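(* Let $\{s_{m,n}\}_{m,n\in\mathbb{Z}_+}$ be a sequence of complex numbers such that $\sum_{m,n,m',n'\in\mathbb{Z}_+}\alpha_{m,n}\overline{\alpha_{m',n'}}\,s_{m+m',n+n'}\ge 0$ for all complex families $(\alpha_{m,n})$ with all but finitely many entries zero. By a solution of the two-dimensional moment problem we mean a non-negative Borel measure $\mu$ on $\mathbb{R}^2$ with $\int_{\mathbb{R}^2}x_1^mx_2^n\,d\mu=s_{m,n}$ for all $m,n\in\mathbb{Z}_+$. Choose and fix an arbitrary model space $\mathcal{H}=\mathcal{H}_0\oplus\bigl(\bigoplus_{j=1}^\infty\mathcal{H}_j\bigr)$ with a sequence $\{h_{m,n}\}_{m,n\in\mathbb{Z}_+}$ in $\mathcal{H}_0$ satisfying $(h_{m,n},h_{m',n'})_{\mathcal{H}_0}=s_{m+m',n+n'}$ for all $m,n,m',n'\in\mathbb{Z}_+$. Then the two-dimensional moment problem has a solution if and only if the following two conditions hold: (a) putting $h_{m,0,0;n,0,0}:=h_{m,n}$, $m,n\in\mathbb{Z}_+$, the scalar equations (E1)–(E10) of the context are satisfied for the vectors $h_{m,0,0;n,0,0}$, i.e. every instance of these equations in which all occurring vectors are of the form $h_{m,0,0;n,0,0}$ holds; (b) $\mathbf{G}\neq\emptyset$, where $\mathbf{G}$ is the set constructed by the algorithm described in the context. Suppose that (a) and (b) are satisfied. To each $(g_1,g_2,\ldots)\in\mathbf{G}$ put into correspondence the sequence $\mathfrak{H}=\{h_{m,k,l;n,r,t}\}_{(m,k,l;n,r,t)\in\Omega}$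 defined by $h_{m,0,0;n,0,0}=h_{m,n}$ for $m,n\in\mathbb{Z}_+$ and $h_{w(r)}:=g_r$ for $r\in\mathbb{N}$. Then $\mathfrak{H}\in X(\mathcal{H})$, and, with $\varphi$ the function associated with $\mathfrak{H}$ in condition 4) of the definition of $X(\mathcal{H})$, the unique non-negative Borel measure $\mu$ on $\mathbb{R}^2$ satisfying $$\int_{\mathbb{R}^2} x_1^m (x_1+i)^k (x_1-i)^l x_2^n (x_2+i)^r (x_2-i)^t\, d\mu = \varphi(m,k,l;n,r,t),\qquad (m,k,l;n,r,t)\in\Omega,$$ is a solution of the two-dimensional moment problem. Moreover, all solutions of the two-dimensional moment problem are obtained in this way.
   Context: **Notation.** $\mathbb{N}$ is the set of positive integers and $\mathbb{Z}_+$ the set of non-negative integers. $\Omega=\{(m,k,l;n,r,t): m,n\in\mathbb{Z}_+,\ k,l,r,t\in\mathbb{Z}\}$, $\Omega_0=\{(m,k,l;n,r,t)\in\Omega: k=l=r=t=0\}$, $\Omega'=\Omega\setminus\Omega_0$. A bijection $w:\mathbb{N}\to\Omega'$ (an arbitrary indexation of $\Omega'$) is fixed. All Hilbert spaces are complex and separable, with scalar product linear in the first argument. Measures are understood to be such that the integrands of the prescribed moments are integrable. **Model space.** A model space is a Hilbert space $\mathcal{H}=\mathcal{H}_0\oplus\bigl(\bigoplus_{j=1}^\infty\mathcal{H}_j\bigr)$ (orthogonal sum), where $\mathcal{H}_0$ is a Hilbert space containing a sequence $\{h_{m,n}\}_{m,n\in\mathbb{Z}_+}$ with $(h_{m,n},h_{m',n'})_{\mathcal{H}_0}=s_{m+m',n+n'}$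 whose closed linear span is $\mathcal{H}_0$, and $\mathcal{H}_j$, $j\in\mathbb{N}$, are arbitrary one-dimensional Hilbert spaces. Fix $e_j\in\mathcal{H}_j$ with $\|e_j\|=1$, and an orthonormal basis $\{g_n\}_{n\ge1}$ of $\mathcal{H}_0$ obtained by Gram–Schmidt orthogonalization from $\{h_{m,n}\}$ indexed by a single index (if $\mathcal{H}_0$ is finite-dimensional the sums over $n$ below are finite). **The set $X(\mathcal{H})$.** It is the set of all sequences $\{h_{m,k,l;n,r,t}\}_{(m,k,l;n,r,t)\in\Omega}$ in $\mathcal{H}$ such that: 1) $h_{m,0,0;n,0,0}=h_{m,n}$, $m,n\in\mathbb{Z}_+$; 2) for some $\Lambda\subseteq\mathbb{N}$, $h_{w(r)}\in\mathcal{H}_0\oplus\bigl(\bigoplus_{j\in\Lambda:\ j\le r}\mathcal{H}_j\bigr)$ for all $r\in\mathbb{N}$; 3) for all $(m,k,l;n,r,t)\in\Omega$: $h_{m+1,k,l;n,r,t}+i h_{m,k,l;n,r,t}=h_{m,k+1,l;n,r,t}$, $h_{m+1,k,l;n,r,t}-i h_{m,k,l;n,r,t}=h_{m,k,l+1;n,r,t}$, $h_{m,k,l;n+1,r,t}+i h_{m,k,l;n,r,t}=h_{m,k,l;n,r+1,t}$, $h_{m,k,l;n+1,r,t}-i h_{m,k,l;n,r,t}=h_{m,k,l;n,r,t+1}$; 4) there is a function $\varphi:\Omega\to\mathbb{C}$ such that $(h_{m,k,l;n,r,t},h_{m',k',l';n',r',t'})_{\mathcal{H}}=\varphi(m+m',k+l',l+k';n+n',r+t',t+r')$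 for all $(m,k,l;n,r,t),(m',k',l';n',r',t')\in\Omega$. **Equations (E1)–(E10).** For all $(m,k,l;n,r,t),(a,b,c;d,e,f)\in\Omega$: (E1) $(h_{m+1,k,l;n,r,t}+i h_{m,k,l;n,r,t},h_{a,b,c;d,e,f})=(h_{m,k+1,l;n,r,t},h_{a,b,c;d,e,f})$; (E2) $(h_{m+1,k,l;n,r,t}-i h_{m,k,l;n,r,t},h_{a,b,c;d,e,f})=(h_{m,k,l+1;n,r,t},h_{a,b,c;d,e,f})$; (E3) $(h_{m,k,l;n+1,r,t}+i h_{m,k,l;n,r,t},h_{a,b,c;d,e,f})=(h_{m,k,l;n,r+1,t},h_{a,b,c;d,e,f})$; (E4) $(h_{m,k,l;n+1,r,t}-i h_{m,k,l;n,r,t},h_{a,b,c;d,e,f})=(h_{m,k,l;n,r,t+1},h_{a,b,c;d,e,f})$. For all $m,m',\widetilde m,\widetilde m',n,n',\widetilde n,\widetilde n'\in\mathbb{Z}_+$ and all integers $k,l,r,t,k',l',r',t',\widetilde k,\widetilde l,\widetilde r,\widetilde t,\widetilde k',\widetilde l',\widetilde r',\widetilde t'$ satisfying the indicated equality: (E5) $(h_{m,k,l;n,r,t},h_{m',k',l';n',r',t'})=(h_{\widetilde m,k,l;n,r,t},h_{\widetilde m',k',l';n',r',t'})$ if $m+m'=\widetilde m+\widetilde m'$; (E6) $(h_{m,k,l;n,r,t},h_{m',k',l';n',r',t'})=(h_{m,\widetilde k,l;n,r,t},h_{m',k',\widetilde l';n',r',t'})$ if $k+l'=\widetilde k+\widetilde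 l'$; (E7) $(h_{m,k,l;n,r,t},h_{m',k',l';n',r',t'})=(h_{m,k,\widetilde l;n,r,t},h_{m',\widetilde k',l';n',r',t'})$ if $l+k'=\widetilde l+\widetilde k'$; (E8) $(h_{m,k,l;n,r,t},h_{m',k',l';n',r',t'})=(h_{m,k,l;\widetilde n,r,t},h_{m',k',l';\widetilde n',r',t'})$ if $n+n'=\widetilde n+\widetilde n'$; (E9) $(h_{m,k,l;n,r,t},h_{m',k',l';n',r',t'})=(h_{m,k,l;n,\widetilde r,t},h_{m',k',l';n',r',\widetilde t'})$ if $r+t'=\widetilde r+\widetilde t'$; (E10) $(h_{m,k,l;n,r,t},h_{m',k',l';n',r',t'})=(h_{m,k,l;n,r,\widetilde t},h_{m',k',l';n',\widetilde r',t'})$ if $t+r'=\widetilde t+\widetilde r'$. **Constants $M_j$.** For each $j\in\mathbb{N}$, with $w(j)=(m,k,l;n,r,t)$, fix a constant $M_j\in(0,\infty)$ depending only on $j$ and the moments $\{s_{m,n}\}$ such that every solution $\mu$ of the two-dimensional moment problem satisfies $$\int_{\mathbb{R}^2}x_1^{2m}(x_1^2+1)^k(x_1^2+1)^l x_2^{2n}(x_2^2+1)^r(x_2^2+1)^t\,d\mu\le M_j .$$ (Such bounds exist, since $(x^2+1)^p\le 1$ for $p<0$ and for non-negative exponents the integral is determined by the moments.) **Algorithm.** Step 0: set $h_{m,0,0;n,0,0}=h_{m,n}$, $m,n\in\mathbb{Z}_+$, and check condition (a) of the claim; if it fails, the algorithm stops. Step 1: write $h_{w(1)}=\sum_{n}\alpha_{1;n}g_n+\beta_1e_1$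 with complex $(\alpha_{1;n})_n$, $\beta_1$, and put $d_1=\|h_{w(1)}\|^2$. The instances of (E1)–(E10) that include $h_{w(1)}$ and otherwise only vectors $h_{m,0,0;n,0,0}$ form a set $L_1$ of linear equations with respect to $(\alpha_{1;n})_n$ and $d_1$ (an inner product of $h_{w(1)}$ with a vector of $\mathcal{H}_0$ is expressed by the $\alpha_{1;n}$, and $(h_{w(1)},h_{w(1)})$ is replaced by $d_1$). Let $S_1$ be the set of solutions $((\alpha_{1;n})_n;d_1)$ of $L_1$, $$\widehat S_1=\Bigl\{((\alpha_{1;n})_n;d_1)\in S_1:\ \sum_n|\alpha_{1;n}|^2\le d_1,\ d_1\le M_1\Bigr\},$$ $$G_1=\Bigl\{\sum_n\alpha_{1;n}g_n+e^{i\theta}\Bigl(d_1-\sum_n|\alpha_{1;n}|^2\Bigr)^{1/2}e_1:\ ((\alpha_{1;n})_n;d_1)\in\widehat S_1,\ \theta\in[0,2\pi)\Bigr\}.$$ Step $r\ge2$: write $h_{w(r)}=\sum_n\alpha_{r;n}g_n+\sum_{j=1}^r\beta_{r;j}e_j$ with complex coefficients and put $d_r=\|h_{w(r)}\|^2$. For given parameters $(h_{w(1)},\ldots,h_{w(r-1)})\in G_{r-1}$, the instances of (E1)–(E10) that include $h_{w(r)}$ and otherwise only the already constructed vectors ($h_{m,0,0;n,0,0}$, $m,n\in\mathbb{Z}_+$, and $h_{w(1)},\ldots,h_{w(r-1)}$) form a set $L_r$ of linear equations with respect to $(\alpha_{r;n})_n$, $\beta_{r;j}$ ($1\le j\le r-1$)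 and $d_r$ (with $(h_{w(r)},h_{w(r)})$ replaced by $d_r$), depending on these parameters. Let $S_r$ be the set of all tuples $((\alpha_{r;n})_n;(\beta_{r;j})_{1\le j\le r-1};d_r;h_{w(1)},\ldots,h_{w(r-1)})$ with $(h_{w(1)},\ldots,h_{w(r-1)})\in G_{r-1}$ for which the equations $L_r$ with these parameters hold; let $\widehat S_r$ be the subset of $S_r$ of tuples with $$\sum_n|\alpha_{r;n}|^2+\sum_{j=1}^{r-1}|\beta_{r;j}|^2\le d_r,\qquad d_r\le M_r;$$ and let $G_r$ be the set of all tuples $$\Bigl(h_{w(1)},\ldots,h_{w(r-1)},\ \sum_n\alpha_{r;n}g_n+\sum_{j=1}^{r-1}\beta_{r;j}e_j+e^{i\theta}\Bigl(d_r-\sum_n|\alpha_{r;n}|^2-\sum_{j=1}^{r-1}|\beta_{r;j}|^2\Bigr)^{1/2}e_r\Bigr)$$ with $((\alpha_{r;n})_n;(\beta_{r;j})_{j\le r-1};d_r;h_{w(1)},\ldots,h_{w(r-1)})\in\widehat S_r$ and $\theta\in[0,2\pi)$. In these linear equations the coefficient sequences $(\alpha_{r;n})_n$ are square-summable, being the coefficients of a vector of $\mathcal{H}$. Final step: let $\mathbf{H}$ be the space of sequences $\mathbf{h}=(h_1,h_2,\ldots)$, $h_r\in\mathcal{H}$, with norm $\|\mathbf{h}\|_{\mathbf{H}}=\sup_{r\in\mathbb{N}}\frac{1}{\sqrt{M_r}}\|h_r\|_{\mathcal{H}}<\infty$. For $r\in\mathbb{N}$ let $$\mathbf{G}_r=\{(h_1,\ldots,h_r,g_{r+1},g_{r+2},\ldots):\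 (h_1,\ldots,h_r)\in G_r,\ g_j\in\mathcal{H},\ \|g_j\|_{\mathcal{H}}\le\sqrt{M_j}\ \text{for } j>r\}\subset\mathbf{H},$$ and set $\mathbf{G}=\bigcap_{r=1}^\infty\mathbf{G}_r$. (In the sequences belonging to $\mathbf{G}_r$ and $\mathbf{G}$ the letters $g_j$ denote arbitrary vectors of $\mathcal{H}$, not the basis vectors.) *)

theory Defs
  imports "HOL-Analysis.Analysis"
begin

section \<open>Complex separable Hilbert spaces\<close>

text \<open>Completeness is part of \<^class>\<open>banach\<close>; for metric spaces separability is the same as
  \<^class>\<open>second_countable_topology\<close>. The scalar product is linear in the \<^emph>\<open>first\<close> argument.\<close>

class separable_chilbert = banach + second_countable_topology +
  fixes scaleC :: "complex \<Rightarrow> 'a \<Rightarrow> 'a"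
    and cinner :: "'a \<Rightarrow> 'a \<Rightarrow> complex"
  assumes scaleC_add_right: "scaleC a (x + y) = scaleC a x + scaleC a y"
    and scaleC_add_left: "scaleC (a + b) x = scaleC a x + scaleC b x"
    and scaleC_scaleC: "scaleC a (scaleC b x) = scaleC (a * b) x"
    and scaleC_one: "scaleC 1 x = x"
    and scaleR_scaleC: "scaleR c x = scaleC (complex_of_real c) x"
    and cinner_add_left: "cinner (x + y) z = cinner x z + cinner y z"
    and cinner_scaleC_left: "cinner (scaleC a x) z = a * cinner x z"
    and cinner_commute: "cinner x y = cnj (cinner y x)"
    and cinner_self: "cinner x x = complex_of_real ((norm x)\<^sup>2)"

interpretation complex_vector: vector_space
  "scaleC :: complex \<Rightarrow> 'a \<Rightarrow> 'a::separable_chilbert"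
  by standard (simp_all add: scaleC_add_right scaleC_add_left scaleC_scaleC scaleC_one)

section \<open>Index sets\<close>

text \<open>The tuple \<open>(m, k, l, n, r, t)\<close> stands for \<open>(m, k, l; n, r, t)\<close>, so \<open>\<Omega>\<close> is the whole type.\<close>

type_synonym idx = "nat \<times> int \<times> int \<times> nat \<times> int \<times> int"

definition Omega0 :: "idx set" where
  "Omega0 = {(m, 0, 0, n, 0, 0) | m n. True}"

definition Omega' :: "idx set" where
  "Omega' = UNIV - Omega0"

section \<open>The moment problem\<close>

definition nonneg_moment_form :: "(nat \<Rightarrow> nat \<Rightarrow> complex) \<Rightarrow> bool" where
  "nonneg_moment_form s \<longleftrightarrow> (\<forall>\<alpha> :: nat \<times> nat \<Rightarrow> complex. finite {p. \<alpha> p \<noteq> 0} \<longrightarrow>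
     (\<Sum>(m, n)\<in>{p. \<alpha> p \<noteq> 0}. \<Sum>(m', n')\<in>{p. \<alpha> p \<noteq> 0}.
        \<alpha> (m, n) * cnj (\<alpha> (m', n')) * s (m + m') (n + n')) \<in> \<real>\<^sub>\<ge>\<^sub>0)"

definition moment_solution :: "(nat \<Rightarrow> nat \<Rightarrow> complex) \<Rightarrow> (real \<times> real) measure \<Rightarrow> bool" where
  "moment_solution s \<mu> \<longleftrightarrow> sets \<mu> = sets borel \<and>
     (\<forall>m n. has_bochner_integral \<mu> (\<lambda>(x\<^sub>1, x\<^sub>2). complex_of_real (x\<^sub>1 ^ m * x\<^sub>2 ^ n)) (s m n))"

definition extended_monomial :: "idx \<Rightarrow> real \<times> real \<Rightarrow> complex" where
  "extended_monomial = (\<lambda>(m, k, l, n, r, t) (x\<^sub>1, x\<^sub>2).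
     complex_of_real x\<^sub>1 ^ m * (complex_of_real x\<^sub>1 + \<i>) powi k * (complex_of_real x\<^sub>1 - \<i>) powi l *
     complex_of_real x\<^sub>2 ^ n * (complex_of_real x\<^sub>2 + \<i>) powi r * (complex_of_real x\<^sub>2 - \<i>) powi t)"

definition extended_moment_solution :: "(idx \<Rightarrow> complex) \<Rightarrow> (real \<times> real) measure \<Rightarrow> bool" where
  "extended_moment_solution \<phi> \<mu> \<longleftrightarrow> sets \<mu> = sets borel \<and>
     (\<forall>p. has_bochner_integral \<mu> (extended_monomial p) (\<phi> p))"

definition bound_integrand :: "idx \<Rightarrow> real \<times> real \<Rightarrow> real" where
  "bound_integrand = (\<lambda>(m, k, l, n, r, t) (x\<^sub>1, x\<^sub>2).
     x\<^sub>1 ^ (2 * m) * (x\<^sub>1\<^sup>2 + 1) powi k * (x\<^sub>1\<^sup>2 + 1) powi l *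
     x\<^sub>2 ^ (2 * n) * (x\<^sub>2\<^sup>2 + 1) powi r * (x\<^sub>2\<^sup>2 + 1) powi t)"

definition admissible_bounds ::
    "(nat \<Rightarrow> nat \<Rightarrow> complex) \<Rightarrow> (nat \<Rightarrow> idx) \<Rightarrow> (nat \<Rightarrow> real) \<Rightarrow> bool" where
  "admissible_bounds s w M \<longleftrightarrow> (\<forall>j\<ge>1. 0 < M j \<and>
     (\<forall>\<mu>. moment_solution s \<mu> \<longrightarrow> (\<integral>x. bound_integrand (w j) x \<partial>\<mu>) \<le> M j))"

section \<open>Model spaces\<close>

definition orth_sum :: "'a::separable_chilbert set \<Rightarrow> (nat \<Rightarrow> 'a set) \<Rightarrow> nat set \<Rightarrow> 'a set" where
  "orth_sum H0 Hj J = closure (complex_vector.span (H0 \<union> (\<Union>j\<in>J. Hj j)))"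

text \<open>The whole type \<open>'a\<close> plays the role of the model space; \<open>H0\<close> and \<open>Hj j\<close> are its summands.\<close>

definition model_space :: "(nat \<Rightarrow> nat \<Rightarrow> complex) \<Rightarrow> (nat \<Rightarrow> nat \<Rightarrow> 'a::separable_chilbert) \<Rightarrow>
    'a set \<Rightarrow> (nat \<Rightarrow> 'a set) \<Rightarrow> bool" where
  "model_space s h H0 Hj \<longleftrightarrow>
     (\<forall>m n m' n'. cinner (h m n) (h m' n') = s (m + m') (n + n')) \<and>
     H0 = closure (complex_vector.span {h m n | m n. True}) \<and>
     (\<forall>j\<ge>1. complex_vector.subspace (Hj j) \<and> complex_vector.dim (Hj j) = 1) \<and>
     (\<forall>j\<ge>1. \<forall>x\<in>H0. \<forall>y\<in>Hj j. cinner x y = 0) \<and>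
     (\<forall>i\<ge>1. \<forall>j\<ge>1. i \<noteq> j \<longrightarrow> (\<forall>x\<in>Hj i. \<forall>y\<in>Hj j. cinner x y = 0)) \<and>
     orth_sum H0 Hj {1..} = UNIV"

text \<open>Residuals of the Gram-Schmidt process. Vectors depending linearly on their predecessors have
  residual 0; since \<open>x / 0 = 0\<close>, they do not contribute to later residuals.\<close>

fun gs_residual :: "(nat \<Rightarrow> 'a::separable_chilbert) \<Rightarrow> nat \<Rightarrow> 'a" where
  "gs_residual v i = v i - (\<Sum>j<i. scaleC
     (cinner (v i) (gs_residual v j) / cinner (gs_residual v j) (gs_residual v j))
     (gs_residual v j))"

declare gs_residual.simps [simp del]

text \<open>\<open>N\<close> is the index set of the basis \<open>g\<close>: all positive integers, or \<open>{1..D}\<close> in the case of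
  finite dimension \<open>D\<close> (possibly \<open>D = 0\<close>).\<close>

definition gram_schmidt_basis ::
    "(nat \<Rightarrow> nat \<Rightarrow> 'a::separable_chilbert) \<Rightarrow> nat set \<Rightarrow> (nat \<Rightarrow> 'a) \<Rightarrow> bool" where
  "gram_schmidt_basis h N g \<longleftrightarrow> (N = {1..} \<or> (\<exists>D. N = {1..D})) \<and>
     (\<exists>(\<tau> :: nat \<Rightarrow> nat \<times> nat) \<iota>. bij \<tau> \<and>
        (let u = gs_residual (\<lambda>i. case_prod h (\<tau> i)) in
           strict_mono_on N \<iota> \<and> bij_betw \<iota> N {i. u i \<noteq> 0} \<and>
           (\<forall>n\<in>N. g n = u (\<iota> n) /\<^sub>R norm (u (\<iota> n)))))"

section \<open>The set \<open>X(H)\<close>\<close>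

definition associated_function :: "(idx \<Rightarrow> 'a::separable_chilbert) \<Rightarrow> (idx \<Rightarrow> complex) \<Rightarrow> bool" where
  "associated_function f \<phi> \<longleftrightarrow> (\<forall>m k l n r t m' k' l' n' r' t'.
     cinner (f (m, k, l, n, r, t)) (f (m', k', l', n', r', t')) =
       \<phi> (m + m', k + l', l + k', n + n', r + t', t + r'))"

definition X_set :: "(nat \<Rightarrow> nat \<Rightarrow> 'a::separable_chilbert) \<Rightarrow> 'a set \<Rightarrow> (nat \<Rightarrow> 'a set) \<Rightarrow>
    (nat \<Rightarrow> idx) \<Rightarrow> (idx \<Rightarrow> 'a) set" where
  "X_set h H0 Hj w = {f.
     (\<forall>m n. f (m, 0, 0, n, 0, 0) = h m n) \<and>
     (\<exists>\<Lambda>\<subseteq>{1..}. \<forall>r\<ge>1. f (w r) \<in> orth_sum H0 Hj {j\<in>\<Lambda>. j \<le> r}) \<and>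
     (\<forall>m k l n r t.
        f (m + 1, k, l, n, r, t) + scaleC \<i> (f (m, k, l, n, r, t)) = f (m, k + 1, l, n, r, t) \<and>
        f (m + 1, k, l, n, r, t) - scaleC \<i> (f (m, k, l, n, r, t)) = f (m, k, l + 1, n, r, t) \<and>
        f (m, k, l, n + 1, r, t) + scaleC \<i> (f (m, k, l, n, r, t)) = f (m, k, l, n, r + 1, t) \<and>
        f (m, k, l, n + 1, r, t) - scaleC \<i> (f (m, k, l, n, r, t)) = f (m, k, l, n, r, t + 1)) \<and>
     (\<exists>\<phi>. associated_function f \<phi>)}"

section \<open>The equations\<close>

text \<open>\<open>eq_instance V E\<close>: there is an instance of one of the ten scalar equations in which exactly the
  vectors \<open>h p\<close>, \<open>p \<in> V\<close>, occur, and \<open>E ip\<close> is this equation with every scalar product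
  \<open>(h p, h q)\<close> replaced by \<open>ip p q\<close>. The sums in the first four equations have been expanded by
  linearity in the first argument, so that individual scalar products can be replaced.\<close>

inductive eq_instance :: "idx set \<Rightarrow> ((idx \<Rightarrow> idx \<Rightarrow> complex) \<Rightarrow> bool) \<Rightarrow> bool" where
  E1: "eq_instance
     {(m + 1, k, l, n, r, t), (m, k, l, n, r, t), (m, k + 1, l, n, r, t), (a, b, c, d, e, f)}
     (\<lambda>ip. ip (m + 1, k, l, n, r, t) (a, b, c, d, e, f) + \<i> * ip (m, k, l, n, r, t) (a, b, c, d, e, f)
         = ip (m, k + 1, l, n, r, t) (a, b, c, d, e, f))"
| E2: "eq_instance
     {(m + 1, k, l, n, r, t), (m, k, l, n, r, t), (m, k, l + 1, n, r, t), (a, b, c, d, e, f)}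
     (\<lambda>ip. ip (m + 1, k, l, n, r, t) (a, b, c, d, e, f) - \<i> * ip (m, k, l, n, r, t) (a, b, c, d, e, f)
         = ip (m, k, l + 1, n, r, t) (a, b, c, d, e, f))"
| E3: "eq_instance
     {(m, k, l, n + 1, r, t), (m, k, l, n, r, t), (m, k, l, n, r + 1, t), (a, b, c, d, e, f)}
     (\<lambda>ip. ip (m, k, l, n + 1, r, t) (a, b, c, d, e, f) + \<i> * ip (m, k, l, n, r, t) (a, b, c, d, e, f)
         = ip (m, k, l, n, r + 1, t) (a, b, c, d, e, f))"
| E4: "eq_instance
     {(m, k, l, n + 1, r, t), (m, k, l, n, r, t), (m, k, l, n, r, t + 1), (a, b, c, d, e, f)}
     (\<lambda>ip. ip (m, k, l, n + 1, r, t) (a, b, c, d, e, f) - \<i> * ip (m, k, l, n, r, t) (a, b, c, d, e, f)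
         = ip (m, k, l, n, r, t + 1) (a, b, c, d, e, f))"
| E5: "m + m' = mm + mm' \<Longrightarrow> eq_instance
     {(m, k, l, n, r, t), (m', k', l', n', r', t'), (mm, k, l, n, r, t), (mm', k', l', n', r', t')}
     (\<lambda>ip. ip (m, k, l, n, r, t) (m', k', l', n', r', t') = ip (mm, k, l, n, r, t) (mm', k', l', n', r', t'))"
| E6: "k + l' = kk + ll' \<Longrightarrow> eq_instance
     {(m, k, l, n, r, t), (m', k', l', n', r', t'), (m, kk, l, n, r, t), (m', k', ll', n', r', t')}
     (\<lambda>ip. ip (m, k, l, n, r, t) (m', k', l', n', r', t') = ip (m, kk, l, n, r, t) (m', k', ll', n', r', t'))"
| E7: "l + k' = ll + kk' \<Longrightarrow> eq_instance
     {(m, k, l, n, r, t), (m', k', l', n', r', t'), (m, k, ll, n, r, t), (m', kk', l', n', r', t')}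
     (\<lambda>ip. ip (m, k, l, n, r, t) (m', k', l', n', r', t') = ip (m, k, ll, n, r, t) (m', kk', l', n', r', t'))"
| E8: "n + n' = nn + nn' \<Longrightarrow> eq_instance
     {(m, k, l, n, r, t), (m', k', l', n', r', t'), (m, k, l, nn, r, t), (m', k', l', nn', r', t')}
     (\<lambda>ip. ip (m, k, l, n, r, t) (m', k', l', n', r', t') = ip (m, k, l, nn, r, t) (m', k', l', nn', r', t'))"
| E9: "r + t' = rr + tt' \<Longrightarrow> eq_instance
     {(m, k, l, n, r, t), (m', k', l', n', r', t'), (m, k, l, n, rr, t), (m', k', l', n', r', tt')}
     (\<lambda>ip. ip (m, k, l, n, r, t) (m', k', l', n', r', t') = ip (m, k, l, n, rr, t) (m', k', l', n', r', tt'))"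
| E10: "t + r' = tt + rr' \<Longrightarrow> eq_instance
     {(m, k, l, n, r, t), (m', k', l', n', r', t'), (m, k, l, n, r, tt), (m', k', l', n', rr', t')}
     (\<lambda>ip. ip (m, k, l, n, r, t) (m', k', l', n', r', t') = ip (m, k, l, n, r, tt) (m', k', l', n', rr', t'))"

section \<open>The algorithm\<close>

text \<open>Finite tuples \<open>(h\<^sub>1, \<dots>, h\<^sub>r)\<close> and sequences \<open>(h\<^sub>1, h\<^sub>2, \<dots>)\<close> are extensional functions on
  \<open>{1..r}\<close> and \<open>{1..}\<close>. The vector attached to an index by the prescribed \<open>h\<close> and a tuple or sequence
  \<open>hs\<close> with \<open>hs j\<close> in the role of the vector with index \<open>w j\<close>:\<close>

definition assemble :: "(nat \<Rightarrow> nat \<Rightarrow> 'a) \<Rightarrow> (nat \<Rightarrow> idx) \<Rightarrow> (nat \<Rightarrow> 'a) \<Rightarrow> idx \<Rightarrow> 'a" where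
  "assemble h w hs p =
     (if p \<in> Omega0 then (case p of (m, _, _, n, _, _) \<Rightarrow> h m n) else hs (inv_into {1..} w p))"

definition condition_a :: "(nat \<Rightarrow> nat \<Rightarrow> 'a::separable_chilbert) \<Rightarrow> bool" where
  "condition_a h \<longleftrightarrow> (\<forall>V E. eq_instance V E \<and> V \<subseteq> Omega0 \<longrightarrow>
     E (\<lambda>(m, _, _, n, _, _) (m', _, _, n', _, _). cinner (h m n) (h m' n')))"

text \<open>The scalar product of \<open>\<Sum>\<^sub>n \<alpha>\<^sub>n g\<^sub>n + \<Sum>\<^sub>j \<beta>\<^sub>j e\<^sub>j + \<beta>\<^sub>r e\<^sub>r\<close> with an already constructed vector \<open>x\<close>;
  the last term drops out because \<open>x\<close> is orthogonal to \<open>e\<^sub>r\<close>.\<close>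

definition coeff_inner :: "nat set \<Rightarrow> (nat \<Rightarrow> 'a::separable_chilbert) \<Rightarrow> (nat \<Rightarrow> 'a) \<Rightarrow> nat \<Rightarrow>
    (nat \<Rightarrow> complex) \<Rightarrow> (nat \<Rightarrow> complex) \<Rightarrow> 'a \<Rightarrow> complex" where
  "coeff_inner N g e r \<alpha> \<beta> x =
     (\<Sum>\<^sub>\<infinity>n\<in>N. \<alpha> n * cinner (g n) x) + (\<Sum>j\<in>{1..<r}. \<beta> j * cinner (e j) x)"

definition step_gram :: "(nat \<Rightarrow> nat \<Rightarrow> 'a::separable_chilbert) \<Rightarrow> nat set \<Rightarrow> (nat \<Rightarrow> 'a) \<Rightarrow>
    (nat \<Rightarrow> 'a) \<Rightarrow> (nat \<Rightarrow> idx) \<Rightarrow> nat \<Rightarrow> (nat \<Rightarrow> complex) \<Rightarrow> (nat \<Rightarrow> complex) \<Rightarrow> real \<Rightarrow> (nat \<Rightarrow> 'a) \<Rightarrow>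
    idx \<Rightarrow> idx \<Rightarrow> complex" where
  "step_gram h N g e w r \<alpha> \<beta> d hs p q =
     (if p = w r \<and> q = w r then complex_of_real d
      else if p = w r then coeff_inner N g e r \<alpha> \<beta> (assemble h w hs q)
      else if q = w r then cnj (coeff_inner N g e r \<alpha> \<beta> (assemble h w hs p))
      else cinner (assemble h w hs p) (assemble h w hs q))"

definition L_holds :: "(nat \<Rightarrow> nat \<Rightarrow> 'a::separable_chilbert) \<Rightarrow> nat set \<Rightarrow> (nat \<Rightarrow> 'a) \<Rightarrow>
    (nat \<Rightarrow> 'a) \<Rightarrow> (nat \<Rightarrow> idx) \<Rightarrow> nat \<Rightarrow> (nat \<Rightarrow> complex) \<Rightarrow> (nat \<Rightarrow> complex) \<Rightarrow> real \<Rightarrow> (nat \<Rightarrow> 'a) \<Rightarrow>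
    bool" where
  "L_holds h N g e w r \<alpha> \<beta> d hs \<longleftrightarrow>
     (\<forall>V E. eq_instance V E \<and> w r \<in> V \<and> V \<subseteq> Omega0 \<union> w ` {1..r} \<longrightarrow>
        E (step_gram h N g e w r \<alpha> \<beta> d hs))"

definition S_set :: "(nat \<Rightarrow> nat \<Rightarrow> 'a::separable_chilbert) \<Rightarrow> nat set \<Rightarrow> (nat \<Rightarrow> 'a) \<Rightarrow>
    (nat \<Rightarrow> 'a) \<Rightarrow> (nat \<Rightarrow> idx) \<Rightarrow> nat \<Rightarrow> (nat \<Rightarrow> 'a) set \<Rightarrow>
    ((nat \<Rightarrow> complex) \<times> (nat \<Rightarrow> complex) \<times> real \<times> (nat \<Rightarrow> 'a)) set" where
  "S_set h N g e w r Gprev = {(\<alpha>, \<beta>, d, hs).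
     hs \<in> Gprev \<and> \<alpha> \<in> extensional N \<and> (\<lambda>n. (cmod (\<alpha> n))\<^sup>2) summable_on N \<and>
     \<beta> \<in> extensional {1..<r} \<and> L_holds h N g e w r \<alpha> \<beta> d hs}"

definition coeff_sq :: "nat set \<Rightarrow> nat \<Rightarrow> (nat \<Rightarrow> complex) \<Rightarrow> (nat \<Rightarrow> complex) \<Rightarrow> real" where
  "coeff_sq N r \<alpha> \<beta> = (\<Sum>\<^sub>\<infinity>n\<in>N. (cmod (\<alpha> n))\<^sup>2) + (\<Sum>j\<in>{1..<r}. (cmod (\<beta> j))\<^sup>2)"

definition S_hat :: "(nat \<Rightarrow> nat \<Rightarrow> 'a::separable_chilbert) \<Rightarrow> nat set \<Rightarrow> (nat \<Rightarrow> 'a) \<Rightarrow>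
    (nat \<Rightarrow> 'a) \<Rightarrow> (nat \<Rightarrow> idx) \<Rightarrow> (nat \<Rightarrow> real) \<Rightarrow> nat \<Rightarrow> (nat \<Rightarrow> 'a) set \<Rightarrow>
    ((nat \<Rightarrow> complex) \<times> (nat \<Rightarrow> complex) \<times> real \<times> (nat \<Rightarrow> 'a)) set" where
  "S_hat h N g e w M r Gprev = {(\<alpha>, \<beta>, d, hs) \<in> S_set h N g e w r Gprev.
     coeff_sq N r \<alpha> \<beta> \<le> d \<and> d \<le> M r}"

definition new_vector :: "nat set \<Rightarrow> (nat \<Rightarrow> 'a::separable_chilbert) \<Rightarrow> (nat \<Rightarrow> 'a) \<Rightarrow> nat \<Rightarrow>
    (nat \<Rightarrow> complex) \<Rightarrow> (nat \<Rightarrow> complex) \<Rightarrow> real \<Rightarrow> real \<Rightarrow> 'a" where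
  "new_vector N g e r \<alpha> \<beta> d \<theta> =
     (\<Sum>\<^sub>\<infinity>n\<in>N. scaleC (\<alpha> n) (g n)) + (\<Sum>j\<in>{1..<r}. scaleC (\<beta> j) (e j)) +
     scaleC (cis \<theta> * complex_of_real (sqrt (d - coeff_sq N r \<alpha> \<beta>))) (e r)"

text \<open>\<open>G_set \<dots> 0\<close> contains just the empty tuple; with it the first step of the algorithm is the
  general step for \<open>r = 1\<close>.\<close>

primrec G_set :: "(nat \<Rightarrow> nat \<Rightarrow> 'a::separable_chilbert) \<Rightarrow> nat set \<Rightarrow> (nat \<Rightarrow> 'a) \<Rightarrow>
    (nat \<Rightarrow> 'a) \<Rightarrow> (nat \<Rightarrow> idx) \<Rightarrow> (nat \<Rightarrow> real) \<Rightarrow> nat \<Rightarrow> (nat \<Rightarrow> 'a) set" where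
  "G_set h N g e w M 0 = {\<lambda>_. undefined}"
| "G_set h N g e w M (Suc r) =
     {hs(Suc r := new_vector N g e (Suc r) \<alpha> \<beta> d \<theta>) | \<alpha> \<beta> d hs \<theta>.
        (\<alpha>, \<beta>, d, hs) \<in> S_hat h N g e w M (Suc r) (G_set h N g e w M r) \<and> \<theta> \<in> {0..<2 * pi}}"

definition bold_H :: "(nat \<Rightarrow> real) \<Rightarrow> (nat \<Rightarrow> 'a::separable_chilbert) set" where
  "bold_H M = {hs \<in> extensional {1..}. bdd_above ((\<lambda>r. 1 / sqrt (M r) * norm (hs r)) ` {1..})}"

definition bold_G_step :: "(nat \<Rightarrow> nat \<Rightarrow> 'a::separable_chilbert) \<Rightarrow> nat set \<Rightarrow> (nat \<Rightarrow> 'a) \<Rightarrow>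
    (nat \<Rightarrow> 'a) \<Rightarrow> (nat \<Rightarrow> idx) \<Rightarrow> (nat \<Rightarrow> real) \<Rightarrow> nat \<Rightarrow> (nat \<Rightarrow> 'a) set" where
  "bold_G_step h N g e w M r = {hs \<in> bold_H M.
     restrict hs {1..r} \<in> G_set h N g e w M r \<and> (\<forall>j>r. norm (hs j) \<le> sqrt (M j))}"

definition bold_G :: "(nat \<Rightarrow> nat \<Rightarrow> 'a::separable_chilbert) \<Rightarrow> nat set \<Rightarrow> (nat \<Rightarrow> 'a) \<Rightarrow>
    (nat \<Rightarrow> 'a) \<Rightarrow> (nat \<Rightarrow> idx) \<Rightarrow> (nat \<Rightarrow> real) \<Rightarrow> (nat \<Rightarrow> 'a) set" where
  "bold_G h N g e w M = (\<Inter>r\<in>{1..}. bold_G_step h N g e w M r)"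

end

theory Submission
  imports Defs "HOL-Probability.Helly_Selection"
begin

text \<open>The link between measures and sequences of vectors are the extended moments, the integrals of
  \<open>x\<^sub>1^m (x\<^sub>1 + \<i>)^k (x\<^sub>1 - \<i>)^l x\<^sub>2^n (x\<^sub>2 + \<i>)^r (x\<^sub>2 - \<i>)^t\<close> with integer exponents on \<open>x\<^sub>j \<plusminus> \<i>\<close>. Positivity
  of the ordinary moments does not yield a measure in dimension two, but positivity of the extended
  moments does: this is what makes the algorithm a criterion.

  \<^emph>\<open>From sequences to measures.\<close> An equation involves finitely many vectors, so a sequence that
  survives all steps of the algorithm satisfies all equations (\<open>bold_G_sound\<close>). By (E5)-(E10) its
  Gram matrix depends only on the sum of the indices and thus defines a function \<open>\<phi>\<close>; by (E1)-(E4),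
  tested against all vectors of the sequence, the four relations hold between the vectors themselves.
  To represent \<open>\<phi>\<close> by a measure, put \<open>z = (x - \<i>) / (x + \<i>)\<close> in both variables. For fixed \<open>K\<close> the
  vectors with exponents \<open>(K - a, a; K - b, b)\<close> have a Gram matrix depending on differences only, and
  the theorem of Herglotz and Bochner on \<open>\<int>\<^sup>2\<close> provides a measure \<open>\<nu>\<^sub>K\<close> on the torus. It plays the role of
  \<open>(x\<^sub>1\<^sup>2 + 1)^K (x\<^sub>2\<^sup>2 + 1)^K \<mu>\<close>; dividing by this weight removes the lines \<open>z\<^sub>j = 1\<close>, which correspond to
  infinity, and produces a measure \<open>\<mu>\<^sub>K\<close> on the plane with the right moments as long as
  \<open>k + l < 2K\<close> and \<open>r + t < 2K\<close>. A finite measure on the torus is determined by its trigonometric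
  moments (\<open>torus_measure_unique\<close>), so all \<open>\<mu>\<^sub>K\<close> coincide, and the common value has all extended moments
  (\<open>extended_moment_solution_exists\<close>). The same argument gives uniqueness.

  \<^emph>\<open>The theorem of Herglotz and Bochner.\<close> Averaging a positive definite function over a square of side
  \<open>n\<close> gives nonnegative weights on a grid of the torus, whose trigonometric moments are Fejer means of
  the function (\<open>fejer_weights\<close>). A limit measure is obtained by Helly's selection theorem on the
  line: the grid points lie on a continuous square-filling curve, so that the weights can be moved to
  its parameter interval and the limit can be pushed forward.

  \<^emph>\<open>From measures to sequences.\<close> The extended monomials of a solution \<open>\<mu>\<close> satisfy all equations with
  the scalar product of \<open>L\<^sup>2(\<mu>)\<close>. They are copied into the model space one at a time: the scalar
  products which the next vector must have with its predecessors form a bounded functional on their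
  span, hence are realised by a vector of the closed span (\<open>one_step_extension\<close>), and the missing
  part of the norm is supplied by the fresh unit vector of the step. The bound on the norm is the
  admissibility of the constants, so every step of the algorithm accepts the vector
  (\<open>solution_in_bold_G\<close>).\<close>

section \<open>Geometry of complex Hilbert spaces\<close>

lemma cinner_add_right: "cinner x (y + z) = cinner x y + cinner x (z :: 'a::separable_chilbert)"
  by (metis cinner_add_left cinner_commute complex_cnj_add)

lemma cinner_scaleC_right: "cinner x (scaleC a y) = cnj a * cinner x (y :: 'a::separable_chilbert)"
  by (metis cinner_scaleC_left cinner_commute complex_cnj_mult)

lemma scaleC_zero_right [simp]: "scaleC c (0 :: 'a::separable_chilbert) = 0"
  by (rule complex_vector.scale_zero_right)

lemma cinner_zero [simp]: "cinner 0 x = 0" "cinner x (0 :: 'a::separable_chilbert) = 0"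
  using cinner_scaleC_left[of 0 x x] cinner_scaleC_right[of x 0 x] by simp_all

lemma cinner_minus [simp]:
  "cinner (- x) y = - cinner x (y :: 'a::separable_chilbert)" "cinner x (- y) = - cinner x y"
  using cinner_add_left[of x "- x" y] cinner_add_right[of x y "- y"] by (simp_all add: eq_neg_iff_add_eq_0 add.commute)

lemma cinner_diff_left: "cinner (x - y) z = cinner x z - cinner y (z :: 'a::separable_chilbert)"
  using cinner_add_left[of x "- y" z] by simp

lemma cinner_diff_right: "cinner x (y - z) = cinner x y - cinner x (z :: 'a::separable_chilbert)"
  using cinner_add_right[of x y "- z"] by simp

lemma cinner_sum_left: "cinner (sum f A) y = (\<Sum>i\<in>A. cinner (f i) (y :: 'a::separable_chilbert))"
  by (induction A rule: infinite_finite_induct) (auto simp: cinner_add_left)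

lemma cinner_sum_right: "cinner y (sum f A) = (\<Sum>i\<in>A. cinner y (f i :: 'a::separable_chilbert))"
  by (induction A rule: infinite_finite_induct) (auto simp: cinner_add_right)

lemma cinner_eq_0_iff [simp]: "cinner x x = 0 \<longleftrightarrow> x = (0 :: 'a::separable_chilbert)"
  by (simp add: cinner_self)

lemma norm_eq_sqrt_cinner: "(norm x)\<^sup>2 = Re (cinner x (x :: 'a::separable_chilbert))"
  by (simp add: cinner_self)

lemma norm_scaleC: "norm (scaleC c x) = cmod c * norm (x :: 'a::separable_chilbert)"
proof -
  have "(norm (scaleC c x))\<^sup>2 = Re ((c * cnj c) * cinner x x)"
    unfolding norm_eq_sqrt_cinner cinner_scaleC_left cinner_scaleC_right by (simp only: mult.assoc mult.left_commute)
  also have "\<dots> = (cmod c * norm x)\<^sup>2"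
    by (simp add: cinner_self complex_norm_square[symmetric] power_mult_distrib del: of_real_power)
  finally show ?thesis by simp
qed

lemma norm_diff_square:
  "(norm (x - y))\<^sup>2 = (norm x)\<^sup>2 - 2 * Re (cinner x y) + (norm (y :: 'a::separable_chilbert))\<^sup>2"
proof -
  have "Re (cinner y x) = Re (cinner x y)" by (subst cinner_commute) simp
  then show ?thesis
    unfolding norm_eq_sqrt_cinner by (simp add: cinner_diff_left cinner_diff_right)
qed

lemma norm_add_square:
  "(norm (x + y))\<^sup>2 = (norm x)\<^sup>2 + 2 * Re (cinner x y) + (norm (y :: 'a::separable_chilbert))\<^sup>2"
  using norm_diff_square[of x "- y"] by simp

lemma Cauchy_Schwarz_cinner: "cmod (cinner x y) \<le> norm x * norm (y :: 'a::separable_chilbert)"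
proof (cases "y = 0")
  case False
  define c where "c = cinner x y / cinner y y"
  have "0 \<le> (norm (x - scaleC c y))\<^sup>2" by simp
  also have "\<dots> = (norm x)\<^sup>2 - 2 * Re (cnj c * cinner x y) + (cmod c * norm y)\<^sup>2"
    unfolding norm_diff_square cinner_scaleC_right norm_scaleC ..
  also have "cnj c * cinner x y = complex_of_real ((cmod (cinner x y))\<^sup>2 / (norm y)\<^sup>2)"
    unfolding c_def cinner_self[of y] of_real_divide complex_norm_square by (simp add: mult.commute)
  also have "(cmod c * norm y)\<^sup>2 = (cmod (cinner x y))\<^sup>2 / (norm y)\<^sup>2"
  proof -
    have "cmod c = cmod (cinner x y) / (norm y)\<^sup>2"
      by (simp add: c_def cinner_self norm_divide norm_power del: of_real_power)
    then show ?thesis using False by (simp add: power2_eq_square field_simps)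
  qed
  finally have "(cmod (cinner x y))\<^sup>2 / (norm y)\<^sup>2 \<le> (norm x)\<^sup>2" by simp
  then have "(cmod (cinner x y))\<^sup>2 \<le> (norm x * norm y)\<^sup>2"
    using False by (simp add: divide_le_eq power_mult_distrib)
  then show ?thesis by (rule power2_le_imp_le) simp
qed simp

lemma bounded_linear_cinner_left: "bounded_linear (\<lambda>x. cinner x (y :: 'a::separable_chilbert))"
  by (rule bounded_linear_intro[where K = "norm y"])
    (auto simp: cinner_add_left scaleR_scaleC cinner_scaleC_left Cauchy_Schwarz_cinner scaleR_conv_of_real)

lemma bounded_linear_cinner_right: "bounded_linear (\<lambda>x. cinner (y :: 'a::separable_chilbert) x)"
  by (rule bounded_linear_intro[where K = "norm y"])
    (auto simp: cinner_add_right scaleR_scaleC cinner_scaleC_right Cauchy_Schwarz_cinner scaleR_conv_of_real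
       mult.commute[of "norm _" "norm y"])

lemma bounded_linear_scaleC_right: "bounded_linear (\<lambda>x. scaleC c (x :: 'a::separable_chilbert))"
  by (rule bounded_linear_intro[where K = "cmod c"])
    (auto simp: scaleC_add_right scaleR_scaleC scaleC_scaleC norm_scaleC mult.commute)

lemmas tendsto_cinner_left = bounded_linear.tendsto[OF bounded_linear_cinner_left]
lemmas tendsto_cinner_right = bounded_linear.tendsto[OF bounded_linear_cinner_right]

abbreviation cspan :: "'a::separable_chilbert set \<Rightarrow> 'a set" where
  "cspan \<equiv> complex_vector.span"

definition closed_cspan :: "'a::separable_chilbert set \<Rightarrow> 'a set" where
  "closed_cspan S = closure (cspan S)"

lemma closed_cspan_superset: "x \<in> S \<Longrightarrow> x \<in> closed_cspan S"
  unfolding closed_cspan_def using closure_subset complex_vector.span_base by blast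

lemma subspace_closure:
  fixes S :: "'a::separable_chilbert set"
  assumes "complex_vector.subspace S"
  shows "complex_vector.subspace (closure S)"
proof (rule complex_vector.subspaceI)
  show "0 \<in> closure S" using complex_vector.subspace_0[OF assms] closure_subset by blast
  fix x y assume "x \<in> closure S" "y \<in> closure S"
  then obtain f g where f: "\<And>n. f n \<in> S" "f \<longlonglongrightarrow> x" and g: "\<And>n. g n \<in> S" "g \<longlonglongrightarrow> y"
    unfolding closure_sequential by blast
  have "\<And>n. f n + g n \<in> S" using f g complex_vector.subspace_add[OF assms] by blast
  then show "x + y \<in> closure S"
    unfolding closure_sequential using tendsto_add[OF f(2) g(2)] by (intro exI[of _ "\<lambda>n. f n + g n"]) blast
  fix c
  have "\<And>n. scaleC c (f n) \<in> S" using f complex_vector.subspace_scale[OF assms] by blast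
  then show "scaleC c x \<in> closure S"
    unfolding closure_sequential using bounded_linear.tendsto[OF bounded_linear_scaleC_right f(2)]
    by (intro exI[of _ "\<lambda>n. scaleC c (f n)"]) blast
qed

lemma subspace_closed_cspan: "complex_vector.subspace (closed_cspan S)"
  unfolding closed_cspan_def by (intro subspace_closure complex_vector.subspace_span)

lemma closed_closed_cspan: "closed (closed_cspan S)"
  by (simp add: closed_cspan_def)

lemma closed_cspan_minimal:
  assumes "S \<subseteq> V" "complex_vector.subspace V" "closed V"
  shows "closed_cspan S \<subseteq> V"
  unfolding closed_cspan_def using assms complex_vector.span_minimal by (intro closure_minimal) auto

lemma closed_cspan_mono: "S \<subseteq> T \<Longrightarrow> closed_cspan S \<subseteq> closed_cspan T"
  unfolding closed_cspan_def by (intro closure_mono complex_vector.span_mono)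

lemma orthogonal_closed_cspan:
  fixes y :: "'a::separable_chilbert"
  assumes "\<And>x. x \<in> S \<Longrightarrow> cinner x y = 0" "x \<in> closed_cspan S"
  shows "cinner x y = 0"
proof -
  let ?V = "{x. cinner x y = 0}"
  have "closed_cspan S \<subseteq> ?V"
  proof (rule closed_cspan_minimal)
    show "complex_vector.subspace ?V"
      by (rule complex_vector.subspaceI) (auto simp: cinner_add_left cinner_scaleC_left)
    show "closed ?V"
      by (intro closed_Collect_eq continuous_intros linear_continuous_on bounded_linear_cinner_left)
  qed (use assms in auto)
  then show ?thesis using assms(2) by blast
qed

lemma orthogonal_complement_trivial:
  fixes y :: "'a::separable_chilbert"
  assumes "\<And>x. x \<in> S \<Longrightarrow> cinner x y = 0" "y \<in> closed_cspan S"
  shows "y = 0"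
  using orthogonal_closed_cspan[OF assms] by simp

section \<open>Orthonormal series\<close>

definition orthonormal_on :: "'i set \<Rightarrow> ('i \<Rightarrow> 'a::separable_chilbert) \<Rightarrow> bool" where
  "orthonormal_on I b \<longleftrightarrow> (\<forall>i\<in>I. \<forall>j\<in>I. cinner (b i) (b j) = (if i = j then 1 else 0))"

lemma orthonormal_norm_sum:
  assumes "orthonormal_on I b" "finite F" "F \<subseteq> I"
  shows "(norm (\<Sum>i\<in>F. scaleC (\<alpha> i) (b i)))\<^sup>2 = (\<Sum>i\<in>F. (cmod (\<alpha> i))\<^sup>2)"
proof -
  let ?s = "\<Sum>i\<in>F. scaleC (\<alpha> i) (b i)"
  have "cinner ?s (b j) = \<alpha> j" if "j \<in> F" for j
  proof -
    have "cinner ?s (b j) = (\<Sum>i\<in>F. if i = j then \<alpha> i else 0)"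
      unfolding cinner_sum_left cinner_scaleC_left
      using assms that by (intro sum.cong) (auto simp: orthonormal_on_def subset_eq)
    then show ?thesis using assms(2) that by simp
  qed
  then have "cinner ?s ?s = (\<Sum>i\<in>F. \<alpha> i * cnj (\<alpha> i))"
    by (subst cinner_sum_right) (simp add: cinner_scaleC_right mult.commute)
  also have "\<dots> = complex_of_real (\<Sum>i\<in>F. (cmod (\<alpha> i))\<^sup>2)"
    unfolding complex_norm_square[symmetric] by simp
  finally show ?thesis unfolding norm_eq_sqrt_cinner by simp
qed

text \<open>The partial sums form a Cauchy net: by the theorem of Pythagoras, the squared distance of two of them
  is governed by tails of the sum of squares. The series need not converge absolutely, so there is no
  comparison with the norms of its terms.\<close>

lemma orthonormal_series_summable:
  fixes b :: "'i \<Rightarrow> 'a::separable_chilbert"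
  assumes b: "orthonormal_on I b" and \<alpha>: "(\<lambda>i. (cmod (\<alpha> i))\<^sup>2) summable_on I"
  shows "(\<lambda>i. scaleC (\<alpha> i) (b i)) summable_on I"
proof -
  let ?f = "\<lambda>i. scaleC (\<alpha> i) (b i)" and ?q = "\<lambda>i. (cmod (\<alpha> i))\<^sup>2"
  obtain L where L: "(sum ?q \<longlongrightarrow> L) (finite_subsets_at_top I)"
    using \<alpha> by (auto simp: summable_on_def has_sum_def)
  have "\<exists>P. eventually P (finite_subsets_at_top I) \<and> (\<forall>F G. P F \<and> P G \<longrightarrow> dist (sum ?f F) (sum ?f G) < e)"
    if "e > 0" for e :: real
  proof -
    \<comment> \<open>Sums of squares within \<open>d\<close> of their limit differ by less than \<open>2 d = (e / 2)\<^sup>2\<close>.\<close>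
    define d where "d = (e / 2)\<^sup>2 / 2"
    have "d > 0" using \<open>e > 0\<close> by (simp add: d_def)
    then have "\<forall>\<^sub>F F in finite_subsets_at_top I. dist (sum ?q F) L < d"
      using L tendstoD by blast
    then obtain F0 where F0: "finite F0" "F0 \<subseteq> I" and
      F0_close: "\<forall>F. finite F \<and> F0 \<subseteq> F \<and> F \<subseteq> I \<longrightarrow> dist (sum ?q F) L < d"
      unfolding eventually_finite_subsets_at_top by (elim exE conjE)
    define P where "P F \<longleftrightarrow> finite F \<and> F0 \<subseteq> F \<and> F \<subseteq> I" for F
    have near: "norm (sum ?f (F \<union> G) - sum ?f F) < e / 2" if "P F" "P G" for F G
    proof -
      have fin: "finite F" "finite G" "F \<subseteq> I" "G \<subseteq> I" "F0 \<subseteq> F" using that by (auto simp: P_def)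
      have "sum ?f (F \<union> G) - sum ?f F = sum ?f (G - F)"
        using fin sum.union_disjoint[of F "G - F" ?f] by simp
      moreover have "(norm (sum ?f (G - F)))\<^sup>2 = sum ?q (G - F)"
        using fin by (intro orthonormal_norm_sum[OF b]) auto
      moreover have "sum ?q (G - F) = sum ?q (F \<union> G) - sum ?q F"
        using fin sum.union_disjoint[of F "G - F" ?q] by simp
      ultimately have "(norm (sum ?f (F \<union> G) - sum ?f F))\<^sup>2 = sum ?q (F \<union> G) - sum ?q F"
        by (simp only:)
      moreover have "dist (sum ?q (F \<union> G)) L < d" "dist (sum ?q F) L < d"
        using fin by (intro F0_close[rule_format]; auto)+
      ultimately have "(norm (sum ?f (F \<union> G) - sum ?f F))\<^sup>2 < (e / 2)\<^sup>2"
        unfolding d_def dist_real_def by linarith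
      then show ?thesis by (rule power2_less_imp_less) (use \<open>e > 0\<close> in simp)
    qed
    have "dist (sum ?f F) (sum ?f G) < e" if "P F" "P G" for F G
    proof -
      have "dist (sum ?f F) (sum ?f G) \<le> dist (sum ?f (F \<union> G)) (sum ?f F) + dist (sum ?f (F \<union> G)) (sum ?f G)"
        by (rule dist_triangle3)
      also have "\<dots> < e / 2 + e / 2"
        using near[OF that] near[OF that(2,1)] by (intro add_strict_mono) (simp_all add: dist_norm Un_commute)
      finally show ?thesis by simp
    qed
    moreover have "eventually P (finite_subsets_at_top I)"
      unfolding eventually_finite_subsets_at_top P_def using F0 by blast
    ultimately show ?thesis by blast
  qed
  then have "cauchy_filter (filtermap (sum ?f) (finite_subsets_at_top I))"
    by (simp add: cauchy_filter_metric_filtermap)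
  moreover have "complete (UNIV :: 'a set)"
    by (meson Cauchy_convergent UNIV_I complete_def convergent_def)
  ultimately obtain v where "(sum ?f \<longlongrightarrow> v) (finite_subsets_at_top I)"
    using complete_uniform[where S = UNIV] by (force simp add: filterlim_def)
  then show ?thesis by (auto simp: summable_on_def has_sum_def)
qed

text \<open>Scalar products are continuous and may be taken under the sum; doing so with \<open>v\<close> itself in the second
  argument gives Parseval's identity.\<close>

lemma orthonormal_series:
  fixes b :: "'i \<Rightarrow> 'a::separable_chilbert"
  assumes b: "orthonormal_on I b" and \<alpha>: "(\<lambda>i. (cmod (\<alpha> i))\<^sup>2) summable_on I"
  defines "v \<equiv> (\<Sum>\<^sub>\<infinity>i\<in>I. scaleC (\<alpha> i) (b i))"
  shows "cinner v x = (\<Sum>\<^sub>\<infinity>i\<in>I. \<alpha> i * cinner (b i) x)"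
    and "i \<in> I \<Longrightarrow> cinner v (b i) = \<alpha> i"
    and "(norm v)\<^sup>2 = (\<Sum>\<^sub>\<infinity>i\<in>I. (cmod (\<alpha> i))\<^sup>2)"
    and "v \<in> closed_cspan (b ` I)"
proof -
  have v: "((\<lambda>i. scaleC (\<alpha> i) (b i)) has_sum v) I"
    unfolding v_def using orthonormal_series_summable[OF b \<alpha>] by simp
  have hs: "((\<lambda>i. \<alpha> i * cinner (b i) x) has_sum cinner v x) I" for x
    using has_sum_bounded_linear[OF bounded_linear_cinner_left v] by (simp add: cinner_scaleC_left)
  then show 1: "cinner v x = (\<Sum>\<^sub>\<infinity>i\<in>I. \<alpha> i * cinner (b i) x)" for x
    by (metis infsumI)
  show c: "cinner v (b i) = \<alpha> i" if "i \<in> I" for i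
  proof -
    have "cinner v (b i) = (\<Sum>\<^sub>\<infinity>j\<in>I. if j = i then \<alpha> i else 0)"
      unfolding 1 using b that by (intro infsum_cong) (auto simp: orthonormal_on_def)
    also have "\<dots> = (\<Sum>\<^sub>\<infinity>j\<in>{i}. if j = i then \<alpha> i else 0)"
      using that by (intro infsum_cong_neutral) auto
    finally show ?thesis by simp
  qed
  have "((\<lambda>i. complex_of_real ((cmod (\<alpha> i))\<^sup>2)) has_sum cinner v v) I"
  proof (rule iffD1[OF has_sum_cong hs])
    fix i assume "i \<in> I"
    then have "cinner (b i) v = cnj (\<alpha> i)" using c cinner_commute[of "b i" v] by simp
    then show "\<alpha> i * cinner (b i) v = complex_of_real ((cmod (\<alpha> i))\<^sup>2)" by (simp only: complex_norm_square)
  qed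
  then have "((\<lambda>i. (cmod (\<alpha> i))\<^sup>2) has_sum (norm v)\<^sup>2) I"
    unfolding cinner_self by (simp only: has_sum_of_real_iff)
  then show "(norm v)\<^sup>2 = (\<Sum>\<^sub>\<infinity>i\<in>I. (cmod (\<alpha> i))\<^sup>2)" by (metis infsumI)
  show "v \<in> closed_cspan (b ` I)"
  proof -
    have "(sum (\<lambda>i. scaleC (\<alpha> i) (b i)) \<longlongrightarrow> v) (finite_subsets_at_top I)"
      using v by (simp add: has_sum_def)
    moreover have "\<forall>\<^sub>F F in finite_subsets_at_top I. sum (\<lambda>i. scaleC (\<alpha> i) (b i)) F \<in> closed_cspan (b ` I)"
      using eventually_finite_subsets_at_top_weakI[of I]
      by (intro eventually_finite_subsets_at_top_weakI complex_vector.subspace_sum subspace_closed_cspan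
          complex_vector.subspace_scale closed_cspan_superset) auto
    ultimately show ?thesis
      using Lim_in_closed_set[OF closed_closed_cspan] finite_subsets_at_top_neq_bot by blast
  qed
qed

text \<open>Bessel's inequality: the squared distance of \<open>y\<close> to its projection on finitely many basis vectors is
  nonnegative, which bounds the partial sums by the squared norm of \<open>y\<close>.\<close>

lemma bessel_summable:
  fixes b :: "'i \<Rightarrow> 'a::separable_chilbert"
  assumes b: "orthonormal_on I b"
  shows "(\<lambda>i. (cmod (cinner y (b i)))\<^sup>2) summable_on I"
proof -
  let ?\<alpha> = "\<lambda>i. cinner y (b i)"
  show "(\<lambda>i. (cmod (?\<alpha> i))\<^sup>2) summable_on I"
  proof (rule nonneg_bdd_above_summable_on)
    show "bdd_above (sum (\<lambda>i. (cmod (?\<alpha> i))\<^sup>2) ` {F. F \<subseteq> I \<and> finite F})"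
    proof (rule bdd_aboveI2[where M = "(norm y)\<^sup>2"])
      fix F assume "F \<in> {F. F \<subseteq> I \<and> finite F}"
      then have F: "finite F" "F \<subseteq> I" by auto
      let ?s = "\<Sum>i\<in>F. scaleC (?\<alpha> i) (b i)"
      have "cinner y ?s = (\<Sum>i\<in>F. cnj (?\<alpha> i) * ?\<alpha> i)"
        by (simp add: cinner_sum_right cinner_scaleC_right)
      also have "\<dots> = complex_of_real (\<Sum>i\<in>F. (cmod (?\<alpha> i))\<^sup>2)"
        unfolding of_real_sum complex_norm_square by (simp add: mult.commute)
      finally have "Re (cinner y ?s) = (\<Sum>i\<in>F. (cmod (?\<alpha> i))\<^sup>2)" by simp
      moreover have "0 \<le> (norm (y - ?s))\<^sup>2" by simp
      ultimately show "(\<Sum>i\<in>F. (cmod (?\<alpha> i))\<^sup>2) \<le> (norm y)\<^sup>2"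
        unfolding norm_diff_square orthonormal_norm_sum[OF b F] by simp
    qed
  qed simp
qed

section \<open>Riesz representation\<close>

text \<open>A linear functional on a subspace is given by its graph \<open>D\<close>, so that a functional prescribed on
  linearly dependent vectors need not be shown to be well defined beforehand. The bound says that
  \<open>J v = \<parallel>v\<parallel>\<^sup>2 - 2 Re z\<close> is at least \<open>- \<kappa>\<close>. A minimising sequence of \<open>J\<close> is a Cauchy sequence by the
  parallelogram law, and the vanishing first variation at its limit \<open>y\<close> says that \<open>y\<close> represents the
  functional.\<close>

lemma riesz_representation:
  fixes D :: "('a::separable_chilbert \<times> complex) set"
  assumes D0: "(0, 0) \<in> D"
    and add: "\<And>v z v' z'. (v, z) \<in> D \<Longrightarrow> (v', z') \<in> D \<Longrightarrow> (v + v', z + z') \<in> D"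
    and scale: "\<And>c v z. (v, z) \<in> D \<Longrightarrow> (scaleC c v, c * z) \<in> D"
    and bound: "\<And>v z. (v, z) \<in> D \<Longrightarrow> 2 * Re z \<le> (norm v)\<^sup>2 + \<kappa>"
  obtains y where "y \<in> closure (fst ` D)" "\<And>v z. (v, z) \<in> D \<Longrightarrow> cinner v y = z" "(norm y)\<^sup>2 \<le> \<kappa>"
proof -
  define J where "J p = (norm (fst p))\<^sup>2 - 2 * Re (snd p)" for p :: "'a \<times> complex"
  define \<delta> where "\<delta> = Inf (J ` D)"
  have bdd: "bdd_below (J ` D)" using bound by (intro bdd_belowI2[where m = "- \<kappa>"]) (force simp: J_def)
  have \<delta>: "\<delta> \<le> J p" if "p \<in> D" for p
    unfolding \<delta>_def using bdd that by (intro cInf_lower) auto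
  have "\<exists>p\<in>D. J p < \<delta> + 1 / Suc n" for n
    using cInf_lessD[of "J ` D" "\<delta> + 1 / Suc n"] D0 by (force simp: \<delta>_def)
  then obtain p where p: "\<And>n. p n \<in> D" "\<And>n. J (p n) < \<delta> + 1 / Suc n" by metis
  \<comment> \<open>The parallelogram law at the midpoint of two elements of the graph.\<close>
  have par: "(norm (fst a - fst b))\<^sup>2 \<le> 2 * (J a - \<delta>) + 2 * (J b - \<delta>)" if "a \<in> D" "b \<in> D" for a b
  proof -
    have "(scaleC (1/2) (fst a) + scaleC (1/2) (fst b), (1/2) * snd a + (1/2) * snd b) \<in> D"
      using add scale that by (metis prod.collapse)
    from \<delta>[OF this] have "\<delta> \<le> (norm (scaleC (1/2) (fst a + fst b)))\<^sup>2 - (Re (snd a) + Re (snd b))"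
      by (simp add: J_def scaleC_add_right)
    also have "(norm (scaleC (1/2) (fst a + fst b)))\<^sup>2 = (norm (fst a + fst b))\<^sup>2 / 4"
      by (simp add: norm_scaleC power_mult_distrib power_divide)
    finally have "4 * \<delta> \<le> (norm (fst a + fst b))\<^sup>2 - 4 * (Re (snd a) + Re (snd b))" by simp
    moreover have "(norm (fst a + fst b))\<^sup>2 + (norm (fst a - fst b))\<^sup>2 = 2 * (norm (fst a))\<^sup>2 + 2 * (norm (fst b))\<^sup>2"
      unfolding norm_add_square norm_diff_square by simp
    ultimately show ?thesis by (simp add: J_def)
  qed
  have "Cauchy (\<lambda>n. fst (p n))"
  proof (rule metric_CauchyI)
    fix e :: real assume "e > 0"
    then obtain N where N: "1 / real (Suc N) < e\<^sup>2 / 4"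
      using reals_Archimedean[of "e\<^sup>2 / 4"] by (auto simp: inverse_eq_divide)
    have "dist (fst (p m)) (fst (p n)) < e" if "m \<ge> N" "n \<ge> N" for m n
    proof -
      have "1 / real (Suc k) \<le> 1 / real (Suc N)" if "k \<ge> N" for k using that by (simp add: field_simps)
      then have "J (p m) - \<delta> < e\<^sup>2 / 4" "J (p n) - \<delta> < e\<^sup>2 / 4" using p(2)[of m] p(2)[of n] N that by (smt (verit))+
      then have "2 * (J (p m) - \<delta>) + 2 * (J (p n) - \<delta>) < 2 * (e\<^sup>2 / 4) + 2 * (e\<^sup>2 / 4)"
        by (intro add_strict_mono mult_strict_left_mono) auto
      with par[OF p(1) p(1), of m n] have "(norm (fst (p m) - fst (p n)))\<^sup>2 < 2 * (e\<^sup>2 / 4) + 2 * (e\<^sup>2 / 4)"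
        by (rule le_less_trans)
      then have "(norm (fst (p m) - fst (p n)))\<^sup>2 < e\<^sup>2" by simp
      then show ?thesis using \<open>e > 0\<close> by (simp add: dist_norm power2_less_imp_less)
    qed
    then show "\<exists>N. \<forall>m\<ge>N. \<forall>n\<ge>N. dist (fst (p m)) (fst (p n)) < e" by blast
  qed
  then obtain y where y: "(\<lambda>n. fst (p n)) \<longlonglongrightarrow> y" using Cauchy_convergent convergent_def by blast
  have lim_J: "(\<lambda>n. J (p n)) \<longlonglongrightarrow> \<delta>"
  proof (rule tendsto_sandwich[where f = "\<lambda>_. \<delta>" and h = "\<lambda>n. \<delta> + 1 / Suc n"])
    show "(\<lambda>n. \<delta> + 1 / Suc n) \<longlonglongrightarrow> \<delta>"
      using tendsto_add[OF tendsto_const LIMSEQ_inverse_real_of_nat, of \<delta>] by (simp add: inverse_eq_divide)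
    show "\<forall>\<^sub>F n in sequentially. J (p n) \<le> \<delta> + 1 / Suc n" "\<forall>\<^sub>F n in sequentially. \<delta> \<le> J (p n)"
      using \<delta> p by (simp_all add: less_imp_le del: of_nat_Suc)
  qed simp
  \<comment> \<open>Moving the minimising sequence by \<open>v\<close> cannot take \<open>J\<close> below \<open>\<delta>\<close>.\<close>
  have var: "0 \<le> 2 * Re (cinner v y) - 2 * Re z + (norm v)\<^sup>2" if vz: "(v, z) \<in> D" for v z
  proof -
    have "\<delta> \<le> J (p n) + (2 * Re (cinner v (fst (p n))) - 2 * Re z + (norm v)\<^sup>2)" for n
    proof -
      have "(v + fst (p n), z + snd (p n)) \<in> D" using add[OF vz] p(1)[of n] by (metis prod.collapse)
      from \<delta>[OF this] show ?thesis by (simp add: J_def norm_add_square)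
    qed
    then have "\<delta> \<le> \<delta> + (2 * Re (cinner v y) - 2 * Re z + (norm v)\<^sup>2)"
      by (intro LIMSEQ_le_const[where X = "\<lambda>n. J (p n) + (2 * Re (cinner v (fst (p n))) - 2 * Re z + (norm v)\<^sup>2)"]
          tendsto_intros lim_J tendsto_cinner_right[OF y]) auto
    then show ?thesis by simp
  qed
  have rep: "cinner v y = z" if vz: "(v, z) \<in> D" for v z
  proof (rule ccontr)
    define u where "u = cinner v y - z"
    assume "cinner v y \<noteq> z"
    then have u: "cmod u > 0" by (simp add: u_def)
    \<comment> \<open>A step of this size against the defect \<open>u\<close> decreases \<open>J\<close> below its infimum.\<close>
    define t where "t = 1 / ((norm v)\<^sup>2 + 1)"
    have t: "t > 0" "t * (norm v)\<^sup>2 < 1" by (auto simp: t_def field_simps add_pos_nonneg)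
    define c where "c = - (of_real t * cnj u)"
    have "cmod c = t * cmod u" using t by (simp add: c_def norm_mult)
    have "(scaleC c v, c * z) \<in> D" by (rule scale[OF vz])
    from var[OF this] have "0 \<le> 2 * Re (c * cinner v y - c * z) + (cmod c * norm v)\<^sup>2"
      by (simp add: cinner_scaleC_left norm_scaleC)
    also have "c * cinner v y - c * z = - (of_real t * cnj u) * u"
      by (simp add: c_def u_def algebra_simps)
    also note \<open>cmod c = t * cmod u\<close>
    also have "- (of_real t * cnj u) * u = complex_of_real (- t * (cmod u)\<^sup>2)"
      unfolding of_real_mult complex_norm_square by simp
    also have "2 * Re (complex_of_real (- t * (cmod u)\<^sup>2)) + (t * cmod u * norm v)\<^sup>2
      = t * (cmod u)\<^sup>2 * (t * (norm v)\<^sup>2 - 2)"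
      by (simp add: power2_eq_square algebra_simps)
    finally have "0 \<le> t * (cmod u)\<^sup>2 * (t * (norm v)\<^sup>2 - 2)" .
    moreover have "t * (cmod u)\<^sup>2 * (t * (norm v)\<^sup>2 - 2) < 0"
      using t u by (intro mult_pos_neg) auto
    ultimately show False by linarith
  qed
  have "(norm y)\<^sup>2 \<le> \<kappa>"
  proof -
    have "(norm (fst (p n)))\<^sup>2 + \<kappa> \<ge> 2 * Re (cinner (fst (p n)) y)" for n
      using bound[of "fst (p n)" "snd (p n)"] rep[of "fst (p n)" "snd (p n)"] p(1)[of n] by simp
    then have "2 * Re (cinner y y) \<le> (norm y)\<^sup>2 + \<kappa>"
      by (intro LIMSEQ_le[of "\<lambda>n. 2 * Re (cinner (fst (p n)) y)" _ "\<lambda>n. (norm (fst (p n)))\<^sup>2 + \<kappa>"]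
          tendsto_intros y tendsto_cinner_left[OF y]) auto
    then show ?thesis by (simp add: cinner_self)
  qed
  moreover have "y \<in> closure (fst ` D)"
    unfolding closure_sequential using y p(1) by (intro exI[of _ "\<lambda>n. fst (p n)"]) auto
  ultimately show ?thesis using that rep by blast
qed

section \<open>The basis of the first summand\<close>

lemma gs_residual_eq:
  "v i = gs_residual v i + (\<Sum>j<i. scaleC
     (cinner (v i) (gs_residual v j) / cinner (gs_residual v j) (gs_residual v j)) (gs_residual v j))"
  by (simp add: gs_residual.simps[of v i])

text \<open>Also correct if some residuals vanish: their quotient is 0, and so is the scalar product it should
  cancel.\<close>

lemma gs_residual_orthogonal:
  "j < i \<Longrightarrow> cinner (gs_residual v i) (gs_residual v j) = 0"
proof (induction i arbitrary: j rule: less_induct)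
  case (less i)
  let ?u = "gs_residual v"
  let ?c = "\<lambda>k. cinner (v i) (?u k) / cinner (?u k) (?u k)"
  have orth: "cinner (?u k) (?u j) = 0" if "k < i" "k \<noteq> j" for k
  proof (cases "k < j")
    case True
    then have "cinner (?u j) (?u k) = 0" using less by blast
    then show ?thesis by (subst cinner_commute) simp
  qed (use that less in auto)
  have "cinner (\<Sum>k<i. scaleC (?c k) (?u k)) (?u j) = (\<Sum>k<i. if k = j then ?c j * cinner (?u j) (?u j) else 0)"
    unfolding cinner_sum_left cinner_scaleC_left using orth by (intro sum.cong) auto
  also have "\<dots> = cinner (v i) (?u j)" using less.prems by simp
  finally show ?case
    by (subst gs_residual.simps) (simp add: cinner_diff_left)
qed

lemma gs_residual_span: "gs_residual v i \<in> cspan (range v)"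
proof (induction i rule: less_induct)
  case (less i)
  show ?case
    by (subst gs_residual.simps)
      (intro complex_vector.span_diff complex_vector.span_sum complex_vector.span_scale complex_vector.span_base less; simp)
qed

lemma gs_residual_in_span: "v i \<in> cspan (range (gs_residual v))"
  by (subst gs_residual_eq)
    (intro complex_vector.span_add complex_vector.span_sum complex_vector.span_scale complex_vector.span_base; simp)

text \<open>Vectors and residuals are combinations of each other, and the normalised nonzero residuals span
  the same space as all residuals.\<close>

lemma gram_schmidt_basis_props:
  fixes h :: "nat \<Rightarrow> nat \<Rightarrow> 'a::separable_chilbert"
  assumes "gram_schmidt_basis h N g"
  shows "orthonormal_on N g" "closed_cspan (g ` N) = closed_cspan {h m n | m n. True}"
proof -
  obtain \<tau> :: "nat \<Rightarrow> nat \<times> nat" and \<iota> where \<tau>: "bij \<tau>" and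
    \<iota>: "strict_mono_on N \<iota>" "bij_betw \<iota> N {i. gs_residual (\<lambda>i. case_prod h (\<tau> i)) i \<noteq> 0}" and
    g: "\<And>n. n \<in> N \<Longrightarrow> g n = gs_residual (\<lambda>i. case_prod h (\<tau> i)) (\<iota> n) /\<^sub>R norm (gs_residual (\<lambda>i. case_prod h (\<tau> i)) (\<iota> n))"
    using assms unfolding gram_schmidt_basis_def Let_def by blast
  define v where "v i = case_prod h (\<tau> i)" for i
  let ?u = "gs_residual v"
  have \<iota>': "bij_betw \<iota> N {i. ?u i \<noteq> 0}" and g': "\<And>n. n \<in> N \<Longrightarrow> g n = scaleC (complex_of_real (inverse (norm (?u (\<iota> n))))) (?u (\<iota> n))"
    using \<iota>(2) g by (simp_all add: v_def[abs_def] scaleR_scaleC)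
  have nz: "?u (\<iota> n) \<noteq> 0" if "n \<in> N" for n using \<iota>' that by (auto simp: bij_betw_def)
  have orth: "cinner (?u i) (?u j) = 0" if "i \<noteq> j" for i j
  proof (cases "j < i")
    case False
    then have "cinner (?u j) (?u i) = 0" using that by (intro gs_residual_orthogonal) simp
    then show ?thesis by (subst cinner_commute) simp
  qed (rule gs_residual_orthogonal)
  show "orthonormal_on N g"
    unfolding orthonormal_on_def
  proof (intro ballI)
    fix i j assume ij: "i \<in> N" "j \<in> N"
    show "cinner (g i) (g j) = (if i = j then 1 else 0)"
    proof (cases "i = j")
      case True
      have "norm (g i) = 1" using nz[OF ij(1)] by (simp add: g'[OF ij(1)] norm_scaleC norm_inverse)
      then show ?thesis using True by (simp add: cinner_self)
    next
      case False
      then have "\<iota> i \<noteq> \<iota> j" using \<iota>' ij by (auto simp: bij_betw_def inj_on_def)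
      then show ?thesis using False orth
        by (simp add: g'[OF ij(1)] g'[OF ij(2)] cinner_scaleC_left cinner_scaleC_right)
    qed
  qed
  have range: "{h m n | m n. True} = range v"
  proof -
    have "range v = case_prod h ` range \<tau>" by (simp add: v_def image_image)
    also have "range \<tau> = UNIV" using \<tau> by (simp add: bij_is_surj)
    finally show ?thesis by auto
  qed
  have "cspan (g ` N) = cspan (range v)"
  proof
    show "cspan (g ` N) \<subseteq> cspan (range v)"
      by (intro complex_vector.span_minimal complex_vector.subspace_span)
        (auto simp: g' intro!: complex_vector.span_scale gs_residual_span)
    have "?u i \<in> cspan (g ` N)" for i
    proof (cases "?u i = 0")
      case False
      then have "i \<in> \<iota> ` N" using \<iota>' by (simp add: bij_betw_def)
      then obtain n where n: "n \<in> N" "\<iota> n = i" by blast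
      then have "?u i = scaleC (complex_of_real (norm (?u i))) (g n)"
        using False by (simp add: g' scaleC_scaleC scaleC_one)
      then show ?thesis using n by (metis complex_vector.span_base complex_vector.span_scale imageI)
    qed (simp add: complex_vector.span_zero)
    then have "cspan (range ?u) \<subseteq> cspan (g ` N)"
      by (intro complex_vector.span_minimal complex_vector.subspace_span) auto
    then show "cspan (range v) \<subseteq> cspan (g ` N)"
      using gs_residual_in_span by (intro complex_vector.span_minimal complex_vector.subspace_span) blast
  qed
  then show "closed_cspan (g ` N) = closed_cspan {h m n | m n. True}"
    by (simp only: closed_cspan_def range)
qed

section \<open>Consequences of the ten equations\<close>

text \<open>The index of the product of one extended monomial with the conjugate of another: conjugation
  interchanges \<open>x + \<i>\<close> and \<open>x - \<i>\<close>.\<close>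

definition conj_sum :: "idx \<Rightarrow> idx \<Rightarrow> idx" where
  "conj_sum = (\<lambda>(m, k, l, n, r, t) (m', k', l', n', r', t'). (m + m', k + l', l + k', n + n', r + t', t + r'))"

lemma conj_sum_simp [simp]:
  "conj_sum (m, k, l, n, r, t) (m', k', l', n', r', t') = (m + m', k + l', l + k', n + n', r + t', t + r')"
  by (simp add: conj_sum_def)

lemma associated_function_conj_sum:
  "associated_function f \<phi> \<longleftrightarrow> (\<forall>p q. cinner (f p) (f q) = \<phi> (conj_sum p q))"
  unfolding associated_function_def by (simp add: split_paired_all)

text \<open>The relations (E1)-(E4) for a functional: multiplying a monomial by \<open>x \<plusminus> \<i>\<close> is multiplying by \<open>x\<close> and
  adding a multiple.\<close>

definition shift_relations :: "(idx \<Rightarrow> complex) \<Rightarrow> bool" where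
  "shift_relations \<phi> \<longleftrightarrow>
     (\<forall>m k l n r t.
        \<phi> (m + 1, k, l, n, r, t) + \<i> * \<phi> (m, k, l, n, r, t) = \<phi> (m, k + 1, l, n, r, t) \<and>
        \<phi> (m + 1, k, l, n, r, t) - \<i> * \<phi> (m, k, l, n, r, t) = \<phi> (m, k, l + 1, n, r, t) \<and>
        \<phi> (m, k, l, n + 1, r, t) + \<i> * \<phi> (m, k, l, n, r, t) = \<phi> (m, k, l, n, r + 1, t) \<and>
        \<phi> (m, k, l, n + 1, r, t) - \<i> * \<phi> (m, k, l, n, r, t) = \<phi> (m, k, l, n, r, t + 1))"

lemma shift_relationsD:
  assumes "shift_relations \<phi>"
  shows "\<phi> (Suc m, k, l, n, r, t) + \<i> * \<phi> (m, k, l, n, r, t) = \<phi> (m, k + 1, l, n, r, t)"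
    "\<phi> (Suc m, k, l, n, r, t) - \<i> * \<phi> (m, k, l, n, r, t) = \<phi> (m, k, l + 1, n, r, t)"
    "\<phi> (m, k, l, Suc n, r, t) + \<i> * \<phi> (m, k, l, n, r, t) = \<phi> (m, k, l, n, r + 1, t)"
    "\<phi> (m, k, l, Suc n, r, t) - \<i> * \<phi> (m, k, l, n, r, t) = \<phi> (m, k, l, n, r, t + 1)"
  using assms unfolding shift_relations_def Suc_eq_plus1 by blast+

lemma eq_instance_finite: "eq_instance V E \<Longrightarrow> finite V"
  by (induction rule: eq_instance.induct) auto

text \<open>Allows to pass between the formal scalar products in the equations of a step and the actual ones.\<close>

lemma eq_instance_cong:
  assumes "eq_instance V E" "\<And>p q. p \<in> V \<Longrightarrow> q \<in> V \<Longrightarrow> ip p q = ip' p q"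
  shows "E ip = E ip'"
  using assms by (induction rule: eq_instance.induct) simp_all

text \<open>Both sides of (E5)-(E10) have the same index sum, and (E1)-(E4) are shift relations at the index sum.\<close>

lemma eq_instance_conj_sum:
  assumes "eq_instance V E" "shift_relations \<phi>"
  shows "E (\<lambda>p q. \<phi> (conj_sum p q))"
  using assms(1)
proof induction
  case (E1 m k l n r t a b c d e f)
  then show ?case using shift_relationsD(1)[OF assms(2), of "m + a" "k + c" "l + b" "n + d" "r + f" "t + e"]
    by (simp add: ac_simps)
next
  case (E2 m k l n r t a b c d e f)
  then show ?case using shift_relationsD(2)[OF assms(2), of "m + a" "k + c" "l + b" "n + d" "r + f" "t + e"]
    by (simp add: ac_simps)
next
  case (E3 m k l n r t a b c d e f)
  then show ?case using shift_relationsD(3)[OF assms(2), of "m + a" "k + c" "l + b" "n + d" "r + f" "t + e"]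
    by (simp add: ac_simps)
next
  case (E4 m k l n r t a b c d e f)
  then show ?case using shift_relationsD(4)[OF assms(2), of "m + a" "k + c" "l + b" "n + d" "r + f" "t + e"]
    by (simp add: ac_simps)
qed simp_all

abbreviation gram :: "(idx \<Rightarrow> 'a::separable_chilbert) \<Rightarrow> idx \<Rightarrow> idx \<Rightarrow> complex" where
  "gram f p q \<equiv> cinner (f p) (f q)"

definition all_equations :: "(idx \<Rightarrow> 'a::separable_chilbert) \<Rightarrow> bool" where
  "all_equations f \<longleftrightarrow> (\<forall>V E. eq_instance V E \<longrightarrow> E (gram f))"

text \<open>The equations (E5)-(E10) move one exponent after the other from the second vector to the first.\<close>

lemma all_equations_gram:
  assumes f: "all_equations f"
  shows "gram f p q = gram f (conj_sum p q) (0, 0, 0, 0, 0, 0)"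
proof -
  obtain m k l n r t where p: "p = (m, k, l, n, r, t)" by (cases p) 
  obtain m' k' l' n' r' t' where q: "q = (m', k', l', n', r', t')" by (cases q)
  have D: "E (gram f)" if "eq_instance V E" for V E using f that unfolding all_equations_def by blast
  have "gram f p q = gram f (m + m', k, l, n, r, t) (0, k', l', n', r', t')"
    unfolding p q by (rule D[OF eq_instance.E5]) simp
  also have "\<dots> = gram f (m + m', k + l', l, n, r, t) (0, k', 0, n', r', t')"
    by (rule D[OF eq_instance.E6]) simp
  also have "\<dots> = gram f (m + m', k + l', l + k', n, r, t) (0, 0, 0, n', r', t')"
    by (rule D[OF eq_instance.E7]) simp
  also have "\<dots> = gram f (m + m', k + l', l + k', n + n', r, t) (0, 0, 0, 0, r', t')"
    by (rule D[OF eq_instance.E8]) simp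
  also have "\<dots> = gram f (m + m', k + l', l + k', n + n', r + t', t) (0, 0, 0, 0, r', 0)"
    by (rule D[OF eq_instance.E9]) simp
  also have "\<dots> = gram f (m + m', k + l', l + k', n + n', r + t', t + r') (0, 0, 0, 0, 0, 0)"
    by (rule D[OF eq_instance.E10]) simp
  finally show ?thesis by (simp add: p q)
qed

text \<open>The defect of each relation is orthogonal to the whole sequence by (E1)-(E4), and it is itself a
  combination of vectors of the sequence.\<close>

lemma all_equations_vectors:
  assumes f: "all_equations f"
  shows "f (m + 1, k, l, n, r, t) + scaleC \<i> (f (m, k, l, n, r, t)) = f (m, k + 1, l, n, r, t)"
    "f (m + 1, k, l, n, r, t) - scaleC \<i> (f (m, k, l, n, r, t)) = f (m, k, l + 1, n, r, t)"
    "f (m, k, l, n + 1, r, t) + scaleC \<i> (f (m, k, l, n, r, t)) = f (m, k, l, n, r + 1, t)"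
    "f (m, k, l, n + 1, r, t) - scaleC \<i> (f (m, k, l, n, r, t)) = f (m, k, l, n, r, t + 1)"
proof -
  have D: "E (gram f)" if "eq_instance V E" for V E using f that unfolding all_equations_def by blast
  have vec: "f p + scaleC c (f q) = f u" if orth: "\<And>x. cinner (f p + scaleC c (f q) - f u) (f x) = 0" for p q u c
  proof -
    let ?d = "f p + scaleC c (f q) - f u"
    have "cinner ?d ?d = cinner ?d (f p) + cnj c * cinner ?d (f q) - cinner ?d (f u)"
      by (subst (2) diff_conv_add_uminus) (simp add: cinner_add_right cinner_scaleC_right cinner_diff_right)
    then have "cinner ?d ?d = 0" unfolding orth by simp
    then show ?thesis by simp
  qed
  show "f (m + 1, k, l, n, r, t) + scaleC \<i> (f (m, k, l, n, r, t)) = f (m, k + 1, l, n, r, t)"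
  proof (rule vec)
    show "cinner (f (m + 1, k, l, n, r, t) + scaleC \<i> (f (m, k, l, n, r, t)) - f (m, k + 1, l, n, r, t)) (f x) = 0" for x
      using D[OF eq_instance.E1[of m k l n r t]] by (cases x) (simp add: cinner_diff_left cinner_add_left cinner_scaleC_left)
  qed
  show "f (m, k, l, n + 1, r, t) + scaleC \<i> (f (m, k, l, n, r, t)) = f (m, k, l, n, r + 1, t)"
  proof (rule vec)
    show "cinner (f (m, k, l, n + 1, r, t) + scaleC \<i> (f (m, k, l, n, r, t)) - f (m, k, l, n, r + 1, t)) (f x) = 0" for x
      using D[OF eq_instance.E3[of m k l n r t]] by (cases x) (simp add: cinner_diff_left cinner_add_left cinner_scaleC_left)
  qed
  have "f (m + 1, k, l, n, r, t) + scaleC (- \<i>) (f (m, k, l, n, r, t)) = f (m, k, l + 1, n, r, t)"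
  proof (rule vec)
    show "cinner (f (m + 1, k, l, n, r, t) + scaleC (- \<i>) (f (m, k, l, n, r, t)) - f (m, k, l + 1, n, r, t)) (f x) = 0" for x
      using D[OF eq_instance.E2[of m k l n r t]] by (cases x) (simp add: cinner_diff_left cinner_add_left cinner_scaleC_left)
  qed
  then show "f (m + 1, k, l, n, r, t) - scaleC \<i> (f (m, k, l, n, r, t)) = f (m, k, l + 1, n, r, t)"
    by (simp add: complex_vector.scale_minus_left)
  have "f (m, k, l, n + 1, r, t) + scaleC (- \<i>) (f (m, k, l, n, r, t)) = f (m, k, l, n, r, t + 1)"
  proof (rule vec)
    show "cinner (f (m, k, l, n + 1, r, t) + scaleC (- \<i>) (f (m, k, l, n, r, t)) - f (m, k, l, n, r, t + 1)) (f x) = 0" for x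
      using D[OF eq_instance.E4[of m k l n r t]] by (cases x) (simp add: cinner_diff_left cinner_add_left cinner_scaleC_left)
  qed
  then show "f (m, k, l, n + 1, r, t) - scaleC \<i> (f (m, k, l, n, r, t)) = f (m, k, l, n, r, t + 1)"
    by (simp add: complex_vector.scale_minus_left)
qed

lemma all_equations_associated_function:
  assumes f: "all_equations f"
  shows "associated_function f \<phi> \<longleftrightarrow> \<phi> = (\<lambda>p. cinner (f p) (f (0, 0, 0, 0, 0, 0)))"
proof
  assume \<phi>: "associated_function f \<phi>"
  have "conj_sum p (0, 0, 0, 0, 0, 0) = p" for p by (cases p) simp
  then show "\<phi> = (\<lambda>p. cinner (f p) (f (0, 0, 0, 0, 0, 0)))"
    using \<phi> unfolding associated_function_conj_sum by metis
qed (use all_equations_gram[OF f] in \<open>simp add: associated_function_conj_sum\<close>)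

section \<open>Sequences produced by the algorithm\<close>

locale model =
  fixes s :: "nat \<Rightarrow> nat \<Rightarrow> complex"
    and h :: "nat \<Rightarrow> nat \<Rightarrow> 'a::separable_chilbert"
    and H0 :: "'a set"
    and Hj :: "nat \<Rightarrow> 'a set"
    and e :: "nat \<Rightarrow> 'a"
    and N :: "nat set"
    and g :: "nat \<Rightarrow> 'a"
    and w :: "nat \<Rightarrow> idx"
    and M :: "nat \<Rightarrow> real"
  assumes model: "model_space s h H0 Hj"
    and unit: "\<And>j. j \<ge> 1 \<Longrightarrow> e j \<in> Hj j \<and> norm (e j) = 1"
    and basis: "gram_schmidt_basis h N g"
    and w: "bij_betw w {1..} Omega'"
    and M: "admissible_bounds s w M"
begin

lemma gram_h: "cinner (h m n) (h m' n') = s (m + m') (n + n')"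
  using model by (simp add: model_space_def)

lemma H0_eq: "H0 = closed_cspan (g ` N)"
  using model gram_schmidt_basis_props(2)[OF basis] by (simp add: model_space_def closed_cspan_def)

lemma h_in_H0: "h m n \<in> H0"
  using gram_schmidt_basis_props(2)[OF basis] closed_cspan_superset[of "h m n" "{h m n | m n. True}"]
  unfolding H0_eq by blast

lemma g_orthonormal: "orthonormal_on N g"
  by (rule gram_schmidt_basis_props(1)[OF basis])

lemma g_in_H0: "n \<in> N \<Longrightarrow> g n \<in> H0"
  unfolding H0_eq by (intro closed_cspan_superset) simp

lemma H0_e: "x \<in> H0 \<Longrightarrow> j \<ge> 1 \<Longrightarrow> cinner x (e j) = 0"
  using model unit by (simp add: model_space_def)

lemma e_H0: "x \<in> H0 \<Longrightarrow> j \<ge> 1 \<Longrightarrow> cinner (e j) x = 0"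
  by (subst cinner_commute) (simp add: H0_e)

lemma e_orthonormal: "orthonormal_on {1..} e"
  using model unit by (auto simp: model_space_def orthonormal_on_def cinner_self)

lemma e_e: "i \<ge> 1 \<Longrightarrow> j \<ge> 1 \<Longrightarrow> cinner (e i) (e j) = (if i = j then 1 else 0)"
  using e_orthonormal by (simp add: orthonormal_on_def)

text \<open>The subspace available to the vectors found in the first \<open>r\<close> steps.\<close>

definition stage :: "nat \<Rightarrow> 'a set" where
  "stage r = closed_cspan (H0 \<union> e ` {1..r})"

lemma stage_mono: "i \<le> j \<Longrightarrow> stage i \<subseteq> stage j"
  unfolding stage_def by (intro closed_cspan_mono) auto

lemma H0_stage: "x \<in> H0 \<Longrightarrow> x \<in> stage r"
  unfolding stage_def by (intro closed_cspan_superset) simp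

lemma e_stage: "1 \<le> j \<Longrightarrow> j \<le> r \<Longrightarrow> e j \<in> stage r"
  unfolding stage_def by (intro closed_cspan_superset) simp

lemma subspace_stage: "complex_vector.subspace (stage r)"
  unfolding stage_def by (rule subspace_closed_cspan)

lemma stage_orthogonal: "x \<in> stage r \<Longrightarrow> r < j \<Longrightarrow> cinner x (e j) = 0"
  unfolding stage_def by (erule orthogonal_closed_cspan[rotated]) (auto simp: H0_e e_e)

lemma stage_subset_orth_sum: "stage r \<subseteq> orth_sum H0 Hj {j \<in> {1..}. j \<le> r}"
  unfolding stage_def orth_sum_def closed_cspan_def[symmetric]
  using unit by (intro closed_cspan_mono) fastforce

lemma assemble_Omega0: "assemble h w hs (m, 0, 0, n, 0, 0) = h m n"
  by (simp add: assemble_def Omega0_def)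

lemma w_notin: "j \<ge> 1 \<Longrightarrow> w j \<notin> Omega0"
  using w by (auto simp: bij_betw_def Omega'_def)

lemma w_inj: "i \<ge> 1 \<Longrightarrow> j \<ge> 1 \<Longrightarrow> w i = w j \<longleftrightarrow> i = j"
  using w by (auto simp: bij_betw_def inj_on_def)

lemma assemble_w: "j \<ge> 1 \<Longrightarrow> assemble h w hs (w j) = hs j"
  using w by (simp add: assemble_def w_notin bij_betw_def)

lemma index_cases:
  obtains m n where "p = (m, 0, 0, n, 0, 0)" "p \<in> Omega0" | j where "j \<ge> 1" "p = w j"
proof (cases "p \<in> Omega0")
  case True
  then show ?thesis using that(1) by (auto simp: Omega0_def)
next
  case False
  then have "p \<in> w ` {1..}" using w by (simp add: bij_betw_def Omega'_def)
  then show ?thesis using that(2) by auto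
qed

text \<open>The indices whose vectors are known after \<open>r\<close> steps.\<close>

definition prescribed :: "nat \<Rightarrow> idx set" where
  "prescribed r = Omega0 \<union> w ` {1..r}"

lemma w_prescribed_iff: "j \<ge> 1 \<Longrightarrow> w j \<in> prescribed r \<longleftrightarrow> j \<le> r"
  by (auto simp: prescribed_def w_notin w_inj)

lemma prescribed_Suc: "prescribed (Suc r) = insert (w (Suc r)) (prescribed r)"
  by (auto simp: prescribed_def atLeastAtMostSuc_conv)

lemma assemble_cong:
  assumes "p \<in> prescribed r" "\<And>j. 1 \<le> j \<Longrightarrow> j \<le> r \<Longrightarrow> hs j = hs' j"
  shows "assemble h w hs p = assemble h w hs' p"
  by (cases p rule: index_cases) (use assms in \<open>auto simp: assemble_Omega0 assemble_w w_prescribed_iff\<close>)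

lemma assemble_stage:
  assumes "p \<in> prescribed r" "\<And>j. 1 \<le> j \<Longrightarrow> j \<le> r \<Longrightarrow> hs j \<in> stage j"
  shows "assemble h w hs p \<in> stage r"
proof (cases p rule: index_cases)
  case (1 m n)
  then show ?thesis by (simp add: assemble_Omega0 H0_stage h_in_H0)
next
  case (2 j)
  then show ?thesis using assms stage_mono[of j r] by (auto simp: assemble_w w_prescribed_iff)
qed

text \<open>The vector of step \<open>Suc r\<close> without its component along the new unit vector.\<close>

definition old_part :: "nat \<Rightarrow> (nat \<Rightarrow> complex) \<Rightarrow> (nat \<Rightarrow> complex) \<Rightarrow> 'a" where
  "old_part r \<alpha> \<beta> = (\<Sum>\<^sub>\<infinity>n\<in>N. scaleC (\<alpha> n) (g n)) + (\<Sum>j\<in>{1..<Suc r}. scaleC (\<beta> j) (e j))"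

lemma old_part_props:
  assumes \<alpha>: "(\<lambda>n. (cmod (\<alpha> n))\<^sup>2) summable_on N"
  shows "old_part r \<alpha> \<beta> \<in> stage r"
    and "cinner (old_part r \<alpha> \<beta>) x = coeff_inner N g e (Suc r) \<alpha> \<beta> x"
    and "(norm (old_part r \<alpha> \<beta>))\<^sup>2 = coeff_sq N (Suc r) \<alpha> \<beta>"
proof -
  let ?v = "\<Sum>\<^sub>\<infinity>n\<in>N. scaleC (\<alpha> n) (g n)" and ?u = "\<Sum>j\<in>{1..<Suc r}. scaleC (\<beta> j) (e j)"
  have v: "?v \<in> H0" using orthonormal_series(4)[OF g_orthonormal \<alpha>] by (simp add: H0_eq)
  show "old_part r \<alpha> \<beta> \<in> stage r"
    unfolding old_part_def using v
    by (intro complex_vector.subspace_add complex_vector.subspace_sum complex_vector.subspace_scale subspace_stage H0_stage e_stage) auto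
  show "cinner (old_part r \<alpha> \<beta>) x = coeff_inner N g e (Suc r) \<alpha> \<beta> x"
    unfolding old_part_def coeff_inner_def cinner_add_left orthonormal_series(1)[OF g_orthonormal \<alpha>]
    by (simp add: cinner_sum_left cinner_scaleC_left del: sum.op_ivl_Suc)
  have "cinner ?v ?u = 0" using v by (simp add: cinner_sum_right cinner_scaleC_right H0_e del: sum.op_ivl_Suc)
  moreover have "(norm ?u)\<^sup>2 = (\<Sum>j\<in>{1..<Suc r}. (cmod (\<beta> j))\<^sup>2)"
    by (intro orthonormal_norm_sum[OF e_orthonormal]) auto
  ultimately show "(norm (old_part r \<alpha> \<beta>))\<^sup>2 = coeff_sq N (Suc r) \<alpha> \<beta>"
    unfolding old_part_def norm_add_square coeff_sq_def orthonormal_series(3)[OF g_orthonormal \<alpha>] by simp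
qed

text \<open>The component along \<open>e (Suc r)\<close> is invisible to the vectors of earlier steps and fills the squared norm
  up to \<open>d\<close>.\<close>

lemma new_vector_props:
  fixes \<theta> :: real
  assumes \<alpha>: "(\<lambda>n. (cmod (\<alpha> n))\<^sup>2) summable_on N" and d: "coeff_sq N (Suc r) \<alpha> \<beta> \<le> d"
  defines "x \<equiv> new_vector N g e (Suc r) \<alpha> \<beta> d \<theta>"
  shows "x \<in> stage (Suc r)"
    and "z \<in> stage r \<Longrightarrow> cinner x z = coeff_inner N g e (Suc r) \<alpha> \<beta> z"
    and "(norm x)\<^sup>2 = d"
proof -
  let ?c = "cis \<theta> * complex_of_real (sqrt (d - coeff_sq N (Suc r) \<alpha> \<beta>))"
  have x: "x = old_part r \<alpha> \<beta> + scaleC ?c (e (Suc r))"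
    by (simp add: x_def new_vector_def old_part_def)
  note old = old_part_props[OF \<alpha>, of r \<beta>]
  show "x \<in> stage (Suc r)"
    unfolding x using old(1) stage_mono[of r "Suc r"]
    by (intro complex_vector.subspace_add complex_vector.subspace_scale subspace_stage e_stage) auto
  show "cinner x z = coeff_inner N g e (Suc r) \<alpha> \<beta> z" if "z \<in> stage r"
  proof -
    have "cinner (e (Suc r)) z = 0"
      using stage_orthogonal[OF that, of "Suc r"] by (subst cinner_commute) simp
    then show ?thesis by (simp add: x cinner_add_left cinner_scaleC_left old(2))
  qed
  have "cinner (old_part r \<alpha> \<beta>) (scaleC ?c (e (Suc r))) = 0"
    using stage_orthogonal[OF old(1), of "Suc r"] by (simp add: cinner_scaleC_right)
  moreover have "(norm (scaleC ?c (e (Suc r))))\<^sup>2 = d - coeff_sq N (Suc r) \<alpha> \<beta>"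
    using d unit[of "Suc r"] by (simp add: norm_scaleC norm_mult)
  ultimately show "(norm x)\<^sup>2 = d" by (simp add: x norm_add_square old(3))
qed

text \<open>Conversely, each vector of a stage arises from its own Fourier coefficients, since it differs from
  their series by a vector orthogonal to a basis of the stage.\<close>

lemma old_part_expansion:
  assumes y: "y \<in> stage r"
  shows "y = old_part r (\<lambda>n. cinner y (g n)) (\<lambda>j. cinner y (e j))" (is "y = ?y")
proof -
  note \<alpha> = bessel_summable[OF g_orthonormal, of y]
  have "y - ?y = 0"
  proof (rule orthogonal_complement_trivial)
    show "y - ?y \<in> closed_cspan (g ` N \<union> e ` {1..r})"
    proof -
      have "stage r \<subseteq> closed_cspan (g ` N \<union> e ` {1..r})"
        unfolding stage_def
      proof (rule closed_cspan_minimal)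
        show "H0 \<union> e ` {1..r} \<subseteq> closed_cspan (g ` N \<union> e ` {1..r})"
        proof (rule Un_least)
          show "H0 \<subseteq> closed_cspan (g ` N \<union> e ` {1..r})"
            unfolding H0_eq by (rule closed_cspan_mono) simp
        qed (auto intro: closed_cspan_superset)
      qed (auto intro: subspace_closed_cspan closed_closed_cspan)
      moreover have "y - ?y \<in> stage r"
        by (intro complex_vector.subspace_diff subspace_stage y old_part_props(1)[OF \<alpha>])
      ultimately show ?thesis by blast
    qed
    have g0: "cinner ?y (g n) = cinner y (g n)" if "n \<in> N" for n
      unfolding old_part_def cinner_add_left
      using orthonormal_series(2)[OF g_orthonormal \<alpha> that] that
      by (simp add: cinner_sum_left cinner_scaleC_left e_H0 g_in_H0 del: sum.op_ivl_Suc)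
    have e0: "cinner ?y (e j) = cinner y (e j)" if "j \<in> {1..r}" for j
    proof -
      have "(\<Sum>\<^sub>\<infinity>n\<in>N. scaleC (cinner y (g n)) (g n)) \<in> H0"
        using orthonormal_series(4)[OF g_orthonormal \<alpha>] by (simp add: H0_eq)
      moreover have "(\<Sum>i\<in>{1..<Suc r}. cinner y (e i) * cinner (e i) (e j)) = (\<Sum>i\<in>{1..<Suc r}. if i = j then cinner y (e j) else 0)"
        using that by (intro sum.cong) (auto simp: e_e)
      ultimately show ?thesis using that
        by (simp add: old_part_def cinner_add_left cinner_sum_left cinner_scaleC_left H0_e)
    qed
    fix x assume "x \<in> g ` N \<union> e ` {1..r}"
    then have "cinner (y - ?y) x = 0" using g0 e0 by (auto simp: cinner_diff_left)
    then show "cinner x (y - ?y) = 0" by (subst cinner_commute) simp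
  qed
  then show ?thesis by simp
qed

lemma condition_a_gram:
  assumes "condition_a h" "eq_instance V E" "V \<subseteq> Omega0"
  shows "E (gram (assemble h w hs))"
proof -
  let ?A = "\<lambda>(m, _, _, n, _, _) (m', _, _, n', _, _). cinner (h m n) (h m' n')"
  have "E ?A = E (gram (assemble h w hs))"
  proof (rule eq_instance_cong[OF assms(2)])
    fix p q assume "p \<in> V" "q \<in> V"
    then have "p \<in> Omega0" "q \<in> Omega0" using assms(3) by auto
    then show "?A p q = gram (assemble h w hs) p q"
      by (auto simp: Omega0_def assemble_Omega0)
  qed
  moreover have "E ?A" using assms unfolding condition_a_def by blast
  ultimately show ?thesis by simp
qed

text \<open>The formal scalar products in the equations of a step become the actual ones when the new vector is
  formed from a solution of these equations.\<close>

lemma step_gram_eq: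
  assumes \<alpha>: "(\<lambda>n. (cmod (\<alpha> n))\<^sup>2) summable_on N" and d: "coeff_sq N (Suc r) \<alpha> \<beta> \<le> d"
    and hs: "\<And>j. 1 \<le> j \<Longrightarrow> j \<le> r \<Longrightarrow> hs j \<in> stage j"
    and pq: "p \<in> prescribed (Suc r)" "q \<in> prescribed (Suc r)"
  shows "step_gram h N g e w (Suc r) \<alpha> \<beta> d hs p q
    = gram (assemble h w (hs(Suc r := new_vector N g e (Suc r) \<alpha> \<beta> d \<theta>))) p q"
proof -
  let ?x = "new_vector N g e (Suc r) \<alpha> \<beta> d \<theta>"
  note x = new_vector_props[OF \<alpha> d, where \<theta> = \<theta>]
  have new: "assemble h w (hs(Suc r := ?x)) (w (Suc r)) = ?x" by (simp add: assemble_w)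
  have old: "assemble h w (hs(Suc r := ?x)) u = assemble h w hs u" if "u \<in> prescribed r" for u
    by (rule assemble_cong[OF that]) simp
  have st: "assemble h w hs u \<in> stage r" if "u \<in> prescribed r" for u
    using assemble_stage[OF that] hs by blast
  show ?thesis
  proof (cases "p = w (Suc r)"; cases "q = w (Suc r)")
    assume "p = w (Suc r)" "q = w (Suc r)"
    then show ?thesis by (simp add: step_gram_def new cinner_self x(3) del: of_real_power)
  next
    assume *: "p = w (Suc r)" "q \<noteq> w (Suc r)"
    then have "q \<in> prescribed r" using pq by (simp add: prescribed_Suc)
    then show ?thesis using * by (simp add: step_gram_def new old x(2)[OF st])
  next
    assume *: "p \<noteq> w (Suc r)" "q = w (Suc r)"
    then have "p \<in> prescribed r" using pq by (simp add: prescribed_Suc)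
    then show ?thesis using * by (subst cinner_commute) (simp add: step_gram_def new old x(2)[OF st])
  next
    assume *: "p \<noteq> w (Suc r)" "q \<noteq> w (Suc r)"
    then have "p \<in> prescribed r" "q \<in> prescribed r" using pq by (simp_all add: prescribed_Suc)
    then show ?thesis using * by (simp add: step_gram_def old)
  qed
qed

text \<open>An equation between the vectors known after step \<open>Suc r\<close> either contains the newest vector and was
  imposed in that step, or it was true before.\<close>

lemma G_set_sound:
  assumes a: "condition_a h" and "hs \<in> G_set h N g e w M r"
  shows "(\<forall>j. 1 \<le> j \<longrightarrow> j \<le> r \<longrightarrow> hs j \<in> stage j) \<and>
    (\<forall>V E. eq_instance V E \<longrightarrow> V \<subseteq> prescribed r \<longrightarrow> E (gram (assemble h w hs)))"
  using assms(2)
proof (induction r arbitrary: hs)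
  case 0
  then show ?case using condition_a_gram[OF a] by (auto simp: prescribed_def)
next
  case (Suc r hs')
  obtain \<alpha> \<beta> d hs \<theta> where hs': "hs' = hs(Suc r := new_vector N g e (Suc r) \<alpha> \<beta> d \<theta>)"
    and S: "(\<alpha>, \<beta>, d, hs) \<in> S_hat h N g e w M (Suc r) (G_set h N g e w M r)"
    using Suc.prems by auto
  have hs: "hs \<in> G_set h N g e w M r" and \<alpha>: "(\<lambda>n. (cmod (\<alpha> n))\<^sup>2) summable_on N"
    and L: "L_holds h N g e w (Suc r) \<alpha> \<beta> d hs" and d: "coeff_sq N (Suc r) \<alpha> \<beta> \<le> d"
    using S by (auto simp: S_hat_def S_set_def)
  have st: "hs j \<in> stage j" if "1 \<le> j" "j \<le> r" for j using Suc.IH[OF hs] that by blast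
  show ?case
  proof (intro conjI allI impI)
    fix j assume "1 \<le> j" "j \<le> Suc r"
    then show "hs' j \<in> stage j"
      using st new_vector_props(1)[OF \<alpha> d] by (auto simp: hs' le_Suc_eq)
  next
    fix V E assume E: "eq_instance V E" and V: "V \<subseteq> prescribed (Suc r)"
    show "E (gram (assemble h w hs'))"
    proof (cases "w (Suc r) \<in> V")
      case True
      then have "E (step_gram h N g e w (Suc r) \<alpha> \<beta> d hs)"
        using L E V unfolding L_holds_def prescribed_def by blast
      moreover have "E (step_gram h N g e w (Suc r) \<alpha> \<beta> d hs) = E (gram (assemble h w hs'))"
        unfolding hs' using V by (intro eq_instance_cong[OF E] step_gram_eq[OF \<alpha> d st]) auto
      ultimately show ?thesis by simp
    next
      case False
      then have V': "V \<subseteq> prescribed r" using V by (auto simp: prescribed_Suc)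
      have same: "assemble h w hs' p = assemble h w hs p" if "p \<in> V" for p
        using V' that by (intro assemble_cong[of _ r]) (auto simp: hs')
      have "E (gram (assemble h w hs)) = E (gram (assemble h w hs'))"
        by (rule eq_instance_cong[OF E]) (simp add: same)
      moreover have "E (gram (assemble h w hs))" using Suc.IH[OF hs] E V' by blast
      ultimately show ?thesis by simp
    qed
  qed
qed

text \<open>Each equation contains finitely many vectors and so concerns a finite number of steps only.\<close>

lemma bold_G_sound:
  assumes a: "condition_a h" and gs: "gs \<in> bold_G h N g e w M"
  shows "all_equations (assemble h w gs)" "j \<ge> 1 \<Longrightarrow> gs j \<in> stage j"
proof -
  have G: "restrict gs {1..r} \<in> G_set h N g e w M r" if "r \<ge> 1" for r
    using gs that by (simp add: bold_G_def bold_G_step_def)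
  show "gs j \<in> stage j" if "j \<ge> 1"
    using G_set_sound[OF a G[OF that]] that by (metis atLeastAtMost_iff order_refl restrict_apply)
  show "all_equations (assemble h w gs)"
    unfolding all_equations_def
  proof (intro allI impI)
    fix V E assume E: "eq_instance V E"
    have "\<exists>r\<ge>1. V \<subseteq> prescribed r"
      using eq_instance_finite[OF E]
    proof (induction V rule: finite_induct)
      case (insert p V)
      then obtain r where r: "r \<ge> 1" "V \<subseteq> prescribed r" by blast
      show ?case
      proof (cases p rule: index_cases)
        case 1
        then show ?thesis using r by (intro exI[of _ r]) (auto simp: prescribed_def)
      next
        case (2 j)
        then show ?thesis using r
          by (intro exI[of _ "max r j"]) (force simp: prescribed_def)
      qed
    qed auto
    then obtain r where r: "r \<ge> 1" "V \<subseteq> prescribed r" by blast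
    have "E (gram (assemble h w (restrict gs {1..r})))"
      using G_set_sound[OF a G[OF r(1)]] E r(2) by blast
    moreover have "assemble h w (restrict gs {1..r}) p = assemble h w gs p" if "p \<in> V" for p
      using r that by (intro assemble_cong[of _ r]) auto
    then have "E (gram (assemble h w (restrict gs {1..r}))) = E (gram (assemble h w gs))"
      by (intro eq_instance_cong[OF E]) simp
    ultimately show "E (gram (assemble h w gs))" by simp
  qed
qed

lemma assemble_in_X_set:
  assumes a: "condition_a h" and gs: "gs \<in> bold_G h N g e w M"
  shows "assemble h w gs \<in> X_set h H0 Hj w"
proof -
  note f = bold_G_sound[OF a gs]
  have "\<exists>\<Lambda>\<subseteq>{1..}. \<forall>r\<ge>1. assemble h w gs (w r) \<in> orth_sum H0 Hj {j\<in>\<Lambda>. j \<le> r}"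
    using f(2) stage_subset_orth_sum by (intro exI[of _ "{1..}"]) (auto simp: assemble_w)
  moreover have "\<exists>\<phi>. associated_function (assemble h w gs) \<phi>"
    using all_equations_associated_function[OF f(1)] by blast
  ultimately show ?thesis
    unfolding X_set_def using all_equations_vectors[OF f(1)]
    by (simp add: assemble_Omega0)
qed

end

section \<open>A square-filling curve\<close>

text \<open>Schoenberg's function: it has period 2, is 0 within distance \<open>1/3\<close> of the even integers and 1 within
  distance \<open>1/3\<close> of the odd integers.\<close>

definition tent :: "real \<Rightarrow> real" where
  "tent t = max 0 (min 1 (1 / 2 - cos (pi * t)))"

text \<open>The coordinates \<open>i = 0\<close> and \<open>i = 1\<close> of Schoenberg's space-filling curve read the binary digits of a
  point from the ternary digits at even and odd places of the parameter.\<close>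

definition curve_coord :: "nat \<Rightarrow> real \<Rightarrow> real" where
  "curve_coord i t = (\<Sum>k. tent (3 ^ (2 * k + i) * t) / 2 ^ Suc k)"

lemma continuous_curve_coord: "continuous_on UNIV (curve_coord i)"
proof -
  have sm: "summable (\<lambda>k. 1 / 2 ^ Suc k :: real)"
    using summable_mult[OF summable_geometric[of "1/2::real"], of "1/2"] by (simp add: power_divide)
  have "uniform_limit UNIV (\<lambda>n t. \<Sum>k<n. tent (3 ^ (2 * k + i) * t) / 2 ^ Suc k) (curve_coord i) sequentially"
    unfolding curve_coord_def[abs_def]
    by (rule Weierstrass_m_test[OF _ sm]) (simp add: tent_def divide_right_mono)
  moreover have "continuous_on UNIV (\<lambda>t. \<Sum>k<n. tent (3 ^ (2 * k + i) * t) / 2 ^ Suc k)" for n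
    unfolding tent_def by (intro continuous_intros) auto
  ultimately show ?thesis
    by (intro uniform_limit_theorem[where F = sequentially]) auto
qed

text \<open>The points of the Cantor set, with ternary digits 0 and 2.\<close>

definition ternary :: "(nat \<Rightarrow> nat) \<Rightarrow> real" where
  "ternary b = (\<Sum>k. 2 * real (b k) / 3 ^ Suc k)"

lemma ternary_props:
  assumes b: "\<And>k. b k \<le> 1"
  shows "ternary b = (2 * real (b 0) + ternary (\<lambda>k. b (Suc k))) / 3" "0 \<le> ternary b" "ternary b \<le> 1"
proof -
  have g: "(\<lambda>k. 2 / 3 ^ Suc k :: real) sums 1"
    using sums_mult[OF geometric_sums[of "1/3::real"], of "2/3"] by (simp add: power_divide)
  have le: "2 * real (b k) / 3 ^ Suc k \<le> 2 / 3 ^ Suc k" for k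
    using b[of k] by (intro divide_right_mono) auto
  have sm: "summable (\<lambda>k. 2 * real (c k) / 3 ^ Suc k)" if "\<And>k. c k \<le> 1" for c
  proof (rule summable_comparison_test')
    show "summable (\<lambda>k. 2 / 3 ^ Suc k :: real)" using g sums_summable by blast
    show "norm (2 * real (c k) / 3 ^ Suc k) \<le> 2 / 3 ^ Suc k" for k
      using that[of k] by (auto intro!: divide_right_mono)
  qed
  show "ternary b = (2 * real (b 0) + ternary (\<lambda>k. b (Suc k))) / 3"
  proof -
    have "ternary b = 2 * real (b 0) / 3 + (\<Sum>k. 2 * real (b (Suc k)) / 3 ^ Suc (Suc k))"
      unfolding ternary_def using suminf_split_head[OF sm[of b, OF b]] by simp
    also have "(\<Sum>k. 2 * real (b (Suc k)) / 3 ^ Suc (Suc k)) = ternary (\<lambda>k. b (Suc k)) / 3"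
      unfolding ternary_def by (subst suminf_divide[OF sm, symmetric]) (use b in auto)
    finally show ?thesis by (simp add: field_simps)
  qed
  show "0 \<le> ternary b" unfolding ternary_def by (intro suminf_nonneg sm b) auto
  show "ternary b \<le> 1"
    using suminf_le[OF le sm[OF b] sums_summable[OF g]] sums_unique[OF g] by (simp add: ternary_def)
qed

text \<open>Multiplication by \<open>3^k\<close> moves the first \<open>k\<close> digits in front of the ternary point, where they form
  an even integer.\<close>

lemma cos_ternary_shift:
  assumes b: "\<And>k. b k \<le> 1"
  shows "cos (pi * (3 ^ k * ternary b)) = cos (pi * ternary (\<lambda>j. b (j + k)))"
  using b
proof (induction k arbitrary: b)
  case (Suc k)
  have "3 * ternary b = 2 * real (b 0) + ternary (\<lambda>k. b (Suc k))"
    using ternary_props(1)[of b] Suc.prems by simp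
  then have "3 ^ k * (3 * ternary b) = 3 ^ k * (2 * real (b 0) + ternary (\<lambda>k. b (Suc k)))"
    by simp
  then have "pi * (3 ^ Suc k * ternary b) =
      pi * (3 ^ k * ternary (\<lambda>k. b (Suc k))) + 2 * pi * of_int (3 ^ k * int (b 0))"
    by (simp add: algebra_simps)
  then have "cos (pi * (3 ^ Suc k * ternary b)) = cos (pi * (3 ^ k * ternary (\<lambda>k. b (Suc k))))"
    by (simp only:) (simp add: cos_add cos_int_2pin sin_int_2pin del: of_int_mult)
  also have "\<dots> = cos (pi * ternary (\<lambda>j. b (Suc (j + k))))"
    using Suc.prems by (intro Suc.IH)
  finally show ?case by simp
qed simp

lemma tent_ternary:
  assumes b: "\<And>k. b k \<le> 1"
  shows "tent (3 ^ k * ternary b) = real (b k)"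
proof -
  let ?c = "\<lambda>j. b (j + k)" let ?\<tau> = "ternary ?c"
  have c: "?c j \<le> 1" "?c (Suc j) \<le> 1" for j using b by auto
  have \<tau>: "?\<tau> = (2 * real (b k) + ternary (\<lambda>j. ?c (Suc j))) / 3"
    "0 \<le> ternary (\<lambda>j. ?c (Suc j))" "ternary (\<lambda>j. ?c (Suc j)) \<le> 1"
    using ternary_props[of ?c] ternary_props[of "\<lambda>j. ?c (Suc j)"] b by auto
  consider "b k = 0" | "b k = 1" using b[of k] by linarith
  then show ?thesis
  proof cases
    case 1
    then have "cos (pi / 3) \<le> cos (pi * ?\<tau>)"
      using \<tau> by (intro cos_monotone_0_pi_le) (auto simp: field_simps)
    then show ?thesis unfolding tent_def cos_ternary_shift[OF b] using 1 by (simp add: cos_60)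
  next
    case 2
    then have "cos (pi * ?\<tau>) \<le> cos (2 * pi / 3)"
      using \<tau> by (intro cos_monotone_0_pi_le) (auto simp: field_simps)
    then show ?thesis unfolding tent_def cos_ternary_shift[OF b] using 2 by (simp add: cos_120)
  qed
qed

lemma binary_expansion:
  fixes x :: real
  assumes "0 \<le> x" "x < 1"
  obtains b :: "nat \<Rightarrow> nat" where "\<And>k. b k \<le> 1" "(\<lambda>k. real (b k) / 2 ^ Suc k) sums x"
proof
  let ?f = "\<lambda>k. \<lfloor>2 ^ k * x\<rfloor>"
  let ?b = "\<lambda>k. nat (?f (Suc k) mod 2)"
  show "?b k \<le> 1" for k by linarith
  have half: "?f (Suc k) div 2 = ?f k" for k
    using floor_divide_real_eq_div[of 2 "2 ^ Suc k * x"] by (simp add: field_simps)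
  \<comment> \<open>With the last digit written as a difference of floors, the digit sum telescopes.\<close>
  have tele: "real (?b k) / 2 ^ Suc k = ?f (Suc k) / 2 ^ Suc k - ?f k / 2 ^ k" for k
  proof -
    have "?f (Suc k) mod 2 = ?f (Suc k) - 2 * ?f k"
      using half[of k] by (simp add: minus_div_mult_eq_mod [symmetric])
    then have "real (?b k) = real_of_int (?f (Suc k) - 2 * ?f k)"
      by (metis of_nat_nat pos_mod_sign zero_less_numeral of_int_of_nat_eq)
    then show ?thesis by (simp add: diff_divide_distrib)
  qed
  have lim: "(\<lambda>k. ?f k / 2 ^ k) \<longlonglongrightarrow> x"
  proof (rule tendsto_sandwich)
    show "\<forall>\<^sub>F k in sequentially. x - (1/2) ^ k \<le> ?f k / 2 ^ k"
    proof (intro always_eventually allI)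
      fix k
      have "2 ^ k * x - 1 \<le> ?f k" by linarith
      then have "(2 ^ k * x - 1) / 2 ^ k \<le> ?f k / 2 ^ k" by (intro divide_right_mono) auto
      then show "x - (1/2) ^ k \<le> ?f k / 2 ^ k" by (simp add: diff_divide_distrib power_divide)
    qed
    show "\<forall>\<^sub>F k in sequentially. ?f k / 2 ^ k \<le> x"
    proof (intro always_eventually allI)
      fix k
      have "real_of_int (?f k) / 2 ^ k \<le> (2 ^ k * x) / 2 ^ k" by (intro divide_right_mono) auto
      then show "?f k / 2 ^ k \<le> x" by simp
    qed
    show "(\<lambda>k. x - (1/2) ^ k) \<longlonglongrightarrow> x"
      using tendsto_diff[OF tendsto_const LIMSEQ_power_zero[of "1/2::real"], of x] by simp
  qed simp
  have "(\<Sum>k<n. real (?b k) / 2 ^ Suc k) = ?f n / 2 ^ n" for n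
  proof -
    have "?f 0 = 0" using assms by (simp add: floor_eq_iff)
    then show ?thesis unfolding tele by (subst sum_lessThan_telescope) simp
  qed
  then show "(\<lambda>k. real (?b k) / 2 ^ Suc k) sums x"
    unfolding sums_def using lim by simp
qed

lemma square_filling_curve:
  assumes "0 \<le> x" "x < 1" "0 \<le> y" "y < 1"
  obtains t where "0 \<le> t" "t \<le> 1" "curve_coord 0 t = x" "curve_coord 1 t = y"
proof -
  obtain a where a: "\<And>k. a k \<le> 1" "(\<lambda>k. real (a k) / 2 ^ Suc k) sums x"
    using binary_expansion assms by metis
  obtain b where b: "\<And>k. b k \<le> 1" "(\<lambda>k. real (b k) / 2 ^ Suc k) sums y"
    using binary_expansion assms by metis
  define c where "c k = (if even k then a (k div 2) else b (k div 2))" for k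
  have c: "c k \<le> 1" for k using a b by (simp add: c_def)
  have "curve_coord 0 (ternary c) = (\<Sum>k. real (a k) / 2 ^ Suc k)"
    "curve_coord 1 (ternary c) = (\<Sum>k. real (b k) / 2 ^ Suc k)"
    unfolding curve_coord_def tent_ternary[OF c] by (simp_all add: c_def del: power_Suc)
  then have "curve_coord 0 (ternary c) = x" "curve_coord 1 (ternary c) = y"
    using a(2) b(2) by (simp_all only: sums_iff)
  then show ?thesis by (rule that[OF ternary_props(2,3)[OF c]])
qed

section \<open>The theorem of Herglotz and Bochner on the torus\<close>

lemma sum_cis_grid:
  fixes x :: int
  assumes "n > 0" "\<bar>x\<bar> < int n"
  shows "(\<Sum>j<n. cis (2 * pi * real j * of_int x / real n)) = (if x = 0 then of_nat n else 0)"
proof (cases "x = 0")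
  case False
  let ?z = "cis (2 * pi * of_int x / real n)"
  have pow: "cis (2 * pi * real j * of_int x / real n) = ?z ^ j" for j
    by (simp only: Complex.DeMoivre) (simp add: algebra_simps)
  have "?z ^ n = cis (2 * pi * of_int x)"
    using assms(1) by (simp only: Complex.DeMoivre) simp
  then have zn: "?z ^ n = 1"
    using cis_multiple_2pi[of "of_int x"] by simp
  have "?z \<noteq> 1"
  proof
    assume "?z = 1"
    then have "cos (2 * pi * of_int x / real n) = 1" by (metis cis.sel(1) one_complex.sel(1))
    then obtain k :: int where "2 * pi * of_int x / real n = of_int k * 2 * pi"
      by (auto simp: cos_one_2pi_int)
    then have "real_of_int x = real_of_int k * real n"
      using assms(1) by (simp add: field_simps)
    then have "x = k * int n"
      by (metis of_int_eq_iff of_int_mult of_int_of_nat_eq)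
    then show False using assms(2) False by (auto simp: abs_mult mult_less_cancel_right2)
  qed
  then show ?thesis
    unfolding pow using False zn by (simp add: geometric_sum)
qed simp

lemma card_int_differences:
  fixes a :: int
  assumes "\<bar>a\<bar> \<le> int n"
  shows "(\<Sum>u\<in>{0..<int n}. \<Sum>v\<in>{0..<int n}. if u - v = a then 1 else 0 :: complex) = of_int (int n - \<bar>a\<bar>)"
proof -
  have "(\<Sum>v\<in>{0..<int n}. if u - v = a then 1 else 0 :: complex) = (if u \<in> {a..<int n + a} then 1 else 0)" for u
  proof -
    have "(\<Sum>v\<in>{0..<int n}. if u - v = a then 1 else 0 :: complex) = (\<Sum>v\<in>{0..<int n}. if v = u - a then 1 else 0)"
      by (intro sum.cong) auto
    then show ?thesis by (simp add: sum.delta)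
  qed
  then have "(\<Sum>u\<in>{0..<int n}. \<Sum>v\<in>{0..<int n}. if u - v = a then 1 else 0 :: complex)
      = (\<Sum>u\<in>{0..<int n}. if u \<in> {a..<int n + a} then 1 else 0)"
    by (intro sum.cong) auto
  also have "\<dots> = of_nat (card ({0..<int n} \<inter> {a..<int n + a}))"
    unfolding sum.inter_restrict[OF finite_atLeastLessThan_int, symmetric] by simp
  also have "card ({0..<int n} \<inter> {a..<int n + a}) = nat (int n - \<bar>a\<bar>)"
  proof (cases "a \<ge> 0")
    case True
    then have "{0..<int n} \<inter> {a..<int n + a} = {a..<int n}" by auto
    then show ?thesis using True by simp
  next
    case False
    then have "{0..<int n} \<inter> {a..<int n + a} = {0..<int n + a}" by auto
    then show ?thesis using False by simp
  qed
  also have "of_nat (nat (int n - \<bar>a\<bar>)) = (of_int (int n - \<bar>a\<bar>) :: complex)"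
    using assms by (simp only: of_nat_nat diff_ge_0_iff_ge)
  finally show ?thesis .
qed

lemma sum_Times_product:
  fixes f :: "'a \<Rightarrow> 'c::comm_semiring_0" and k :: "'b \<Rightarrow> 'c"
  shows "(\<Sum>v\<in>A \<times> B. f (fst v) * k (snd v)) = sum f A * sum k B"
  by (simp add: sum_product sum.cartesian_product case_prod_beta)

definition positive_definite2 :: "(int \<Rightarrow> int \<Rightarrow> complex) \<Rightarrow> bool" where
  "positive_definite2 c \<longleftrightarrow> (\<forall>F (\<alpha> :: int \<times> int \<Rightarrow> complex). finite F \<longrightarrow>
     (\<Sum>u\<in>F. \<Sum>v\<in>F. \<alpha> u * cnj (\<alpha> v) * c (fst u - fst v) (snd u - snd v)) \<in> \<real>\<^sub>\<ge>\<^sub>0)"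

definition grid_character :: "nat \<Rightarrow> nat \<times> nat \<Rightarrow> int \<times> int \<Rightarrow> complex" where
  "grid_character n j u = cis (2 * pi * (real (fst j) * of_int (fst u) + real (snd j) * of_int (snd u)) / real n)"

lemma sum_grid_character:
  assumes "n > 0" "\<bar>fst x\<bar> < int n" "\<bar>snd x\<bar> < int n"
  shows "(\<Sum>j\<in>{..<n} \<times> {..<n}. grid_character n j x) = (if x = (0, 0) then of_nat (n * n) else 0)"
proof -
  have "(\<Sum>j\<in>{..<n} \<times> {..<n}. grid_character n j x)
    = (\<Sum>i<n. \<Sum>j<n. cis (2 * pi * real i * of_int (fst x) / real n) * cis (2 * pi * real j * of_int (snd x) / real n))"
    unfolding sum.cartesian_product
    by (intro sum.cong) (auto simp: grid_character_def cis_mult add_divide_distrib ring_distribs mult.assoc)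
  also have "\<dots> = (\<Sum>i<n. cis (2 * pi * real i * of_int (fst x) / real n)) * (\<Sum>j<n. cis (2 * pi * real j * of_int (snd x) / real n))"
    by (simp only: sum_product)
  also have "\<dots> = (if x = (0, 0) then of_nat (n * n) else 0)"
    using assms by (cases x) (simp add: sum_cis_grid del: of_int_eq_iff)
  finally show ?thesis .
qed

text \<open>The weight of a grid point is the quadratic form of \<open>c\<close> evaluated at a character on a square of side
  \<open>n\<close>. The grid has \<open>2n\<close> points in each direction, hence its characters separate all differences that
  occur here, and summation over the grid leaves only the pairs with difference \<open>(a, b)\<close>. There are
  \<open>(n - \<bar>a\<bar>) (n - \<bar>b\<bar>)\<close> of them.\<close>

lemma fejer_weights:
  fixes c :: "int \<Rightarrow> int \<Rightarrow> complex"
  assumes pd: "positive_definite2 c" and n: "n > 0"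
  shows "\<exists>p :: nat \<times> nat \<Rightarrow> real. (\<forall>j. 0 \<le> p j) \<and>
    (\<forall>a b. \<bar>a\<bar> < int n \<longrightarrow> \<bar>b\<bar> < int n \<longrightarrow>
       (\<Sum>j\<in>{..<2 * n} \<times> {..<2 * n}. complex_of_real (p j) * grid_character (2 * n) j (a, b))
         = complex_of_real ((1 - \<bar>real_of_int a\<bar> / n) * (1 - \<bar>real_of_int b\<bar> / n)) * c a b)"
proof -
  let ?U = "{0..<int n}" let ?B = "?U \<times> ?U"
  let ?J = "{..<2 * n} \<times> {..<2 * n}"
  let ?w = "grid_character (2 * n)"
  \<comment> \<open>The mean over the \<open>4 n\<^sup>2\<close> points of the grid and the \<open>n\<^sup>2\<close> points of the square.\<close>
  define K where "K = 1 / (4 * real n ^ 4)"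
  define q where "q j = (\<Sum>u\<in>?B. \<Sum>v\<in>?B. cnj (?w j u) * ?w j v * c (fst u - fst v) (snd u - snd v))" for j
  have qR: "q j \<in> \<real>\<^sub>\<ge>\<^sub>0" for j
    using pd[unfolded positive_definite2_def, rule_format, of ?B "\<lambda>u. cnj (?w j u)"]
    by (simp add: q_def)
  have q: "q j = complex_of_real (Re (q j))" "0 \<le> Re (q j)" for j
    using qR[of j] by (auto simp: complex_nonneg_Reals_iff complex_eq_iff)
  show ?thesis
  proof (intro exI[of _ "\<lambda>j. K * Re (q j)"] conjI allI impI)
    show "0 \<le> K * Re (q j)" for j using q by (simp add: K_def)
    fix a b :: int assume ab: "\<bar>a\<bar> < int n" "\<bar>b\<bar> < int n"
    have chars: "cnj (?w j u) * ?w j v * ?w j (a, b) = ?w j (a - (fst u - fst v), b - (snd u - snd v))" for j u v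
      unfolding grid_character_def cis_cnj cis_mult
      by (rule arg_cong[where f = cis])
        (simp add: ring_distribs add_divide_distrib diff_divide_distrib)
    have orth: "(\<Sum>j\<in>?J. cnj (?w j u) * ?w j v * ?w j (a, b)) =
        4 * of_nat (n * n) * ((if fst u - fst v = a then 1 else 0) * (if snd u - snd v = b then 1 else 0))"
      if "u \<in> ?B" "v \<in> ?B" for u v
      unfolding chars
      by (subst sum_grid_character) (use n ab that in \<open>auto simp: mem_Times_iff\<close>)
    have "(\<Sum>j\<in>?J. (K * Re (q j)) * ?w j (a, b)) = K * (\<Sum>j\<in>?J. q j * ?w j (a, b))"
      using q(1) by (simp add: sum_distrib_left mult.assoc)
    also have "(\<Sum>j\<in>?J. q j * ?w j (a, b)) = (\<Sum>j\<in>?J. \<Sum>u\<in>?B. \<Sum>v\<in>?B.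
        c (fst u - fst v) (snd u - snd v) * (cnj (?w j u) * ?w j v * ?w j (a, b)))"
      unfolding q_def sum_distrib_right by (intro sum.cong refl) (simp add: mult_ac)
    also have "\<dots> = (\<Sum>u\<in>?B. \<Sum>v\<in>?B. \<Sum>j\<in>?J.
        c (fst u - fst v) (snd u - snd v) * (cnj (?w j u) * ?w j v * ?w j (a, b)))"
      by (subst sum.swap, rule sum.cong[OF refl], rule sum.swap)
    also have "\<dots> = (\<Sum>u\<in>?B. \<Sum>v\<in>?B. c (fst u - fst v) (snd u - snd v) *
        (4 * of_nat (n * n) * ((if fst u - fst v = a then 1 else 0) * (if snd u - snd v = b then 1 else 0))))"
      unfolding sum_distrib_left[symmetric] by (intro sum.cong refl) (simp only: orth)
    also have "\<dots> = (\<Sum>u\<in>?B. \<Sum>v\<in>?B. c a b * (4 * of_nat (n * n)) *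
        ((if fst u - fst v = a then 1 else 0) * (if snd u - snd v = b then 1 else 0)))"
      by (intro sum.cong refl) auto
    also have "\<dots> = c a b * (4 * of_nat (n * n)) * (\<Sum>u\<in>?B. \<Sum>v\<in>?B. 
        ((if fst u - fst v = a then 1 else 0) * (if snd u - snd v = b then 1 else 0)))"
      by (simp only: sum_distrib_left)
    also have "(\<Sum>u\<in>?B. \<Sum>v\<in>?B. ((if fst u - fst v = a then 1 else 0) * (if snd u - snd v = b then 1 else 0 :: complex)))
      = (\<Sum>u\<in>?U. \<Sum>v\<in>?U. if u - v = a then 1 else 0) * (\<Sum>u\<in>?U. \<Sum>v\<in>?U. if u - v = b then 1 else 0)"
    proof -
      have "(\<Sum>u\<in>?B. \<Sum>v\<in>?B. ((if fst u - fst v = a then 1 else 0) * (if snd u - snd v = b then 1 else 0 :: complex)))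
        = (\<Sum>u\<in>?B. (\<Sum>v\<in>?U. if fst u - v = a then 1 else 0) * (\<Sum>v\<in>?U. if snd u - v = b then 1 else 0))"
        by (intro sum.cong refl sum_Times_product)
      also have "\<dots> = (\<Sum>u\<in>?U. \<Sum>v\<in>?U. if u - v = a then 1 else 0) * (\<Sum>u\<in>?U. \<Sum>v\<in>?U. if u - v = b then 1 else 0)"
        by (rule sum_Times_product)
      finally show ?thesis .
    qed
    also have "\<dots> = of_int (int n - \<bar>a\<bar>) * of_int (int n - \<bar>b\<bar>)"
      by (subst (1 2) card_int_differences) (use ab in auto)
    also have "\<dots> = complex_of_real ((real n - \<bar>real_of_int a\<bar>) * (real n - \<bar>real_of_int b\<bar>))"
    proof -
      have "of_int (int n - \<bar>x\<bar>) = complex_of_real (real n - \<bar>real_of_int x\<bar>)" for x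
        by (metis of_int_abs of_int_diff of_int_of_nat_eq of_real_of_int_eq)
      then show ?thesis by simp
    qed
    also have "complex_of_real K * (c a b * (4 * of_nat (n * n)) *
        complex_of_real ((real n - \<bar>real_of_int a\<bar>) * (real n - \<bar>real_of_int b\<bar>)))
      = complex_of_real (K * (4 * (real n * real n)) * ((real n - \<bar>real_of_int a\<bar>) * (real n - \<bar>real_of_int b\<bar>))) * c a b"
      by (simp add: mult_ac)
    also have "K * (4 * (real n * real n)) * ((real n - \<bar>real_of_int a\<bar>) * (real n - \<bar>real_of_int b\<bar>))
      = (1 - \<bar>real_of_int a\<bar> / n) * (1 - \<bar>real_of_int b\<bar> / n)"
      using n by (simp add: K_def field_simps power4_eq_xxxx)
    finally show "(\<Sum>j\<in>?J. complex_of_real (K * Re (q j)) * ?w j (a, b))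
        = complex_of_real ((1 - \<bar>real_of_int a\<bar> / n) * (1 - \<bar>real_of_int b\<bar> / n)) * c a b" .
  qed
qed

definition torus_point :: "real \<Rightarrow> complex \<times> complex" where
  "torus_point t = (cis (2 * pi * curve_coord 0 t), cis (2 * pi * curve_coord 1 t))"

lemma continuous_torus_point: "continuous_on UNIV torus_point"
  unfolding torus_point_def cis_conv_exp
  by (intro continuous_intros continuous_curve_coord)

text \<open>Outside the grid any parameter will do; this makes the choice of parameters total.\<close>

lemma torus_grid_point:
  assumes "n > 0"
  shows "\<exists>t. 0 \<le> t \<and> t \<le> 1 \<and> (j \<in> {..<n} \<times> {..<n} \<longrightarrow>
    (\<forall>a b. fst (torus_point t) powi a * snd (torus_point t) powi b = grid_character n j (a, b)))"
proof (cases "j \<in> {..<n} \<times> {..<n}")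
  case True
  then obtain t where t: "0 \<le> t" "t \<le> 1" "curve_coord 0 t = real (fst j) / real n" "curve_coord 1 t = real (snd j) / real n"
    using assms square_filling_curve[of "real (fst j) / real n" "real (snd j) / real n"]
    by (auto simp: mem_Times_iff)
  have "fst (torus_point t) powi a * snd (torus_point t) powi b = grid_character n j (a, b)" for a b
    unfolding torus_point_def t fst_conv snd_conv cis_power_int cis_mult grid_character_def
    by (rule arg_cong[where f = cis]) (simp add: add_divide_distrib ring_distribs mult_ac)
  then show ?thesis using t by blast
qed (rule exI[of _ 0], simp)

text \<open>Masses \<open>p j\<close> at the points \<open>t j\<close> of the line, which may coincide.\<close>

lemma finitely_supported_distribution:
  fixes p :: "'b \<Rightarrow> real" and t :: "'b \<Rightarrow> real"
  assumes "finite J" "\<And>j. 0 \<le> p j" "sum p J = 1"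
  obtains \<rho> where "real_distribution \<rho>" "\<And>A. A \<in> sets borel \<Longrightarrow> t ` J \<subseteq> A \<Longrightarrow> measure \<rho> A = 1"
    "\<And>f :: real \<Rightarrow> complex. f \<in> borel_measurable borel \<Longrightarrow> integral\<^sup>L \<rho> f = (\<Sum>j\<in>J. p j * f (t j))"
proof
  let ?P = "point_measure J (\<lambda>j. ennreal (p j))"
  let ?\<rho> = "distr ?P borel t"
  have [measurable]: "t \<in> measurable ?P borel" by simp
  have "emeasure ?P (space ?P) = 1"
    using assms by (simp add: space_point_measure emeasure_point_measure_finite sum_ennreal)
  then interpret P: prob_space ?P by (rule prob_spaceI)
  interpret D: prob_space ?\<rho> by (rule P.prob_space_distr) measurable
  show "real_distribution ?\<rho>" by standard simp
  show "measure ?\<rho> A = 1" if "A \<in> sets borel" "t ` J \<subseteq> A" for A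
  proof -
    have "t -` A \<inter> space ?P = space ?P" using that by (auto simp: space_point_measure)
    then show ?thesis using that P.prob_space by (simp add: measure_distr)
  qed
  show "integral\<^sup>L ?\<rho> f = (\<Sum>j\<in>J. p j * f (t j))" if "f \<in> borel_measurable borel" for f :: "real \<Rightarrow> complex"
    using that assms by (simp add: integral_distr lebesgue_integral_point_measure_finite scaleR_conv_of_real)
qed

definition torus_measure :: "(complex \<times> complex) measure \<Rightarrow> bool" where
  "torus_measure \<nu> \<longleftrightarrow> finite_measure \<nu> \<and> sets \<nu> = sets borel \<and>
     (AE z in \<nu>. cmod (fst z) = 1 \<and> cmod (snd z) = 1)"

lemma borel_measurable_power_int [measurable (raw)]:
  fixes f :: "'b \<Rightarrow> complex"
  assumes [measurable]: "f \<in> borel_measurable M"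
  shows "(\<lambda>x. f x powi n) \<in> borel_measurable M"
  by (cases "n \<ge> 0") (simp_all add: power_int_def)

lemma borel_measurable_fst_snd [measurable]:
  "fst \<in> borel_measurable (borel :: (complex \<times> complex) measure)"
  "snd \<in> borel_measurable (borel :: (complex \<times> complex) measure)"
  by (intro borel_measurable_continuous_onI continuous_intros)+

text \<open>The Fejer weights, divided by their total mass, are placed at parameters of the square-filling curve in
  \<open>[0, 1]\<close>. These distributions are tight, a subsequence converges weakly, and characters composed
  with the curve are bounded and continuous, so their integrals converge to the limits of the Fejer
  means. If the total mass vanishes, then so does the positive definite function.\<close>

theorem herglotz_bochner_torus:
  fixes c :: "int \<Rightarrow> int \<Rightarrow> complex"
  assumes pd: "positive_definite2 c"
  shows "\<exists>\<nu>. torus_measure \<nu> \<and> (\<forall>a b. has_bochner_integral \<nu> (\<lambda>z. fst z powi a * snd z powi b) (c a b))"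
proof -
  define J where "J n = {..<2 * Suc n} \<times> {..<2 * Suc n}" for n
  define ch where "ch n = grid_character (2 * Suc n)" for n
  define D where "D n a b = (1 - \<bar>real_of_int a\<bar> / Suc n) * (1 - \<bar>real_of_int b\<bar> / Suc n)" for n a b
  define W where "W n p \<longleftrightarrow> (\<forall>j. 0 \<le> p j) \<and> (\<forall>a b. \<bar>a\<bar> < int (Suc n) \<longrightarrow> \<bar>b\<bar> < int (Suc n) \<longrightarrow>
    (\<Sum>j\<in>J n. complex_of_real (p j) * ch n j (a, b)) = complex_of_real (D n a b) * c a b)" for n p
  have finJ: "finite (J n)" for n by (simp add: J_def)
  have "\<exists>p. W n p" for n
    unfolding W_def J_def ch_def D_def by (rule fejer_weights[OF pd zero_less_Suc])
  then obtain p where W: "\<And>n. W n (p n)" by metis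
  have p0: "\<And>n j. 0 \<le> p n j" and
    p: "\<And>n a b. \<bar>a\<bar> < int (Suc n) \<Longrightarrow> \<bar>b\<bar> < int (Suc n) \<Longrightarrow>
       (\<Sum>j\<in>J n. complex_of_real (p n j) * ch n j (a, b)) = complex_of_real (D n a b) * c a b"
    using W by (auto simp: W_def)
  define C where "C = Re (c 0 0)"
  have sum_p: "complex_of_real (sum (p n) (J n)) = c 0 0" for n
    using p[of 0 n 0] by (simp add: grid_character_def ch_def D_def)
  have C: "sum (p n) (J n) = C" for n
    unfolding C_def sum_p[symmetric, of n] by simp
  have lim: "(\<lambda>n. complex_of_real (D n a b) * c a b) \<longlonglongrightarrow> c a b" for a b
  proof -
    have *: "(\<lambda>n. \<bar>x\<bar> / real (Suc n)) \<longlonglongrightarrow> 0" for x :: real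
      using LIMSEQ_Suc[OF lim_const_over_n[of "\<bar>x\<bar>"]] by simp
    have "(\<lambda>n. complex_of_real (D n a b) * c a b) \<longlonglongrightarrow> complex_of_real ((1 - 0) * (1 - 0)) * c a b"
      unfolding D_def by (intro tendsto_intros *)
    then show ?thesis by simp
  qed
  have large: "\<forall>\<^sub>F n in sequentially. \<bar>a\<bar> < int (Suc n) \<and> \<bar>b\<bar> < int (Suc n)" for a b
    using eventually_ge_at_top[of "nat (\<bar>a\<bar> + \<bar>b\<bar>)"] by eventually_elim linarith
  have "C \<ge> 0" using C[of 0] p0[of 0] by (metis sum_nonneg)
  show ?thesis
  proof (cases "C = 0")
    case True
    then have "\<forall>j\<in>J n. p n j = 0" for n
      using C[of n] p0[of n] sum_nonneg_eq_0_iff[OF finJ, of n "p n"] by simp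
    then have z: "complex_of_real (D n a b) * c a b = 0"
      if "\<bar>a\<bar> < int (Suc n)" "\<bar>b\<bar> < int (Suc n)" for n a b
      using p[OF that] by simp
    have "c a b = 0" for a b
    proof (rule LIMSEQ_unique[OF lim])
      have "\<forall>\<^sub>F n in sequentially. complex_of_real (D n a b) * c a b = 0"
        using large[of a b] by eventually_elim (use z in blast)
      then show "(\<lambda>n. complex_of_real (D n a b) * c a b) \<longlonglongrightarrow> 0"
        by (rule tendsto_eventually)
    qed
    moreover have "torus_measure (null_measure borel)"
      unfolding torus_measure_def by (auto intro!: finite_measureI AE_I'[of UNIV] simp: null_sets_def)
    ultimately show ?thesis by (intro exI[of _ "null_measure borel"]) simp
  next
    case False
    with \<open>C \<ge> 0\<close> have "C > 0" by simp
    define T where "T n j t \<longleftrightarrow> 0 \<le> t \<and> t \<le> 1 \<and> (j \<in> J n \<longrightarrow>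
      (\<forall>a b. fst (torus_point t) powi a * snd (torus_point t) powi b = ch n j (a, b)))" for n j t
    have "\<exists>t. T n j t" for n j
      unfolding T_def J_def ch_def by (rule torus_grid_point) simp
    then obtain t where T: "\<And>n j. T n j (t n j)" by metis
    define R where "R n \<rho> \<longleftrightarrow> real_distribution \<rho> \<and> (\<forall>A\<in>sets borel. t n ` J n \<subseteq> A \<longrightarrow> measure \<rho> A = 1) \<and>
      (\<forall>f :: real \<Rightarrow> complex. f \<in> borel_measurable borel \<longrightarrow>
         integral\<^sup>L \<rho> f = (\<Sum>j\<in>J n. complex_of_real (p n j / C) * f (t n j)))" for n \<rho>
    have "\<exists>\<rho>. R n \<rho>" for n
    proof -
      have "(\<Sum>j\<in>J n. p n j / C) = 1" using C[of n] \<open>C > 0\<close> by (simp flip: sum_divide_distrib)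
      then obtain \<rho> where "real_distribution \<rho>" "\<And>A. A \<in> sets borel \<Longrightarrow> t n ` J n \<subseteq> A \<Longrightarrow> measure \<rho> A = 1"
        "\<And>f :: real \<Rightarrow> complex. f \<in> borel_measurable borel \<Longrightarrow> integral\<^sup>L \<rho> f = (\<Sum>j\<in>J n. (p n j / C) * f (t n j))"
        using finitely_supported_distribution[of "J n" "\<lambda>j. p n j / C" "t n"] p0 \<open>C > 0\<close> finJ
        by (smt (verit) divide_nonneg_pos)
      then show ?thesis unfolding R_def by blast
    qed
    then obtain \<rho> where R: "\<And>n. R n (\<rho> n)" by metis
    have \<rho>: "real_distribution (\<rho> n)" for n using R by (simp add: R_def)
    have "tight \<rho>"
    proof (unfold tight_def, intro conjI allI impI \<rho>)
      fix \<epsilon> :: real assume "\<epsilon> > 0"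
      moreover have "measure (\<rho> n) {-1<..1} = 1" for n
      proof -
        have "t n ` J n \<subseteq> {-1<..1}"
        proof (rule image_subsetI)
          fix j show "t n j \<in> {-1<..1}" using T[of n j] by (simp add: T_def)
        qed
        then show ?thesis using R[of n] by (simp add: R_def)
      qed
      ultimately show "\<exists>a b. a < b \<and> (\<forall>n. 1 - \<epsilon> < measure (\<rho> n) {a<..b})"
        by (intro exI[of _ "-1"] exI[of _ 1]) simp
    qed
    from tight_imp_convergent_subsubsequence[OF this strict_mono_id] obtain r M where
      r: "strict_mono r" and M: "real_distribution M" and conv: "weak_conv_m (\<rho> \<circ> r) M"
      by auto
    interpret M: real_distribution M by fact
    let ?f = "\<lambda>a b t. fst (torus_point t) powi a * snd (torus_point t) powi b"
    have f1: "cmod (?f a b t) = 1" for a b t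
      by (simp add: torus_point_def norm_mult norm_power_int)
    have fcont: "continuous_on UNIV (?f a b)" for a b
      using continuous_torus_point
      by (intro continuous_intros) (auto simp: torus_point_def)
    have I: "integral\<^sup>L M (?f a b) = c a b / C" for a b
    proof (rule LIMSEQ_unique)
      show "(\<lambda>n. integral\<^sup>L ((\<rho> \<circ> r) n) (?f a b)) \<longlonglongrightarrow> integral\<^sup>L M (?f a b)"
      proof (rule weak_conv_imp_integral_bdd_continuous_conv[where B = 1])
        show "real_distribution ((\<rho> \<circ> r) n)" for n using \<rho> by simp
        show "isCont (?f a b) x" for x using fcont by (simp add: continuous_on_eq_continuous_at)
        show "norm (?f a b x) \<le> 1" for x by (simp only: f1 order_refl)
      qed (fact M conv)+
      have "(\<lambda>n. complex_of_real (D n a b) * c a b / C) \<longlonglongrightarrow> c a b / C"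
        using \<open>C > 0\<close> by (intro tendsto_divide lim) auto
      moreover have "\<forall>\<^sub>F n in sequentially. complex_of_real (D n a b) * c a b / C = integral\<^sup>L (\<rho> n) (?f a b)"
        using large[of a b]
      proof eventually_elim
        case (elim n)
        have "integral\<^sup>L (\<rho> n) (?f a b) = (\<Sum>j\<in>J n. (p n j / C) * ?f a b (t n j))"
          using R[of n] borel_measurable_continuous_onI[OF fcont] by (simp add: R_def)
        also have "\<dots> = (\<Sum>j\<in>J n. complex_of_real (p n j) * ch n j (a, b)) / C"
          unfolding sum_divide_distrib
        proof (rule sum.cong)
          show "(p n j / C) * ?f a b (t n j) = complex_of_real (p n j) * ch n j (a, b) / C" if "j \<in> J n" for j
            using T[of n j] that by (simp add: T_def)
        qed simp
        finally show ?case using p[of a n b] elim by simp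
      qed
      ultimately have "(\<lambda>n. integral\<^sup>L (\<rho> n) (?f a b)) \<longlonglongrightarrow> c a b / C"
        by (rule Lim_transform_eventually)
      then show "(\<lambda>n. integral\<^sup>L ((\<rho> \<circ> r) n) (?f a b)) \<longlonglongrightarrow> c a b / C"
        using LIMSEQ_subseq_LIMSEQ[OF _ r] by (fastforce simp: o_def)
    qed
    have [measurable]: "torus_point \<in> borel_measurable M"
      using borel_measurable_continuous_onI[OF continuous_torus_point] by simp
    let ?\<nu> = "density (distr M borel torus_point) (\<lambda>_. ennreal C)"
    have int: "has_bochner_integral ?\<nu> (\<lambda>z. fst z powi a * snd z powi b) (c a b)" for a b
    proof -
      have "integrable M (?f a b)"
      proof (rule M.integrable_const_bound[where B = 1])
        show "AE t in M. cmod (?f a b t) \<le> 1" using f1 by simp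
      qed measurable
      then have "has_bochner_integral M (?f a b) (c a b / C)" using I by (simp add: has_bochner_integral_iff)
      then have "has_bochner_integral (distr M borel torus_point) (\<lambda>z. fst z powi a * snd z powi b) (c a b / C)"
        by (simp add: has_bochner_integral_distr)
      then have "has_bochner_integral (distr M borel torus_point) (\<lambda>z. C *\<^sub>R (fst z powi a * snd z powi b)) (C *\<^sub>R (c a b / C))"
        by (rule has_bochner_integral_scaleR_right)
      moreover have "C *\<^sub>R (c a b / C) = c a b" using \<open>C > 0\<close> by (simp add: scaleR_conv_of_real)
      ultimately show ?thesis
        using \<open>C > 0\<close> by (intro has_bochner_integral_density) auto
    qed
    have "torus_measure ?\<nu>"
      unfolding torus_measure_def
    proof (intro conjI)
      have "has_bochner_integral ?\<nu> (\<lambda>z. 1 :: complex) (c 0 0)" using int[of 0 0] by simp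
      then have "integrable ?\<nu> (\<lambda>z. 1 :: complex)" by (simp add: has_bochner_integral_iff)
      then show "finite_measure ?\<nu>"
        by (intro finite_measureI) (simp add: integrable_iff_bounded top.not_eq_extremum)
      have "AE z in distr M borel torus_point. cmod (fst z) = 1 \<and> cmod (snd z) = 1"
        by (subst AE_distr_iff) (auto simp: torus_point_def)
      then show "AE z in ?\<nu>. cmod (fst z) = 1 \<and> cmod (snd z) = 1"
        by (subst AE_density) auto
    qed simp
    with int show ?thesis by blast
  qed
qed

section \<open>Measures determined by trigonometric moments\<close>

text \<open>Indicators of closed sets are pointwise limits of bounded continuous functions of the distance, and
  closed sets generate the Borel sets.\<close>

lemma finite_measure_eqI_bounded_continuous:
  fixes \<mu> \<nu> :: "'b::metric_space measure"
  assumes "finite_measure \<mu>" "finite_measure \<nu>"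
    and [measurable_cong]: "sets \<mu> = sets borel" "sets \<nu> = sets borel"
    and eq: "\<And>f :: 'b \<Rightarrow> real. continuous_on UNIV f \<Longrightarrow> (\<And>x. \<bar>f x\<bar> \<le> 1) \<Longrightarrow> integral\<^sup>L \<mu> f = integral\<^sup>L \<nu> f"
  shows "\<mu> = \<nu>"
proof (rule measure_eqI_generator_eq[where E = "Collect closed" and \<Omega> = UNIV and A = "\<lambda>_. UNIV"])
  interpret \<mu>: finite_measure \<mu> by fact
  interpret \<nu>: finite_measure \<nu> by fact
  show "emeasure \<mu> C = emeasure \<nu> C" if "C \<in> Collect closed" for C
  proof (cases "C = {}")
    case False
    have [measurable]: "C \<in> sets borel" using that by simp
    define f where "f n x = max 0 (1 - real n * infdist x C)" for n x
    have cont: "continuous_on UNIV (f n)" for n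
      unfolding f_def by (intro continuous_intros)
    have [measurable]: "f n \<in> borel_measurable borel" for n
      by (rule borel_measurable_continuous_onI[OF cont])
    have bnd: "\<bar>f n x\<bar> \<le> 1" for n x by (simp add: f_def infdist_nonneg)
    have lim: "(\<lambda>n. f n x) \<longlonglongrightarrow> indicator C x" for x
    proof (cases "x \<in> C")
      case True
      then have "f n x = 1" for n by (simp add: f_def)
      then show ?thesis using True by simp
    next
      case xC: False
      then have "infdist x C > 0"
        using that False infdist_pos_not_in_closed by auto
      then obtain k where k: "real k * infdist x C > 1" using reals_Archimedean3 by blast
      have "f n x = 0" if "n \<ge> k" for n
      proof -
        have "real k * infdist x C \<le> real n * infdist x C"
          using that by (intro mult_right_mono) (auto simp: infdist_nonneg)
        then show ?thesis using k by (simp add: f_def)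
      qed
      then have "\<forall>\<^sub>F n in sequentially. f n x = 0" by (auto simp: eventually_sequentially)
      then show ?thesis using xC by (simp add: tendsto_eventually)
    qed
    have conv: "(\<lambda>n. integral\<^sup>L M (f n)) \<longlonglongrightarrow> measure M C"
      if "finite_measure M" and [measurable_cong]: "sets M = sets borel" for M
    proof -
      interpret finite_measure M by fact
      have "(\<lambda>n. integral\<^sup>L M (f n)) \<longlonglongrightarrow> integral\<^sup>L M (indicator C)"
        by (rule integral_dominated_convergence[where w = "\<lambda>_. 1"]) (use lim bnd in auto)
      then show ?thesis using sets_eq_imp_space_eq[OF that(2)] by simp
    qed
    have "measure \<mu> C = measure \<nu> C"
    proof (rule LIMSEQ_unique)
      show "(\<lambda>n. integral\<^sup>L \<mu> (f n)) \<longlonglongrightarrow> measure \<mu> C" by (intro conv) fact+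
      show "(\<lambda>n. integral\<^sup>L \<mu> (f n)) \<longlonglongrightarrow> measure \<nu> C"
        unfolding eq[OF cont bnd] by (intro conv) fact+
    qed
    then show ?thesis by (simp add: \<mu>.emeasure_eq_measure \<nu>.emeasure_eq_measure)
  qed simp
  show "sets \<mu> = sigma_sets UNIV (Collect closed)" "sets \<nu> = sigma_sets UNIV (Collect closed)"
    using assms(3,4) by (simp_all add: borel_eq_closed)
qed (use assms in \<open>auto simp: Int_stable_def finite_measure.emeasure_finite\<close>)

inductive trig_poly :: "(complex \<times> complex \<Rightarrow> complex) \<Rightarrow> bool" where
  character: "trig_poly (\<lambda>z. fst z powi a * snd z powi b)"
| add: "trig_poly F \<Longrightarrow> trig_poly G \<Longrightarrow> trig_poly (\<lambda>z. F z + G z)"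
| scale: "trig_poly F \<Longrightarrow> trig_poly (\<lambda>z. c * F z)"

definition torus :: "(complex \<times> complex) set" where
  "torus = {z. cmod (fst z) = 1 \<and> cmod (snd z) = 1}"

lemma torus_nonzero: "z \<in> torus \<Longrightarrow> fst z \<noteq> 0 \<and> snd z \<noteq> 0"
  by (auto simp: torus_def)

text \<open>An identity on the torus only, since exponents do not add up at the origin.\<close>

lemma trig_poly_mult:
  assumes "trig_poly F" "trig_poly G"
  shows "\<exists>H. trig_poly H \<and> (\<forall>z\<in>torus. H z = F z * G z)"
  using assms(1)
proof induction
  case (character a b)
  show ?case using assms(2)
  proof induction
    case (character c d)
    show ?case
      by (rule exI[of _ "\<lambda>z. fst z powi (a + c) * snd z powi (b + d)"])
        (auto simp: torus_nonzero power_int_add mult_ac intro: trig_poly.character)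
  next
    case (add F G)
    then obtain H K where "trig_poly H" "\<forall>z\<in>torus. H z = fst z powi a * snd z powi b * F z"
      "trig_poly K" "\<forall>z\<in>torus. K z = fst z powi a * snd z powi b * G z" by blast
    then show ?case
      by (intro exI[of _ "\<lambda>z. H z + K z"]) (auto simp: ring_distribs intro: trig_poly.add)
  next
    case (scale F c)
    then obtain H where "trig_poly H" "\<forall>z\<in>torus. H z = fst z powi a * snd z powi b * F z" by blast
    then show ?case
      by (intro exI[of _ "\<lambda>z. c * H z"]) (auto simp: mult_ac intro: trig_poly.scale)
  qed
next
  case (add F F')
  then obtain H K where "trig_poly H" "\<forall>z\<in>torus. H z = F z * G z"
    "trig_poly K" "\<forall>z\<in>torus. K z = F' z * G z" by blast
  then show ?case
    by (intro exI[of _ "\<lambda>z. H z + K z"]) (auto simp: ring_distribs intro: trig_poly.add)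
next
  case (scale F c)
  then obtain H where "trig_poly H" "\<forall>z\<in>torus. H z = F z * G z" by blast
  then show ?case
    by (intro exI[of _ "\<lambda>z. c * H z"]) (auto simp: mult_ac intro: trig_poly.scale)
qed

lemma unit_circle_Re_Im:
  assumes "cmod z = 1"
  shows "complex_of_real (Re z) = (z + z powi -1) / 2" "complex_of_real (Im z) = (z - z powi -1) / (2 * \<i>)"
proof -
  have "z powi -1 = cnj z"
    using assms complex_norm_square[of z] by (simp add: power_int_minus inverse_eq_divide divide_eq_eq mult.commute)
  then show "complex_of_real (Re z) = (z + z powi -1) / 2" "complex_of_real (Im z) = (z - z powi -1) / (2 * \<i>)"
    by (simp_all add: complex_eq_iff complex_add_cnj complex_diff_cnj)
qed

text \<open>Real and imaginary parts are trigonometric polynomials because conjugation is inversion on the unit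
  circle.\<close>

lemma real_polynomial_on_torus:
  assumes "real_polynomial_function f"
  shows "\<exists>F. trig_poly F \<and> (\<forall>z\<in>torus. F z = complex_of_real (f z))"
  using assms
proof induction
  case (linear f)
  then interpret bounded_linear f .
  let ?F = "\<lambda>z :: complex \<times> complex. ((complex_of_real (f (1, 0)) / 2) * (fst z powi 1 * snd z powi 0) + (complex_of_real (f (1, 0)) / 2) * (fst z powi -1 * snd z powi 0))
    + ((complex_of_real (f (\<i>, 0)) / (2 * \<i>)) * (fst z powi 1 * snd z powi 0) + (-(complex_of_real (f (\<i>, 0)) / (2 * \<i>))) * (fst z powi -1 * snd z powi 0))
    + (((complex_of_real (f (0, 1)) / 2) * (fst z powi 0 * snd z powi 1) + (complex_of_real (f (0, 1)) / 2) * (fst z powi 0 * snd z powi -1))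
    + ((complex_of_real (f (0, \<i>)) / (2 * \<i>)) * (fst z powi 0 * snd z powi 1) + (-(complex_of_real (f (0, \<i>)) / (2 * \<i>))) * (fst z powi 0 * snd z powi -1)))"
  have "trig_poly ?F" by (intro trig_poly.intros)
  moreover have "?F z = f z" if z: "z \<in> torus" for z
  proof -
    have decomp: "z = Re (fst z) *\<^sub>R (1, 0) + Im (fst z) *\<^sub>R (\<i>, 0) + (Re (snd z) *\<^sub>R (0, 1) + Im (snd z) *\<^sub>R (0, \<i>))"
      by (simp add: prod_eq_iff complex_eq_iff)
    have "f z = Re (fst z) * f (1, 0) + Im (fst z) * f (\<i>, 0) + (Re (snd z) * f (0, 1) + Im (snd z) * f (0, \<i>))"
      by (subst decomp) (simp only: add scaleR real_scaleR_def)
    then have "complex_of_real (f z) = complex_of_real (Re (fst z)) * f (1, 0) + complex_of_real (Im (fst z)) * f (\<i>, 0)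
      + (complex_of_real (Re (snd z)) * f (0, 1) + complex_of_real (Im (snd z)) * f (0, \<i>))"
      by simp
    also have "\<dots> = ?F z"
      using z by (simp add: torus_def unit_circle_Re_Im add_divide_distrib diff_divide_distrib ring_distribs mult.commute)
    finally show ?thesis by simp
  qed
  ultimately show ?case by blast
next
  case (const c)
  have "trig_poly (\<lambda>z. complex_of_real c * (fst z powi 0 * snd z powi 0))" by (intro trig_poly.intros)
  then show ?case by (intro exI[of _ "\<lambda>z. complex_of_real c * (fst z powi 0 * snd z powi 0)"]) simp
next
  case (add f g)
  then obtain F G where "trig_poly F" "\<forall>z\<in>torus. F z = complex_of_real (f z)"
    "trig_poly G" "\<forall>z\<in>torus. G z = complex_of_real (g z)" by blast
  then show ?case by (intro exI[of _ "\<lambda>z. F z + G z"]) (auto intro: trig_poly.add)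
next
  case (mult f g)
  then obtain F G where FG: "trig_poly F" "\<forall>z\<in>torus. F z = complex_of_real (f z)"
    "trig_poly G" "\<forall>z\<in>torus. G z = complex_of_real (g z)" by blast
  obtain H where "trig_poly H" "\<forall>z\<in>torus. H z = F z * G z" using trig_poly_mult FG by blast
  then show ?case using FG by (intro exI[of _ H]) auto
qed

lemma torus_measure_AE: "torus_measure \<nu> \<Longrightarrow> AE z in \<nu>. z \<in> torus"
  by (simp add: torus_measure_def torus_def)

lemma compact_torus: "compact torus"
proof -
  have "torus = sphere 0 1 \<times> sphere 0 1" by (auto simp: torus_def)
  then show ?thesis by (metis compact_Times compact_sphere)
qed

lemma torus_measure_integrable:
  fixes f :: "complex \<times> complex \<Rightarrow> 'b::{banach, second_countable_topology}"
  assumes \<nu>: "torus_measure \<nu>" and f: "f \<in> borel_measurable borel" and B: "\<And>z. z \<in> torus \<Longrightarrow> norm (f z) \<le> B"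
  shows "integrable \<nu> f"
proof -
  interpret finite_measure \<nu> using \<nu> by (simp add: torus_measure_def)
  have [measurable_cong]: "sets \<nu> = sets borel" using \<nu> by (simp add: torus_measure_def)
  show ?thesis
    using torus_measure_AE[OF \<nu>] f B by (intro integrable_const_bound[where B = B]) (auto elim: eventually_mono)
qed

lemma trig_poly_integral_eq:
  assumes "trig_poly F" and \<nu>: "torus_measure \<nu>1" "torus_measure \<nu>2"
    and eq: "\<And>a b. integral\<^sup>L \<nu>1 (\<lambda>z. fst z powi a * snd z powi b) = integral\<^sup>L \<nu>2 (\<lambda>z. fst z powi a * snd z powi b)"
  shows "integrable \<nu>1 F \<and> integrable \<nu>2 F \<and> integral\<^sup>L \<nu>1 F = integral\<^sup>L \<nu>2 F"
  using assms(1)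
proof induction
  case (character a b)
  have "integrable \<nu> (\<lambda>z. fst z powi a * snd z powi b)" if "torus_measure \<nu>" for \<nu>
    by (rule torus_measure_integrable[OF that, where B = 1]) (auto simp: torus_def norm_mult norm_power_int)
  then show ?case using \<nu> eq by simp
qed auto

text \<open>By the theorem of Stone and Weierstrass, continuous functions on the torus are uniform limits of real
  polynomials, that is, of trigonometric polynomials.\<close>

theorem torus_measure_unique:
  assumes \<nu>: "torus_measure \<nu>1" "torus_measure \<nu>2"
    and eq: "\<And>a b. integral\<^sup>L \<nu>1 (\<lambda>z. fst z powi a * snd z powi b) = integral\<^sup>L \<nu>2 (\<lambda>z. fst z powi a * snd z powi b)"
  shows "\<nu>1 = \<nu>2"
proof (rule finite_measure_eqI_bounded_continuous)
  fix f :: "complex \<times> complex \<Rightarrow> real"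
  assume f: "continuous_on UNIV f" "\<And>z. \<bar>f z\<bar> \<le> 1"
  define B where "B = measure \<nu>1 UNIV + measure \<nu>2 UNIV"
  have "\<bar>integral\<^sup>L \<nu>1 f - integral\<^sup>L \<nu>2 f\<bar> \<le> e * B" if e: "e > 0" for e
  proof -
    obtain p where p: "real_polynomial_function p" "\<And>z. z \<in> torus \<Longrightarrow> \<bar>f z - p z\<bar> < e"
      using Stone_Weierstrass_real_polynomial_function[OF compact_torus continuous_on_subset[OF f(1) subset_UNIV] e] by blast
    obtain F where F: "trig_poly F" "\<forall>z\<in>torus. F z = complex_of_real (p z)"
      using real_polynomial_on_torus[OF p(1)] by blast
    have close: "\<bar>integral\<^sup>L \<nu> f - Re (integral\<^sup>L \<nu> F)\<bar> \<le> e * measure \<nu> UNIV"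
      if \<nu>: "torus_measure \<nu>" and F': "integrable \<nu> F" for \<nu>
    proof -
      interpret finite_measure \<nu> using \<nu> by (simp add: torus_measure_def)
      have sp: "space \<nu> = UNIV" using \<nu> sets_eq_imp_space_eq[of \<nu> borel] by (simp add: torus_measure_def)
      have fi: "integrable \<nu> f"
        by (rule torus_measure_integrable[OF \<nu>, where B = 1]) (use f borel_measurable_continuous_onI in auto)
      have "\<bar>integral\<^sup>L \<nu> f - Re (integral\<^sup>L \<nu> F)\<bar> = \<bar>\<integral>z. f z - Re (F z) \<partial>\<nu>\<bar>"
        using fi F' by simp
      also have "\<dots> \<le> (\<integral>z. \<bar>f z - Re (F z)\<bar> \<partial>\<nu>)" by (rule integral_abs_bound)
      also have "\<dots> \<le> (\<integral>z. e \<partial>\<nu>)"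
      proof (rule integral_mono_AE)
        show "AE z in \<nu>. \<bar>f z - Re (F z)\<bar> \<le> e"
          using torus_measure_AE[OF \<nu>] by eventually_elim (use F p in \<open>auto intro: less_imp_le\<close>)
      qed (use fi F' in auto)
      finally show ?thesis using sp by (simp add: mult.commute)
    qed
    have int: "integrable \<nu>1 F" "integrable \<nu>2 F" "integral\<^sup>L \<nu>1 F = integral\<^sup>L \<nu>2 F"
      using trig_poly_integral_eq[OF F(1) \<nu> eq] by auto
    show ?thesis
      using close[OF \<nu>(1) int(1)] close[OF \<nu>(2) int(2)]
      unfolding int(3) B_def ring_distribs by linarith
  qed
  then have "\<bar>integral\<^sup>L \<nu>1 f - integral\<^sup>L \<nu>2 f\<bar> \<le> 0"
  proof (cases "B = 0")
    case False
    then have B: "B > 0" by (simp add: B_def order_less_le)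
    show ?thesis
    proof (rule field_le_epsilon)
      fix e :: real assume "e > 0"
      then show "\<bar>integral\<^sup>L \<nu>1 f - integral\<^sup>L \<nu>2 f\<bar> \<le> 0 + e"
        using \<open>\<And>e. e > 0 \<Longrightarrow> \<bar>integral\<^sup>L \<nu>1 f - integral\<^sup>L \<nu>2 f\<bar> \<le> e * B\<close>[of "e / B"] B by simp
    qed
  qed (metis mult_zero_right zero_less_one)
  then show "integral\<^sup>L \<nu>1 f = integral\<^sup>L \<nu>2 f" by simp
qed (use \<nu> in \<open>auto simp: torus_measure_def\<close>)

definition cayley :: "real \<Rightarrow> complex" where
  "cayley x = (complex_of_real x - \<i>) / (complex_of_real x + \<i>)"

definition inv_cayley :: "complex \<Rightarrow> real" where
  "inv_cayley z = Re (\<i> * (1 + z) / (1 - z))"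

lemma of_real_add_ii_neq_0 [simp]: "complex_of_real x + \<i> \<noteq> 0" "complex_of_real x - \<i> \<noteq> 0" "\<i> + complex_of_real x \<noteq> 0"
  "complex_of_real x \<noteq> \<i>"
  by (simp_all add: complex_eq_iff)

lemma norm_cayley: "cmod (cayley x) = 1"
proof -
  have "cmod (complex_of_real x - \<i>) = cmod (complex_of_real x + \<i>)" by (simp add: cmod_def)
  then show ?thesis by (simp add: cayley_def norm_divide)
qed

lemma inv_cayley_cayley: "inv_cayley (cayley x) = x"
proof -
  have 1: "1 + cayley x = 2 * complex_of_real x / (complex_of_real x + \<i>)"
    "1 - cayley x = 2 * \<i> / (complex_of_real x + \<i>)"
    by (simp_all add: cayley_def field_simps)
  have "\<i> * (1 + cayley x) / (1 - cayley x) = complex_of_real x"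
    unfolding 1 by (simp add: field_simps)
  then show ?thesis by (simp add: inv_cayley_def)
qed

text \<open>Taking the real part in \<open>inv_cayley\<close> makes the function total and real valued; on the unit circle it
  changes nothing.\<close>

lemma inv_cayley_unit_circle:
  assumes "cmod z = 1" "z \<noteq> 1"
  shows "complex_of_real (inv_cayley z) + \<i> = 2 * \<i> / (1 - z)"
    "complex_of_real (inv_cayley z) - \<i> = 2 * \<i> * z / (1 - z)"
proof -
  have "z * cnj z = 1" using assms complex_norm_square[of z] by simp
  then have "cnj (\<i> * (1 + z) / (1 - z)) = \<i> * (1 + z) / (1 - z)"
    using assms(2) by (simp add: field_simps)
  then have "complex_of_real (inv_cayley z) = \<i> * (1 + z) / (1 - z)"
    unfolding inv_cayley_def by (metis Reals_cnj_iff of_real_Re)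
  then show "complex_of_real (inv_cayley z) + \<i> = 2 * \<i> / (1 - z)"
    "complex_of_real (inv_cayley z) - \<i> = 2 * \<i> * z / (1 - z)"
    using assms(2) by (simp_all add: field_simps)
qed

lemma cayley_measurable [measurable]: "cayley \<in> borel_measurable borel"
  unfolding cayley_def by measurable

lemma inv_cayley_measurable [measurable]: "inv_cayley \<in> borel_measurable borel"
  unfolding inv_cayley_def by measurable

lemma borel_measurable_fst_snd_real [measurable]:
  "fst \<in> borel_measurable (borel :: (real \<times> real) measure)"
  "snd \<in> borel_measurable (borel :: (real \<times> real) measure)"
  by (intro borel_measurable_continuous_onI continuous_intros)+

text \<open>The Cayley transform carries the plane into the torus and has a Borel measurable left inverse, so a
  measure can be recovered from its image.\<close>

theorem plane_measure_unique:
  assumes fin: "finite_measure \<mu>1" "finite_measure \<mu>2"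
    and sets: "sets \<mu>1 = sets borel" "sets \<mu>2 = sets borel"
    and eq: "\<And>a b. integral\<^sup>L \<mu>1 (\<lambda>x. cayley (fst x) powi a * cayley (snd x) powi b)
      = integral\<^sup>L \<mu>2 (\<lambda>x. cayley (fst x) powi a * cayley (snd x) powi b)"
  shows "\<mu>1 = \<mu>2"
proof -
  let ?C = "\<lambda>x. (cayley (fst x), cayley (snd x))"
  let ?I = "\<lambda>z. (inv_cayley (fst z), inv_cayley (snd z))"
  have tm: "torus_measure (distr \<mu> borel ?C)" if "finite_measure \<mu>" "sets \<mu> = sets borel" for \<mu>
  proof -
    interpret finite_measure \<mu> by fact
    note [measurable_cong] = that(2)
    have "AE z in distr \<mu> borel ?C. cmod (fst z) = 1 \<and> cmod (snd z) = 1"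
      by (subst AE_distr_iff) (auto simp: norm_cayley)
    moreover have "finite_measure (distr \<mu> borel ?C)" by (intro finite_measure_distr) measurable
    ultimately show ?thesis by (simp add: torus_measure_def)
  qed
  have roundtrip: "distr (distr \<mu> borel ?C) borel ?I = \<mu>" if "sets \<mu> = sets borel" for \<mu>
  proof -
    note [measurable_cong] = that
    have "distr (distr \<mu> borel ?C) borel ?I = distr \<mu> borel (\<lambda>x. x)"
      by (subst distr_distr) (auto simp: o_def inv_cayley_cayley)
    then show ?thesis using that by (simp add: distr_id2)
  qed
  have "distr \<mu>1 borel ?C = distr \<mu>2 borel ?C"
  proof (rule torus_measure_unique)
    fix a b
    note [measurable_cong] = sets
    show "integral\<^sup>L (distr \<mu>1 borel ?C) (\<lambda>z. fst z powi a * snd z powi b)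
      = integral\<^sup>L (distr \<mu>2 borel ?C) (\<lambda>z. fst z powi a * snd z powi b)"
      using eq by (simp add: integral_distr)
  qed (use tm fin sets in auto)
  then show ?thesis using roundtrip[OF sets(1)] roundtrip[OF sets(2)] by metis
qed

section \<open>Existence and uniqueness for extended moments\<close>

text \<open>Only as much positivity as is needed: for each \<open>K\<close>, that of the numbers which would be the trigonometric
  moments of \<open>(x\<^sub>1\<^sup>2 + 1)^K (x\<^sub>2\<^sup>2 + 1)^K \<mu>\<close>.\<close>

definition extended_functional :: "(idx \<Rightarrow> complex) \<Rightarrow> bool" where
  "extended_functional \<phi> \<longleftrightarrow> shift_relations \<phi> \<and>
     (\<forall>K::nat. positive_definite2 (\<lambda>a b. \<phi> (0, int K - a, int K + a, 0, int K - b, int K + b)))"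

text \<open>The function \<open>1 / (x + \<i>)\<close> in the coordinate \<open>z = cayley x\<close>.\<close>

definition resolvent_symbol :: "complex \<Rightarrow> complex" where
  "resolvent_symbol z = (1 - z) / (2 * \<i>)"

text \<open>With \<open>D = resolvent_symbol z\<close> one has \<open>x + \<i> = 1 / D\<close>, \<open>x - \<i> = z / D\<close> and \<open>\<bar>D\<bar>\<^sup>2 = D\<^sup>2 / z\<close>. At the
  point \<open>z = 1\<close>, which corresponds to infinity, both sides vanish because \<open>K\<close> and \<open>d\<close> are positive.\<close>

lemma resolvent_symbol_inv_cayley:
  assumes "cmod z = 1" and d: "int d = 2 * int K - k - l" "d > 0" and K: "K > 0"
  shows "complex_of_real (cmod (resolvent_symbol z) ^ (2 * K)) *
      ((complex_of_real (inv_cayley z) + \<i>) powi k * (complex_of_real (inv_cayley z) - \<i>) powi l)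
    = resolvent_symbol z ^ d * z powi (l - int K)" (is "?lhs = ?rhs")
proof (cases "z = 1")
  case True
  then show ?thesis using assms by (simp add: resolvent_symbol_def zero_power)
next
  case False
  let ?D = "resolvent_symbol z"
  have nz: "z \<noteq> 0" "?D \<noteq> 0" using assms(1) False by (auto simp: resolvent_symbol_def)
  have zc: "cnj z = 1 / z"
    using assms(1) nz complex_norm_square[of z] by (simp add: field_simps)
  have "cnj ?D = ?D / z"
    using nz by (simp add: resolvent_symbol_def zc field_simps)
  then have "complex_of_real (cmod ?D ^ 2) = ?D ^ 2 / z"
    by (simp only: complex_norm_square) (simp add: power2_eq_square)
  then have "complex_of_real (cmod ?D ^ (2 * K)) = (?D ^ 2 / z) ^ K"
    by (simp only: power_mult of_real_power)
  also have "\<dots> = ?D powi int (2 * K) * z powi (- int K)"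
    unfolding power_int_of_nat power_int_minus by (simp add: power_mult divide_inverse power_mult_distrib power_inverse)
  finally have "complex_of_real (cmod ?D ^ (2 * K)) = ?D powi (2 * int K) * z powi (- int K)"
    by simp
  moreover have "complex_of_real (inv_cayley z) + \<i> = 1 / ?D" "complex_of_real (inv_cayley z) - \<i> = z / ?D"
    using inv_cayley_unit_circle[OF assms(1) False] False by (simp_all add: resolvent_symbol_def field_simps)
  ultimately have "?lhs = (?D powi (2 * int K) * z powi (- int K)) * ((1 / ?D) powi k * (z / ?D) powi l)"
    by simp
  also have "\<dots> = ?D powi (2 * int K - k - l) * z powi (l - int K)"
    using nz by (simp add: power_int_diff power_int_divide_distrib power_int_minus power_int_add field_simps)
  also have "?D powi (2 * int K - k - l) = ?D ^ d"
    unfolding d(1)[symmetric] by simp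
  finally show ?thesis .
qed

text \<open>The identity \<open>D = (1 - z) / (2 \<i>)\<close> lowers the exponent of \<open>x + \<i>\<close> in the same way as the shift
  relations do for \<open>\<phi>\<close>: \<open>2 \<i> \<phi>(k, l) = \<phi>(k + 1, l) - \<phi>(k, l + 1)\<close>.\<close>

lemma resolvent_torus_moments:
  assumes \<phi>: "extended_functional \<phi>" and \<nu>: "torus_measure \<nu>"
    and mom: "\<And>a b. has_bochner_integral \<nu> (\<lambda>z. fst z powi a * snd z powi b)
      (\<phi> (0, int K - a, int K + a, 0, int K - b, int K + b))"
  shows "has_bochner_integral \<nu> (\<lambda>z. resolvent_symbol (fst z) ^ d * fst z powi p * (resolvent_symbol (snd z) ^ d' * snd z powi q))
    (\<phi> (0, int K - p - int d, int K + p, 0, int K - q - int d', int K + q))"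
proof -
  have solve: "X = (B - C) / (2 * \<i>)" if "A + \<i> * X = B" "A - \<i> * X = C" for A B C X :: complex
    using that by (auto simp: field_simps)
  have \<phi>1: "\<phi> (m, k, l, n, r, t) = (\<phi> (m, k + 1, l, n, r, t) - \<phi> (m, k, l + 1, n, r, t)) / (2 * \<i>)"
    and \<phi>2: "\<phi> (m, k, l, n, r, t) = (\<phi> (m, k, l, n, r + 1, t) - \<phi> (m, k, l, n, r, t + 1)) / (2 * \<i>)" for m k l n r t
    using \<phi> unfolding extended_functional_def shift_relations_def by (blast intro: solve)+
  have [measurable_cong]: "sets \<nu> = sets borel" using \<nu> by (simp add: torus_measure_def)
  have [measurable]: "(\<lambda>z. resolvent_symbol (fst z)) \<in> borel_measurable \<nu>" "(\<lambda>z. resolvent_symbol (snd z)) \<in> borel_measurable \<nu>"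
    unfolding resolvent_symbol_def by measurable
  have step: "resolvent_symbol z ^ Suc d * z powi p
      = (resolvent_symbol z ^ d * z powi p - resolvent_symbol z ^ d * z powi (p + 1)) / (2 * \<i>)"
    if "z \<noteq> 0" for z d p
    using that by (simp add: power_int_add resolvent_symbol_def field_simps)
  have 1: "has_bochner_integral \<nu> (\<lambda>z. resolvent_symbol (fst z) ^ d * fst z powi p * snd z powi q)
    (\<phi> (0, int K - p - int d, int K + p, 0, int K - q, int K + q))" for d p q
  proof (induction d arbitrary: p)
    case (Suc d)
    have "has_bochner_integral \<nu> (\<lambda>z. (resolvent_symbol (fst z) ^ d * fst z powi p * snd z powi q
        - resolvent_symbol (fst z) ^ d * fst z powi (p + 1) * snd z powi q) / (2 * \<i>))
      (\<phi> (0, int K - p - int (Suc d), int K + p, 0, int K - q, int K + q))"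
      using has_bochner_integral_divide[where y = "2 * \<i>", OF has_bochner_integral_diff[OF Suc.IH[of p] Suc.IH[of "p + 1"]]]
      by (subst \<phi>1) (simp add: algebra_simps)
    then show ?case
    proof (rule iffD1[OF has_bochner_integral_cong_AE, rotated -1])
      show "AE z in \<nu>. (resolvent_symbol (fst z) ^ d * fst z powi p * snd z powi q
        - resolvent_symbol (fst z) ^ d * fst z powi (p + 1) * snd z powi q) / (2 * \<i>)
        = resolvent_symbol (fst z) ^ Suc d * fst z powi p * snd z powi q"
        using torus_measure_AE[OF \<nu>]
      proof eventually_elim
        case (elim z)
        then show ?case unfolding step[OF torus_nonzero[OF elim, THEN conjunct1]] by (simp add: algebra_simps diff_divide_distrib)
      qed
    qed measurable
  qed (use mom in simp)
  show ?thesis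
  proof (induction d' arbitrary: q)
    case (Suc d')
    have "has_bochner_integral \<nu> (\<lambda>z. (resolvent_symbol (fst z) ^ d * fst z powi p * (resolvent_symbol (snd z) ^ d' * snd z powi q)
        - resolvent_symbol (fst z) ^ d * fst z powi p * (resolvent_symbol (snd z) ^ d' * snd z powi (q + 1))) / (2 * \<i>))
      (\<phi> (0, int K - p - int d, int K + p, 0, int K - q - int (Suc d'), int K + q))"
      using has_bochner_integral_divide[where y = "2 * \<i>", OF has_bochner_integral_diff[OF Suc.IH[of q] Suc.IH[of "q + 1"]]]
      by (subst \<phi>2) (simp add: algebra_simps)
    then show ?case
    proof (rule iffD1[OF has_bochner_integral_cong_AE, rotated -1])
      show "AE z in \<nu>. (resolvent_symbol (fst z) ^ d * fst z powi p * (resolvent_symbol (snd z) ^ d' * snd z powi q)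
        - resolvent_symbol (fst z) ^ d * fst z powi p * (resolvent_symbol (snd z) ^ d' * snd z powi (q + 1))) / (2 * \<i>)
        = resolvent_symbol (fst z) ^ d * fst z powi p * (resolvent_symbol (snd z) ^ Suc d' * snd z powi q)"
        using torus_measure_AE[OF \<nu>]
      proof eventually_elim
        case (elim z)
        then show ?case unfolding step[OF torus_nonzero[OF elim, THEN conjunct2]] by (simp add: algebra_simps diff_divide_distrib)
      qed
    qed measurable
  qed (use 1 in simp)
qed

text \<open>Transport from the torus to the plane, together with the division by
  \<open>(x\<^sub>1\<^sup>2 + 1)^K (x\<^sub>2\<^sup>2 + 1)^K\<close>. The density vanishes where \<open>z\<^sub>1 = 1\<close> or \<open>z\<^sub>2 = 1\<close>, so the arbitrary values
  of \<open>inv_cayley\<close> there do no harm.\<close>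

definition cayley_pullback :: "nat \<Rightarrow> (complex \<times> complex) measure \<Rightarrow> (real \<times> real) measure" where
  "cayley_pullback K \<nu> = distr (density \<nu> (\<lambda>z. ennreal (cmod (resolvent_symbol (fst z)) ^ (2 * K) * cmod (resolvent_symbol (snd z)) ^ (2 * K))))
     borel (\<lambda>z. (inv_cayley (fst z), inv_cayley (snd z)))"

lemma extended_monomial_eq:
  "extended_monomial (m, k, l, n, r, t) x =
     complex_of_real (fst x) ^ m * (complex_of_real (fst x) + \<i>) powi k * (complex_of_real (fst x) - \<i>) powi l *
     complex_of_real (snd x) ^ n * (complex_of_real (snd x) + \<i>) powi r * (complex_of_real (snd x) - \<i>) powi t"
  by (simp add: extended_monomial_def case_prod_beta)

lemma extended_monomial_measurable [measurable]: "extended_monomial p \<in> borel_measurable borel"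
proof (cases p)
  case (fields m k l n r t)
  show ?thesis unfolding fields extended_monomial_eq[abs_def] by measurable
qed

lemma cayley_pullback_moments:
  assumes \<phi>: "extended_functional \<phi>" and \<nu>: "torus_measure \<nu>" and K: "K > 0"
    and mom: "\<And>a b. has_bochner_integral \<nu> (\<lambda>z. fst z powi a * snd z powi b)
      (\<phi> (0, int K - a, int K + a, 0, int K - b, int K + b))"
    and kl: "k + l < 2 * int K" and rt: "r + t < 2 * int K"
  shows "has_bochner_integral (cayley_pullback K \<nu>) (extended_monomial (0, k, l, 0, r, t)) (\<phi> (0, k, l, 0, r, t))"
proof -
  have [measurable_cong]: "sets \<nu> = sets borel" using \<nu> by (simp add: torus_measure_def)
  have [measurable]: "(\<lambda>z. resolvent_symbol (fst z)) \<in> borel_measurable \<nu>" "(\<lambda>z. resolvent_symbol (snd z)) \<in> borel_measurable \<nu>"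
    unfolding resolvent_symbol_def by measurable
  define d where "d = nat (2 * int K - k - l)"
  define d' where "d' = nat (2 * int K - r - t)"
  have d: "int d = 2 * int K - k - l" "0 < d" "int d' = 2 * int K - r - t" "0 < d'"
    using kl rt by (auto simp: d_def d'_def)
  let ?w = "\<lambda>z. cmod (resolvent_symbol (fst z)) ^ (2 * K) * cmod (resolvent_symbol (snd z)) ^ (2 * K)"
  let ?I = "\<lambda>z. (inv_cayley (fst z), inv_cayley (snd z))"
  have "has_bochner_integral \<nu> (\<lambda>z. resolvent_symbol (fst z) ^ d * fst z powi (l - int K) * (resolvent_symbol (snd z) ^ d' * snd z powi (t - int K)))
    (\<phi> (0, int K - (l - int K) - int d, int K + (l - int K), 0, int K - (t - int K) - int d', int K + (t - int K)))"
    by (rule resolvent_torus_moments[OF \<phi> \<nu> mom])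
  also have "(0::nat, int K - (l - int K) - int d, int K + (l - int K), 0::nat, int K - (t - int K) - int d', int K + (t - int K)) = (0, k, l, 0, r, t)"
    using d by simp
  finally have "has_bochner_integral \<nu> (\<lambda>z. ?w z *\<^sub>R extended_monomial (0, k, l, 0, r, t) (?I z)) (\<phi> (0, k, l, 0, r, t))"
  proof (rule iffD1[OF has_bochner_integral_cong_AE, rotated -1])
    show "AE z in \<nu>. resolvent_symbol (fst z) ^ d * fst z powi (l - int K) * (resolvent_symbol (snd z) ^ d' * snd z powi (t - int K))
      = ?w z *\<^sub>R extended_monomial (0, k, l, 0, r, t) (?I z)"
      using torus_measure_AE[OF \<nu>]
    proof eventually_elim
      case (elim z)
      then have z: "cmod (fst z) = 1" "cmod (snd z) = 1" by (auto simp: torus_def)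
      show ?case
        unfolding resolvent_symbol_inv_cayley[OF z(1) d(1,2) K, symmetric] resolvent_symbol_inv_cayley[OF z(2) d(3,4) K, symmetric]
        by (simp add: extended_monomial_eq scaleR_conv_of_real mult_ac)
    qed
  qed measurable
  then have "has_bochner_integral (density \<nu> (\<lambda>z. ennreal (?w z))) (\<lambda>z. extended_monomial (0, k, l, 0, r, t) (?I z)) (\<phi> (0, k, l, 0, r, t))"
    by (intro has_bochner_integral_density) auto
  then show ?thesis
    unfolding cayley_pullback_def by (intro has_bochner_integral_distr) auto
qed

lemma cayley_eq_extended_monomial:
  "cayley (fst x) powi a * cayley (snd x) powi b = extended_monomial (0, - a, a, 0, - b, b) x"
  by (simp add: extended_monomial_eq cayley_def divide_inverse power_int_mult_distrib power_int_inverse power_int_minus mult_ac)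

lemma finite_measure_of_extended_moment:
  assumes "has_bochner_integral \<mu> (extended_monomial (0, 0, 0, 0, 0, 0)) v"
  shows "finite_measure \<mu>"
proof -
  have "integrable \<mu> (\<lambda>x. 1 :: complex)"
    using assms by (simp add: extended_monomial_eq[abs_def] has_bochner_integral_iff)
  then show ?thesis
    by (intro finite_measureI) (simp add: integrable_iff_bounded top.not_eq_extremum)
qed

text \<open>The exponents \<open>(- a, a; - b, b)\<close> give the trigonometric moments of the measure.\<close>

lemma extended_moments_determine_measure:
  assumes "sets \<mu>1 = sets borel" "sets \<mu>2 = sets borel"
    and "\<And>a b. has_bochner_integral \<mu>1 (extended_monomial (0, - a, a, 0, - b, b)) (c a b)"
    and "\<And>a b. has_bochner_integral \<mu>2 (extended_monomial (0, - a, a, 0, - b, b)) (c a b)"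
  shows "\<mu>1 = \<mu>2"
proof (rule plane_measure_unique)
  show "finite_measure \<mu>1" "finite_measure \<mu>2"
    using assms(3,4)[of 0 0] by (auto intro: finite_measure_of_extended_moment)
  show "integral\<^sup>L \<mu>1 (\<lambda>x. cayley (fst x) powi a * cayley (snd x) powi b)
      = integral\<^sup>L \<mu>2 (\<lambda>x. cayley (fst x) powi a * cayley (snd x) powi b)" for a b
    unfolding cayley_eq_extended_monomial using assms(3,4)[of a b] by (simp add: has_bochner_integral_iff)
qed (fact assms)+

text \<open>The measure obtained for \<open>K + 1\<close> has the right moments for \<open>k + l < 2 K + 2\<close> and \<open>r + t < 2 K + 2\<close>, which
  includes all trigonometric moments. So it does not depend on \<open>K\<close> and has the right moments for all
  exponents of \<open>x\<^sub>j \<plusminus> \<i>\<close>. The powers of \<open>x\<^sub>1\<close> and \<open>x\<^sub>2\<close> are added by the shift relations.\<close>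

theorem extended_moment_solution_exists:
  assumes \<phi>: "extended_functional \<phi>"
  shows "\<exists>\<mu>. extended_moment_solution \<phi> \<mu>"
proof -
  have "\<exists>\<mu>. sets \<mu> = sets borel \<and> (\<forall>k l r t. k + l < 2 * int (Suc K) \<longrightarrow> r + t < 2 * int (Suc K) \<longrightarrow>
      has_bochner_integral \<mu> (extended_monomial (0, k, l, 0, r, t)) (\<phi> (0, k, l, 0, r, t)))" for K
  proof -
    have "positive_definite2 (\<lambda>a b. \<phi> (0, int (Suc K) - a, int (Suc K) + a, 0, int (Suc K) - b, int (Suc K) + b))"
      using \<phi> unfolding extended_functional_def by blast
    from herglotz_bochner_torus[OF this] obtain \<nu> where \<nu>: "torus_measure \<nu>"
      "\<And>a b. has_bochner_integral \<nu> (\<lambda>z. fst z powi a * snd z powi b)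
        (\<phi> (0, int (Suc K) - a, int (Suc K) + a, 0, int (Suc K) - b, int (Suc K) + b))" by blast
    show ?thesis
      using cayley_pullback_moments[OF \<phi> \<nu>(1) zero_less_Suc \<nu>(2)]
      by (intro exI[of _ "cayley_pullback (Suc K) \<nu>"]) (simp add: cayley_pullback_def)
  qed
  then obtain M where M: "\<And>K. sets (M K) = sets borel"
    "\<And>K k l r t. k + l < 2 * int (Suc K) \<Longrightarrow> r + t < 2 * int (Suc K) \<Longrightarrow>
      has_bochner_integral (M K) (extended_monomial (0, k, l, 0, r, t)) (\<phi> (0, k, l, 0, r, t))"
    by metis
  let ?\<mu> = "M 0"
  have same: "M K = ?\<mu>" for K
  proof (rule extended_moments_determine_measure[OF M(1) M(1)])
    fix a b
    show "has_bochner_integral (M K) (extended_monomial (0, - a, a, 0, - b, b)) (\<phi> (0, - a, a, 0, - b, b))"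
      "has_bochner_integral ?\<mu> (extended_monomial (0, - a, a, 0, - b, b)) (\<phi> (0, - a, a, 0, - b, b))"
      by (rule M(2); simp)+
  qed
  have base: "has_bochner_integral ?\<mu> (extended_monomial (0, k, l, 0, r, t)) (\<phi> (0, k, l, 0, r, t))" for k l r t
  proof -
    define K where "K = nat \<bar>k + l\<bar> + nat \<bar>r + t\<bar>"
    have large: "x < 2 * int (Suc K)" if "x \<le> p" "0 \<le> p" "0 \<le> q" "int K = p + q" for x p q
      using that by simp
    have kl: "k + l < 2 * int (Suc K)"
      by (rule large[of _ "\<bar>k + l\<bar>" "\<bar>r + t\<bar>"]) (simp_all add: K_def)
    have rt: "r + t < 2 * int (Suc K)"
      by (rule large[of _ "\<bar>r + t\<bar>" "\<bar>k + l\<bar>"]) (simp_all add: K_def)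
    from M(2)[OF kl rt] show ?thesis unfolding same[of K] .
  qed
  have rel: "\<phi> (Suc m, k, l, n, r, t) = \<phi> (m, k + 1, l, n, r, t) - \<i> * \<phi> (m, k, l, n, r, t)"
    "\<phi> (m, k, l, Suc n, r, t) = \<phi> (m, k, l, n, r + 1, t) - \<i> * \<phi> (m, k, l, n, r, t)" for m k l n r t
  proof -
    have "\<phi> (m + 1, k, l, n, r, t) + \<i> * \<phi> (m, k, l, n, r, t) = \<phi> (m, k + 1, l, n, r, t)"
      "\<phi> (m, k, l, n + 1, r, t) + \<i> * \<phi> (m, k, l, n, r, t) = \<phi> (m, k, l, n, r + 1, t)"
      using \<phi> unfolding extended_functional_def shift_relations_def by blast+
    then show "\<phi> (Suc m, k, l, n, r, t) = \<phi> (m, k + 1, l, n, r, t) - \<i> * \<phi> (m, k, l, n, r, t)"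
      "\<phi> (m, k, l, Suc n, r, t) = \<phi> (m, k, l, n, r + 1, t) - \<i> * \<phi> (m, k, l, n, r, t)"
      by (simp_all add: eq_diff_eq)
  qed
  have mon: "extended_monomial (Suc m, k, l, n, r, t) = (\<lambda>x. extended_monomial (m, k + 1, l, n, r, t) x - \<i> * extended_monomial (m, k, l, n, r, t) x)"
    "extended_monomial (m, k, l, Suc n, r, t) = (\<lambda>x. extended_monomial (m, k, l, n, r + 1, t) x - \<i> * extended_monomial (m, k, l, n, r, t) x)" for m k l n r t
    by (simp_all add: fun_eq_iff extended_monomial_eq power_int_add algebra_simps)
  have m: "has_bochner_integral ?\<mu> (extended_monomial (m, k, l, 0, r, t)) (\<phi> (m, k, l, 0, r, t))" for m k l r t
    by (induction m arbitrary: k)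
      (auto simp only: base mon rel intro!: has_bochner_integral_diff has_bochner_integral_mult_right)
  have "has_bochner_integral ?\<mu> (extended_monomial (m, k, l, n, r, t)) (\<phi> (m, k, l, n, r, t))" for m k l n r t
    by (induction n arbitrary: r)
      (auto simp only: m mon rel intro!: has_bochner_integral_diff has_bochner_integral_mult_right)
  then have "extended_moment_solution \<phi> ?\<mu>"
    unfolding extended_moment_solution_def using M(1) by (auto simp: split_paired_all)
  then show ?thesis by blast
qed

theorem extended_moment_solution_unique:
  assumes "extended_moment_solution \<phi> \<mu>1" "extended_moment_solution \<phi> \<mu>2"
  shows "\<mu>1 = \<mu>2"
  using assms unfolding extended_moment_solution_def
  by (intro extended_moments_determine_measure[where c = "\<lambda>a b. \<phi> (0, - a, a, 0, - b, b)"]) auto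

section \<open>Extended moments of a solution\<close>

lemma norm_add_ii_bounds: "1 \<le> cmod (complex_of_real x + \<i>)" "cmod (complex_of_real x + \<i>) \<le> 1 + x\<^sup>2"
  "1 \<le> cmod (complex_of_real x - \<i>)" "cmod (complex_of_real x - \<i>) \<le> 1 + x\<^sup>2"
proof -
  have *: "cmod (complex_of_real x + \<i>) = sqrt (1 + x\<^sup>2)" "cmod (complex_of_real x - \<i>) = sqrt (1 + x\<^sup>2)"
    by (simp_all add: cmod_def add.commute)
  have "sqrt (1 + x\<^sup>2) \<le> sqrt ((1 + x\<^sup>2)\<^sup>2)"
    unfolding power2_eq_square[of "1 + x\<^sup>2"] by (intro real_sqrt_le_mono) (simp add: ring_distribs)
  then show "1 \<le> cmod (complex_of_real x + \<i>)" "cmod (complex_of_real x + \<i>) \<le> 1 + x\<^sup>2"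
    "1 \<le> cmod (complex_of_real x - \<i>)" "cmod (complex_of_real x - \<i>) \<le> 1 + x\<^sup>2"
    unfolding * by simp_all
qed

lemma power_int_bound:
  fixes b B :: real
  assumes "1 \<le> b" "b \<le> B"
  shows "b powi k \<le> B ^ nat \<bar>k\<bar>"
proof -
  have "b powi k \<le> b powi \<bar>k\<bar>" using assms by (intro power_int_increasing) auto
  also have "\<dots> = b ^ nat \<bar>k\<bar>" by (simp add: power_int_nonneg_exp)
  also have "\<dots> \<le> B ^ nat \<bar>k\<bar>" using assms by (intro power_mono) auto
  finally show ?thesis .
qed

lemma extended_monomial_bound:
  "cmod (extended_monomial (m, k, l, n, r, t) x) \<le>
    (1 + (fst x)\<^sup>2) ^ (m + nat \<bar>k\<bar> + nat \<bar>l\<bar>) * (1 + (snd x)\<^sup>2) ^ (n + nat \<bar>r\<bar> + nat \<bar>t\<bar>)"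
proof -
  have one: "\<bar>y\<bar> ^ m * cmod (complex_of_real y + \<i>) powi k * cmod (complex_of_real y - \<i>) powi l
      \<le> (1 + y\<^sup>2) ^ (m + nat \<bar>k\<bar> + nat \<bar>l\<bar>)" for y m k l
  proof -
    have "\<bar>y\<bar> \<le> 1 + y\<^sup>2"
    proof (cases "\<bar>y\<bar> \<le> 1")
      case False
      then have "\<bar>y\<bar> * 1 \<le> \<bar>y\<bar> * \<bar>y\<bar>" by (intro mult_left_mono) auto
      then show ?thesis by (simp add: power2_eq_square)
    qed (simp add: add_increasing2)
    then have "\<bar>y\<bar> ^ m \<le> (1 + y\<^sup>2) ^ m" by (intro power_mono) auto
    then show ?thesis unfolding power_add
      by (intro mult_mono power_int_bound norm_add_ii_bounds) auto
  qed
  show ?thesis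
    using mult_mono[OF one[of "fst x" m k l] one[of "snd x" n r t]]
    by (simp add: extended_monomial_eq norm_mult norm_power norm_power_int mult_ac)
qed

context
  fixes s \<mu> assumes \<mu>: "moment_solution s \<mu>"
begin

lemma moment_solution_sets [measurable_cong]: "sets \<mu> = sets borel"
  using \<mu> by (simp add: moment_solution_def)

text \<open>Each factor \<open>1 + x\<^sub>j\<^sup>2\<close> is expanded into monomials.\<close>

lemma integrable_polynomial_weight:
  "integrable \<mu> (\<lambda>x. fst x ^ m * snd x ^ n * (1 + (fst x)\<^sup>2) ^ A * (1 + (snd x)\<^sup>2) ^ B)"
proof (induction A arbitrary: m n B)
  case 0
  show ?case
  proof (induction B arbitrary: n)
    case 0
    have "integrable \<mu> (\<lambda>x. complex_of_real (fst x ^ m * snd x ^ n))"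
      using \<mu> unfolding moment_solution_def has_bochner_integral_iff by (simp add: case_prod_unfold)
    then show ?case by (simp only: complex_of_real_integrable_eq) simp
  next
    case (Suc B)
    show ?case using Bochner_Integration.integrable_add[OF Suc.IH[of n] Suc.IH[of "n + 2"]]
      by (simp add: algebra_simps power2_eq_square)
  qed
next
  case (Suc A)
  show ?case using Bochner_Integration.integrable_add[OF Suc.IH[of m n B] Suc.IH[of "m + 2" n B]]
    by (simp add: algebra_simps power2_eq_square)
qed

lemma integrable_extended_monomial: "integrable \<mu> (extended_monomial p)"
proof -
  obtain m k l n r t where p: "p = (m, k, l, n, r, t)" by (cases p)
  show ?thesis
  proof (rule Bochner_Integration.integrable_bound)
    show "integrable \<mu> (\<lambda>x. (1 + (fst x)\<^sup>2) ^ (m + nat \<bar>k\<bar> + nat \<bar>l\<bar>) * (1 + (snd x)\<^sup>2) ^ (n + nat \<bar>r\<bar> + nat \<bar>t\<bar>))"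
      using integrable_polynomial_weight[of 0 0] by simp
    show "AE x in \<mu>. norm (extended_monomial p x) \<le>
      norm ((1 + (fst x)\<^sup>2) ^ (m + nat \<bar>k\<bar> + nat \<bar>l\<bar>) * (1 + (snd x)\<^sup>2) ^ (n + nat \<bar>r\<bar> + nat \<bar>t\<bar>))"
      using extended_monomial_bound[of m k l n r t] unfolding p by (intro AE_I2) (simp add: abs_mult)
  qed measurable
qed

definition ext_moment :: "idx \<Rightarrow> complex" where
  "ext_moment p = integral\<^sup>L \<mu> (extended_monomial p)"

lemma ext_moment: "has_bochner_integral \<mu> (extended_monomial p) (ext_moment p)"
  unfolding ext_moment_def by (rule has_bochner_integral_integrable[OF integrable_extended_monomial])

lemma extended_moment_solution_ext_moment: "extended_moment_solution ext_moment \<mu>"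
  unfolding extended_moment_solution_def using ext_moment moment_solution_sets by blast

lemma ext_moment_Omega0: "ext_moment (m, 0, 0, n, 0, 0) = s m n"
  using \<mu> by (simp add: moment_solution_def ext_moment_def extended_monomial_eq[abs_def] has_bochner_integral_iff case_prod_unfold)

lemma shift_relations_ext_moment: "shift_relations ext_moment"
proof -
  have "extended_monomial (m + 1, k, l, n, r, t) x + \<i> * extended_monomial (m, k, l, n, r, t) x = extended_monomial (m, k + 1, l, n, r, t) x"
    "extended_monomial (m + 1, k, l, n, r, t) x - \<i> * extended_monomial (m, k, l, n, r, t) x = extended_monomial (m, k, l + 1, n, r, t) x"
    "extended_monomial (m, k, l, n + 1, r, t) x + \<i> * extended_monomial (m, k, l, n, r, t) x = extended_monomial (m, k, l, n, r + 1, t) x"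
    "extended_monomial (m, k, l, n + 1, r, t) x - \<i> * extended_monomial (m, k, l, n, r, t) x = extended_monomial (m, k, l, n, r, t + 1) x"
    for m k l n r t x
    by (simp_all add: extended_monomial_eq power_int_add algebra_simps)
  note rel = this[symmetric]
  have add: "ext_moment p + \<i> * ext_moment q = ext_moment u" if "\<And>x. extended_monomial u x = extended_monomial p x + \<i> * extended_monomial q x" for p q u
    using has_bochner_integral_add[OF ext_moment has_bochner_integral_mult_right[OF ext_moment], of p \<i> q] ext_moment[of u]
    unfolding that[symmetric] by (simp add: has_bochner_integral_eq)
  have diff: "ext_moment p - \<i> * ext_moment q = ext_moment u" if "\<And>x. extended_monomial u x = extended_monomial p x - \<i> * extended_monomial q x" for p q u
    using has_bochner_integral_diff[OF ext_moment has_bochner_integral_mult_right[OF ext_moment], of p \<i> q] ext_moment[of u]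
    unfolding that[symmetric] by (simp add: has_bochner_integral_eq)
  show ?thesis
    unfolding shift_relations_def by (intro allI conjI add diff rel)
qed

lemma extended_monomial_conj_sum:
  "extended_monomial p x * cnj (extended_monomial q x) = extended_monomial (conj_sum p q) x"
  by (cases p; cases q) (simp add: extended_monomial_eq power_int_add power_add complex_cnj_power_int mult_ac)

lemma has_bochner_integral_gram:
  "has_bochner_integral \<mu> (\<lambda>x. extended_monomial p x * cnj (extended_monomial q x)) (ext_moment (conj_sum p q))"
  unfolding extended_monomial_conj_sum by (rule ext_moment)

lemma ext_moment_commute: "ext_moment (conj_sum q p) = cnj (ext_moment (conj_sum p q))"
proof -
  have "has_bochner_integral \<mu> (\<lambda>x. cnj (extended_monomial p x * cnj (extended_monomial q x))) (cnj (ext_moment (conj_sum p q)))"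
    by (rule has_bochner_integral_cnj[OF has_bochner_integral_gram])
  then show ?thesis
    using has_bochner_integral_gram[of q p] by (simp add: has_bochner_integral_eq mult.commute)
qed

lemma ext_moment_bound_integrand:
  "ext_moment (conj_sum p p) = complex_of_real (\<integral>x. bound_integrand p x \<partial>\<mu>)"
proof -
  have "extended_monomial p x * cnj (extended_monomial p x) = complex_of_real (bound_integrand p x)" for x
  proof -
    obtain m k l n r t where p: "p = (m, k, l, n, r, t)" by (cases p)
    let ?a = "complex_of_real (fst x)" and ?b = "complex_of_real (snd x)"
    have prod: "(of_real y ^ 2 + 1) powi k = (complex_of_real y + \<i>) powi k * (complex_of_real y - \<i>) powi k" for y k
      unfolding power_int_mult_distrib[symmetric] by (simp add: algebra_simps power2_eq_square)
    have "complex_of_real (bound_integrand p x) = ?a ^ (2 * m) * (?a ^ 2 + 1) powi k * (?a ^ 2 + 1) powi l *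
        ?b ^ (2 * n) * (?b ^ 2 + 1) powi r * (?b ^ 2 + 1) powi t"
      unfolding p bound_integrand_def by (simp add: case_prod_unfold of_real_power_int)
    also have "\<dots> = extended_monomial p x * cnj (extended_monomial p x)"
      unfolding prod p by (simp add: extended_monomial_eq complex_cnj_power_int mult_2_right power_add mult_ac)
    finally show ?thesis ..
  qed
  then have "ext_moment (conj_sum p p) = (\<integral>x. complex_of_real (bound_integrand p x) \<partial>\<mu>)"
    using has_bochner_integral_gram[of p p] by (simp add: has_bochner_integral_iff)
  then show ?thesis by (simp only: integral_complex_of_real)
qed

text \<open>A linear combination of the vectors \<open>f p\<close> and the same combination of the extended monomials. Both are
  tracked together because the coefficients are not determined by the vector.\<close>

inductive combination :: "(idx \<Rightarrow> 'a::separable_chilbert) \<Rightarrow> idx set \<Rightarrow> 'a \<Rightarrow> (real \<times> real \<Rightarrow> complex) \<Rightarrow> bool"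
  for f I where
  zero: "combination f I 0 (\<lambda>x. 0)"
| base: "p \<in> I \<Longrightarrow> combination f I (f p) (extended_monomial p)"
| add: "combination f I v F \<Longrightarrow> combination f I v' F' \<Longrightarrow> combination f I (v + v') (\<lambda>x. F x + F' x)"
| scale: "combination f I v F \<Longrightarrow> combination f I (scaleC c v) (\<lambda>x. c * F x)"

lemma combination_inner:
  assumes f: "\<And>p q. p \<in> I \<Longrightarrow> q \<in> I \<Longrightarrow> cinner (f p) (f q) = ext_moment (conj_sum p q)"
    and v: "combination f I v F" and u: "combination f I u G"
  shows "has_bochner_integral \<mu> (\<lambda>x. F x * cnj (G x)) (cinner v u)"
proof -
  have 1: "has_bochner_integral \<mu> (\<lambda>x. F x * cnj (extended_monomial q x)) (cinner v (f q))" if "q \<in> I" for q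
    using v
  proof induction
    case (base p)
    then show ?case using has_bochner_integral_gram[of p q] f that by simp
  next
    case (add v F v' F')
    then show ?case using has_bochner_integral_add[OF add.IH] by (simp add: ring_distribs cinner_add_left)
  next
    case (scale v F c)
    then show ?case using has_bochner_integral_mult_right[OF scale.IH, of c] by (simp add: mult.assoc cinner_scaleC_left)
  qed (simp add: has_bochner_integral_zero)
  show ?thesis
    using u
  proof induction
    case (add v F v' F')
    then show ?case using has_bochner_integral_add[OF add.IH] by (simp add: ring_distribs cinner_add_right)
  next
    case (scale v F c)
    then show ?case using has_bochner_integral_mult_right[OF scale.IH, of "cnj c"] by (simp add: mult_ac cinner_scaleC_right)
  qed (simp_all add: 1 has_bochner_integral_zero)
qed

lemma combination_span: "combination f I v F \<Longrightarrow> v \<in> cspan (f ` I)"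
  by (induction rule: combination.induct)
    (auto intro: complex_vector.span_zero complex_vector.span_add complex_vector.span_scale complex_vector.span_base)

text \<open>The required scalar products form a linear functional on the span of the vectors \<open>f p\<close>. Its bound is
  \<open>0 \<le> \<integral>\<bar>F - E\<bar>\<^sup>2 d\<mu>\<close>, where \<open>E\<close> is the extended monomial of index \<open>q\<close> and \<open>F\<close> the combination of
  monomials that corresponds to a vector of the span.\<close>

lemma one_step_extension:
  fixes f :: "idx \<Rightarrow> 'a::separable_chilbert"
  assumes f: "\<And>p q. p \<in> I \<Longrightarrow> q \<in> I \<Longrightarrow> cinner (f p) (f q) = ext_moment (conj_sum p q)"
  obtains y where "y \<in> closed_cspan (f ` I)" "\<And>p. p \<in> I \<Longrightarrow> cinner y (f p) = ext_moment (conj_sum q p)"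
    "(norm y)\<^sup>2 \<le> Re (ext_moment (conj_sum q q))"
proof -
  define D where "D = {(v, z). \<exists>F. combination f I v F \<and> has_bochner_integral \<mu> (\<lambda>x. F x * cnj (extended_monomial q x)) z}"
  let ?\<kappa> = "Re (ext_moment (conj_sum q q))"
  show ?thesis
  proof (rule riesz_representation[of D ?\<kappa>])
    show "(0, 0) \<in> D"
      unfolding D_def using combination.zero[of f I] by (auto intro!: exI[of _ "\<lambda>_. 0"])
    show "(v + v', z + z') \<in> D" if vz: "(v, z) \<in> D" "(v', z') \<in> D" for v z v' z'
    proof -
      obtain F F' where "combination f I v F" "has_bochner_integral \<mu> (\<lambda>x. F x * cnj (extended_monomial q x)) z"
        "combination f I v' F'" "has_bochner_integral \<mu> (\<lambda>x. F' x * cnj (extended_monomial q x)) z'"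
        using vz by (auto simp: D_def)
      then show ?thesis unfolding D_def
        using combination.add[of f I v F v' F'] has_bochner_integral_add[of \<mu> "\<lambda>x. F x * cnj (extended_monomial q x)" z "\<lambda>x. F' x * cnj (extended_monomial q x)" z']
        by (auto simp: ring_distribs intro!: exI[of _ "\<lambda>x. F x + F' x"])
    qed
    show "(scaleC c v, c * z) \<in> D" if vz: "(v, z) \<in> D" for c v z
    proof -
      obtain F where "combination f I v F" "has_bochner_integral \<mu> (\<lambda>x. F x * cnj (extended_monomial q x)) z"
        using vz by (auto simp: D_def)
      then show ?thesis unfolding D_def
        using combination.scale[of f I v F c] has_bochner_integral_mult_right[of c \<mu> "\<lambda>x. F x * cnj (extended_monomial q x)" z]
        by (auto simp: mult.assoc intro!: exI[of _ "\<lambda>x. c * F x"])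
    qed
    show "2 * Re z \<le> (norm v)\<^sup>2 + ?\<kappa>" if vz: "(v, z) \<in> D" for v z
    proof -
      obtain F where F: "combination f I v F" and z: "has_bochner_integral \<mu> (\<lambda>x. F x * cnj (extended_monomial q x)) z"
        using vz by (auto simp: D_def)
      have "has_bochner_integral \<mu> (\<lambda>x. F x * cnj (F x) + extended_monomial q x * cnj (extended_monomial q x)
          - (F x * cnj (extended_monomial q x) + cnj (F x * cnj (extended_monomial q x))))
        (cinner v v + ext_moment (conj_sum q q) - (z + cnj z))"
        by (intro has_bochner_integral_add has_bochner_integral_diff has_bochner_integral_cnj z
            combination_inner[OF f F F] has_bochner_integral_gram)
      then have "has_bochner_integral \<mu> (\<lambda>x. Re ((F x - extended_monomial q x) * cnj (F x - extended_monomial q x)))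
        (Re (cinner v v + ext_moment (conj_sum q q) - (z + cnj z)))"
        by (intro has_bochner_integral_Re) (simp add: algebra_simps)
      then have int: "has_bochner_integral \<mu> (\<lambda>x. (cmod (F x - extended_monomial q x))\<^sup>2) ((norm v)\<^sup>2 + ?\<kappa> - 2 * Re z)"
        unfolding complex_norm_square[symmetric] by (simp add: cinner_self)
      have "0 \<le> integral\<^sup>L \<mu> (\<lambda>x. (cmod (F x - extended_monomial q x))\<^sup>2)" by simp
      also have "\<dots> = (norm v)\<^sup>2 + ?\<kappa> - 2 * Re z"
        using int by (rule has_bochner_integral_integral_eq)
      finally show ?thesis by simp
    qed
    fix y assume y: "y \<in> closure (fst ` D)" "\<And>v z. (v, z) \<in> D \<Longrightarrow> cinner v y = z" "(norm y)\<^sup>2 \<le> ?\<kappa>"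
    show ?thesis
    proof (rule that)
      have "fst ` D \<subseteq> cspan (f ` I)" by (auto simp: D_def combination_span)
      then show "y \<in> closed_cspan (f ` I)" unfolding closed_cspan_def using y(1) closure_mono by blast
      show "cinner y (f p) = ext_moment (conj_sum q p)" if "p \<in> I" for p
      proof -
        have "(f p, ext_moment (conj_sum p q)) \<in> D"
          unfolding D_def using combination.base[OF that] has_bochner_integral_gram[of p q] by blast
        then have "cinner (f p) y = ext_moment (conj_sum p q)" by (rule y(2))
        then show ?thesis by (subst cinner_commute) (simp add: ext_moment_commute[of q p])
      qed
    qed (fact y(3))
  qed
qed

end

section \<open>Every solution is found by the algorithm\<close>

context model
begin

lemma condition_a_of_solution:
  assumes \<mu>: "moment_solution s \<mu>"
  shows "condition_a h"
  unfolding condition_a_def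
proof (intro allI impI, elim conjE)
  fix V E assume E: "eq_instance V E" and V: "V \<subseteq> Omega0"
  let ?A = "\<lambda>(m, _, _, n, _, _) (m', _, _, n', _, _). cinner (h m n) (h m' n')"
  have "E ?A = E (\<lambda>p q. ext_moment \<mu> (conj_sum p q))"
  proof (rule eq_instance_cong[OF E])
    fix p q assume "p \<in> V" "q \<in> V"
    then have "p \<in> Omega0" "q \<in> Omega0" using V by auto
    then show "?A p q = ext_moment \<mu> (conj_sum p q)"
      by (auto simp: Omega0_def gram_h ext_moment_Omega0[OF \<mu>])
  qed
  then show "E ?A" using eq_instance_conj_sum[OF E shift_relations_ext_moment[OF \<mu>]] by simp
qed

text \<open>The tuples which the algorithm can produce and whose Gram matrix, together with the given vectors, is
  that of the extended monomials in \<open>L\<^sup>2(\<mu>)\<close>.\<close>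

definition represents :: "(real \<times> real) measure \<Rightarrow> nat \<Rightarrow> (nat \<Rightarrow> 'a) \<Rightarrow> bool" where
  "represents \<mu> r hs \<longleftrightarrow> hs \<in> G_set h N g e w M r \<and>
     (\<forall>p\<in>prescribed r. \<forall>q\<in>prescribed r. gram (assemble h w hs) p q = ext_moment \<mu> (conj_sum p q))"

lemma represents_0:
  assumes \<mu>: "moment_solution s \<mu>"
  shows "represents \<mu> 0 (\<lambda>_. undefined)"
  unfolding represents_def prescribed_def
  by (auto simp: Omega0_def assemble_Omega0 gram_h ext_moment_Omega0[OF \<mu>])

text \<open>The new vector is the one provided by \<open>one_step_extension\<close> plus a nonnegative multiple of
  \<open>e (Suc r)\<close> that corrects its norm, so that the phase can be taken to be 0.\<close>

lemma represents_Suc: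
  assumes \<mu>: "moment_solution s \<mu>" and hs: "represents \<mu> r hs"
  shows "\<exists>x. represents \<mu> (Suc r) (hs(Suc r := x))"
proof -
  let ?q = "w (Suc r)" and ?f = "assemble h w hs"
  have G: "hs \<in> G_set h N g e w M r"
    and gram: "\<And>p q. p \<in> prescribed r \<Longrightarrow> q \<in> prescribed r \<Longrightarrow> gram ?f p q = ext_moment \<mu> (conj_sum p q)"
    using hs by (auto simp: represents_def)
  have st: "hs j \<in> stage j" if "1 \<le> j" "j \<le> r" for j
    using G_set_sound[OF condition_a_of_solution[OF \<mu>] G] that by blast
  obtain y where y: "y \<in> closed_cspan (?f ` prescribed r)"
    "\<And>p. p \<in> prescribed r \<Longrightarrow> cinner y (?f p) = ext_moment \<mu> (conj_sum ?q p)"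
    "(norm y)\<^sup>2 \<le> Re (ext_moment \<mu> (conj_sum ?q ?q))"
    using one_step_extension[OF \<mu> gram] by blast
  define d where "d = (\<integral>x. bound_integrand ?q x \<partial>\<mu>)"
  have d: "ext_moment \<mu> (conj_sum ?q ?q) = complex_of_real d"
    unfolding d_def by (rule ext_moment_bound_integrand[OF \<mu>])
  have dM: "d \<le> M (Suc r)" using M \<mu> by (simp add: admissible_bounds_def d_def)
  have "y \<in> stage r"
  proof -
    have "closed_cspan (?f ` prescribed r) \<subseteq> stage r"
      using assemble_stage st
      by (intro closed_cspan_minimal subspace_stage) (auto simp: stage_def closed_closed_cspan)
    then show ?thesis using y(1) by blast
  qed
  define \<alpha> where "\<alpha> = restrict (\<lambda>n. cinner y (g n)) N"
  define \<beta> where "\<beta> = restrict (\<lambda>j. cinner y (e j)) {1..<Suc r}"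
  have \<alpha>: "(\<lambda>n. (cmod (\<alpha> n))\<^sup>2) summable_on N"
    using bessel_summable[OF g_orthonormal, of y] by (simp add: \<alpha>_def cong: summable_on_cong)
  have "old_part r \<alpha> \<beta> = old_part r (\<lambda>n. cinner y (g n)) (\<lambda>j. cinner y (e j))"
    unfolding old_part_def \<alpha>_def \<beta>_def by (intro arg_cong2[where f = "(+)"] infsum_cong sum.cong) auto
  then have y_eq: "y = old_part r \<alpha> \<beta>" using old_part_expansion[OF \<open>y \<in> stage r\<close>] by simp
  have sq: "coeff_sq N (Suc r) \<alpha> \<beta> \<le> d"
    using y(3) old_part_props(3)[OF \<alpha>, of r \<beta>] by (simp add: d flip: y_eq)
  let ?x = "new_vector N g e (Suc r) \<alpha> \<beta> d 0"
  let ?hs = "hs(Suc r := ?x)"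
  have step: "step_gram h N g e w (Suc r) \<alpha> \<beta> d hs p p' = ext_moment \<mu> (conj_sum p p')"
    if pp: "p \<in> prescribed (Suc r)" "p' \<in> prescribed (Suc r)" for p p'
  proof -
    have ci: "coeff_inner N g e (Suc r) \<alpha> \<beta> (?f u) = ext_moment \<mu> (conj_sum ?q u)" if "u \<in> prescribed r" for u
      using y(2)[OF that] old_part_props(2)[OF \<alpha>, of r \<beta>] by (simp flip: y_eq)
    have old: "u \<in> prescribed r" if "u \<in> prescribed (Suc r)" "u \<noteq> ?q" for u
      using that by (simp add: prescribed_Suc)
    show ?thesis
      using pp old[of p] old[of p'] ci gram d ext_moment_commute[OF \<mu>, of p ?q] unfolding step_gram_def by auto
  qed
  have "L_holds h N g e w (Suc r) \<alpha> \<beta> d hs"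
    unfolding L_holds_def
  proof (intro allI impI, elim conjE)
    fix V E assume E: "eq_instance V E" and "V \<subseteq> Omega0 \<union> w ` {1..Suc r}"
    then have V: "V \<subseteq> prescribed (Suc r)" by (simp add: prescribed_def)
    have "E (step_gram h N g e w (Suc r) \<alpha> \<beta> d hs) = E (\<lambda>p q. ext_moment \<mu> (conj_sum p q))"
      using V by (intro eq_instance_cong[OF E] step) auto
    then show "E (step_gram h N g e w (Suc r) \<alpha> \<beta> d hs)"
      using eq_instance_conj_sum[OF E shift_relations_ext_moment[OF \<mu>]] by simp
  qed
  then have "(\<alpha>, \<beta>, d, hs) \<in> S_hat h N g e w M (Suc r) (G_set h N g e w M r)"
    unfolding S_hat_def S_set_def using G \<alpha> sq dM by (simp add: \<alpha>_def \<beta>_def)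
  then have "?hs \<in> G_set h N g e w M (Suc r)"
    unfolding G_set.simps using pi_gt_zero by (intro CollectI exI[of _ \<alpha>] exI[of _ \<beta>] exI[of _ d] exI[of _ hs] exI[of _ 0]) auto
  moreover have "gram (assemble h w ?hs) p q = ext_moment \<mu> (conj_sum p q)"
    if "p \<in> prescribed (Suc r)" "q \<in> prescribed (Suc r)" for p q
    using step[OF that] step_gram_eq[OF \<alpha> sq st that, of 0] by simp
  ultimately show ?thesis unfolding represents_def by blast
qed

text \<open>The tuples are chosen one after the other, each extending the previous one, and have a common
  extension to a sequence.\<close>

lemma solution_in_bold_G:
  assumes \<mu>: "moment_solution s \<mu>"
  shows "\<exists>gs\<in>bold_G h N g e w M. associated_function (assemble h w gs) (ext_moment \<mu>)"
proof -
  have "\<exists>F. \<forall>r. represents \<mu> r (F r) \<and> (\<exists>x. F (Suc r) = (F r)(Suc r := x))"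
  proof (rule dependent_nat_choice)
    show "\<exists>hs. represents \<mu> 0 hs" using represents_0[OF \<mu>] by blast
    show "\<exists>hs'. represents \<mu> (Suc r) hs' \<and> (\<exists>x. hs' = hs(Suc r := x))" if "represents \<mu> r hs" for hs r
      using represents_Suc[OF \<mu> that] by blast
  qed
  then obtain F where F: "\<And>r. represents \<mu> r (F r)" and F_Suc: "\<And>r. \<exists>x. F (Suc r) = (F r)(Suc r := x)"
    by blast
  define gs where "gs = restrict (\<lambda>j. F j j) {1..}"
  have F_old: "F r j = F j j" if "j \<le> r" for r j
    using that
  proof (induction r)
    case (Suc r)
    then show ?case using F_Suc[of r] by (cases "j = Suc r") auto
  qed simp
  \<comment> \<open>Needed because tuples are compared as extensional functions.\<close>
  have F_undef: "F r j = undefined" if "j \<notin> {1..r}" for r j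
    using that
  proof (induction r)
    case 0
    have "F 0 \<in> G_set h N g e w M 0" using F[of 0] by (simp add: represents_def)
    then show ?case by simp
  next
    case (Suc r)
    then show ?case using F_Suc[of r] by auto
  qed
  have F_gs: "restrict gs {1..r} = F r" for r
  proof
    fix j show "restrict gs {1..r} j = F r j"
      by (cases "j \<in> {1..r}") (auto simp: gs_def F_undef F_old[of j r])
  qed
  have gram: "gram (assemble h w gs) p q = ext_moment \<mu> (conj_sum p q)" for p q
  proof -
    have "\<exists>r. p \<in> prescribed r" for p
    proof (cases p rule: index_cases)
      case (2 j)
      then show ?thesis by (intro exI[of _ j]) (simp add: w_prescribed_iff)
    qed (auto simp: prescribed_def)
    then obtain r1 r2 where "p \<in> prescribed r1" "q \<in> prescribed r2" by blast
    then have r: "p \<in> prescribed (max r1 r2)" "q \<in> prescribed (max r1 r2)"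
      by (force simp: prescribed_def)+
    have "assemble h w gs u = assemble h w (F (max r1 r2)) u" if "u \<in> prescribed (max r1 r2)" for u
      using that by (rule assemble_cong) (simp flip: F_gs)
    then show ?thesis using F[of "max r1 r2"] r by (simp add: represents_def)
  qed
  have norm: "norm (gs j) \<le> sqrt (M j)" if "j \<ge> 1" for j
  proof -
    have "complex_of_real ((norm (gs j))\<^sup>2) = complex_of_real (\<integral>x. bound_integrand (w j) x \<partial>\<mu>)"
      using gram[of "w j" "w j"] that
      unfolding ext_moment_bound_integrand[OF \<mu>] by (simp add: assemble_w cinner_self)
    then have "(norm (gs j))\<^sup>2 = (\<integral>x. bound_integrand (w j) x \<partial>\<mu>)" by (simp only: of_real_eq_iff)
    also have "\<dots> \<le> M j" using M \<mu> that by (simp add: admissible_bounds_def)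
    finally show ?thesis by (rule real_le_rsqrt)
  qed
  have "gs \<in> bold_H M"
    unfolding bold_H_def
  proof (intro CollectI conjI bdd_aboveI2[where M = 1])
    show "1 / sqrt (M r) * norm (gs r) \<le> 1" if "r \<in> {1..}" for r
      using norm[of r] that M by (simp add: admissible_bounds_def)
  qed (simp add: gs_def)
  then have "gs \<in> bold_G_step h N g e w M r" for r
    unfolding bold_G_step_def mem_Collect_eq F_gs
    using F[of r] norm by (simp add: represents_def)
  then have "gs \<in> bold_G h N g e w M" by (simp add: bold_G_def)
  then show ?thesis using gram unfolding associated_function_conj_sum by blast
qed

section \<open>Every sequence found by the algorithm gives a solution\<close>

text \<open>The quadratic forms are squared norms of combinations of the vectors with exponents
  \<open>(K - a, a; K - b, b)\<close>.\<close>

lemma extended_functional_of_equations: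
  assumes f: "all_equations f" and \<phi>: "associated_function f \<phi>"
  shows "extended_functional \<phi>"
proof -
  have \<phi>_eq: "\<phi> p = cinner (f p) (f (0, 0, 0, 0, 0, 0))" for p
    using \<phi> all_equations_associated_function[OF f] by simp
  have "shift_relations \<phi>"
    unfolding shift_relations_def \<phi>_eq all_equations_vectors[OF f, symmetric]
    by (simp add: cinner_add_left cinner_diff_left cinner_scaleC_left)
  moreover have "positive_definite2 (\<lambda>a b. \<phi> (0, int K - a, int K + a, 0, int K - b, int K + b))" for K
    unfolding positive_definite2_def
  proof (intro allI impI)
    fix F :: "(int \<times> int) set" and \<alpha> :: "int \<times> int \<Rightarrow> complex"
    assume "finite F"
    let ?v = "\<lambda>u. f (0, int K - fst u, fst u, 0, int K - snd u, snd u)"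
    let ?X = "\<Sum>u\<in>F. scaleC (\<alpha> u) (?v u)"
    have inner: "\<phi> (0, int K - (fst u - fst v), int K + (fst u - fst v), 0, int K - (snd u - snd v), int K + (snd u - snd v))
        = cinner (?v u) (?v v)" for u v
      using \<phi> by (simp add: associated_function_conj_sum algebra_simps)
    have "(\<Sum>u\<in>F. \<Sum>v\<in>F. \<alpha> u * cnj (\<alpha> v) * \<phi> (0, int K - (fst u - fst v), int K + (fst u - fst v), 0,
        int K - (snd u - snd v), int K + (snd u - snd v))) = cinner ?X ?X"
      unfolding inner
      by (subst cinner_sum_left, intro sum.cong refl, subst cinner_sum_right)
        (simp add: cinner_scaleC_left cinner_scaleC_right mult.assoc mult.left_commute sum_distrib_left)
    then show "(\<Sum>u\<in>F. \<Sum>v\<in>F. \<alpha> u * cnj (\<alpha> v) * \<phi> (0, int K - (fst u - fst v), int K + (fst u - fst v), 0,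
        int K - (snd u - snd v), int K + (snd u - snd v))) \<in> \<real>\<^sub>\<ge>\<^sub>0"
      by (simp add: cinner_self complex_nonneg_Reals_iff del: of_real_power)
  qed
  ultimately show ?thesis by (simp add: extended_functional_def)
qed

lemma extended_solution_is_solution:
  assumes \<phi>: "associated_function (assemble h w gs) \<phi>" and \<mu>: "extended_moment_solution \<phi> \<mu>"
  shows "moment_solution s \<mu>"
  unfolding moment_solution_def
proof (intro conjI allI)
  show "sets \<mu> = sets borel" using \<mu> by (simp add: extended_moment_solution_def)
  fix m n
  have "\<phi> (m, 0, 0, n, 0, 0) = s m n"
    using \<phi>[unfolded associated_function_conj_sum, rule_format, of "(m, 0, 0, n, 0, 0)" "(0, 0, 0, 0, 0, 0)"]
    by (simp add: assemble_Omega0 gram_h)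
  moreover have "has_bochner_integral \<mu> (extended_monomial (m, 0, 0, n, 0, 0)) (\<phi> (m, 0, 0, n, 0, 0))"
    using \<mu> by (simp add: extended_moment_solution_def)
  ultimately show "has_bochner_integral \<mu> (\<lambda>(x\<^sub>1, x\<^sub>2). complex_of_real (x\<^sub>1 ^ m * x\<^sub>2 ^ n)) (s m n)"
    by (simp add: extended_monomial_eq[abs_def] case_prod_unfold)
qed

end

section \<open>The moment problem and the algorithm\<close>

text \<open>A sequence in \<open>bold_G\<close> yields an extended functional, hence exactly one measure; conversely, the
  extended moments of a solution are realised by a sequence in \<open>bold_G\<close>.\<close>

theorem theorem5:
  fixes s :: "nat \<Rightarrow> nat \<Rightarrow> complex"
    and h :: "nat \<Rightarrow> nat \<Rightarrow> 'a::separable_chilbert"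
    and H0 :: "'a set"
    and Hj :: "nat \<Rightarrow> 'a set"
    and e :: "nat \<Rightarrow> 'a"
    and N :: "nat set"
    and g :: "nat \<Rightarrow> 'a"
    and w :: "nat \<Rightarrow> idx"
    and M :: "nat \<Rightarrow> real"
  assumes "nonneg_moment_form s"
    and "model_space s h H0 Hj"
    and "\<And>j. j \<ge> 1 \<Longrightarrow> e j \<in> Hj j \<and> norm (e j) = 1"
    and "gram_schmidt_basis h N g"
    and "bij_betw w {1..} Omega'"
    and "admissible_bounds s w M"
  shows "((\<exists>\<mu>. moment_solution s \<mu>) \<longleftrightarrow> condition_a h \<and> bold_G h N g e w M \<noteq> {}) \<and>
    (condition_a h \<and> bold_G h N g e w M \<noteq> {} \<longrightarrow>
      (\<forall>gs \<in> bold_G h N g e w M.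
         assemble h w gs \<in> X_set h H0 Hj w \<and>
         (\<exists>!\<phi>. associated_function (assemble h w gs) \<phi>) \<and>
         (\<forall>\<phi>. associated_function (assemble h w gs) \<phi> \<longrightarrow>
            (\<exists>!\<mu>. extended_moment_solution \<phi> \<mu>) \<and>
            (\<forall>\<mu>. extended_moment_solution \<phi> \<mu> \<longrightarrow> moment_solution s \<mu>))) \<and>
      (\<forall>\<mu>. moment_solution s \<mu> \<longrightarrow>
         (\<exists>gs \<in> bold_G h N g e w M. \<exists>\<phi>.
            associated_function (assemble h w gs) \<phi> \<and> extended_moment_solution \<phi> \<mu>)))"
proof -
  interpret model s h H0 Hj e N g w M
    using assms(2-6) by unfold_locales
  have sound: "assemble h w gs \<in> X_set h H0 Hj w \<and>
      (\<exists>!\<phi>. associated_function (assemble h w gs) \<phi>) \<and>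
      (\<forall>\<phi>. associated_function (assemble h w gs) \<phi> \<longrightarrow>
        (\<exists>!\<mu>. extended_moment_solution \<phi> \<mu>) \<and>
        (\<forall>\<mu>. extended_moment_solution \<phi> \<mu> \<longrightarrow> moment_solution s \<mu>))"
    if "condition_a h" "gs \<in> bold_G h N g e w M" for gs
  proof (intro conjI allI impI)
    note eqs = bold_G_sound(1)[OF that]
    show "assemble h w gs \<in> X_set h H0 Hj w" by (rule assemble_in_X_set[OF that])
    show "\<exists>!\<phi>. associated_function (assemble h w gs) \<phi>"
      unfolding all_equations_associated_function[OF eqs] by blast
    fix \<phi> assume \<phi>: "associated_function (assemble h w gs) \<phi>"
    show "\<exists>!\<mu>. extended_moment_solution \<phi> \<mu>"
      using extended_moment_solution_exists[OF extended_functional_of_equations[OF eqs \<phi>]] extended_moment_solution_unique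
      by blast
    show "moment_solution s \<mu>" if "extended_moment_solution \<phi> \<mu>" for \<mu>
      by (rule extended_solution_is_solution[OF \<phi> that])
  qed
  have complete: "\<exists>gs \<in> bold_G h N g e w M. \<exists>\<phi>. associated_function (assemble h w gs) \<phi> \<and> extended_moment_solution \<phi> \<mu>"
    if "moment_solution s \<mu>" for \<mu>
    using solution_in_bold_G[OF that] extended_moment_solution_ext_moment[OF that] by blast
  have "(\<exists>\<mu>. moment_solution s \<mu>) \<longleftrightarrow> condition_a h \<and> bold_G h N g e w M \<noteq> {}"
  proof
    assume "\<exists>\<mu>. moment_solution s \<mu>"
    then show "condition_a h \<and> bold_G h N g e w M \<noteq> {}"
      using condition_a_of_solution solution_in_bold_G by blast
  next
    assume *: "condition_a h \<and> bold_G h N g e w M \<noteq> {}"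
    then obtain gs where "gs \<in> bold_G h N g e w M" by blast
    with * sound[of gs] show "\<exists>\<mu>. moment_solution s \<mu>" by blast
  qed
  moreover have "\<forall>gs \<in> bold_G h N g e w M.
      assemble h w gs \<in> X_set h H0 Hj w \<and>
      (\<exists>!\<phi>. associated_function (assemble h w gs) \<phi>) \<and>
      (\<forall>\<phi>. associated_function (assemble h w gs) \<phi> \<longrightarrow>
        (\<exists>!\<mu>. extended_moment_solution \<phi> \<mu>) \<and>
        (\<forall>\<mu>. extended_moment_solution \<phi> \<mu> \<longrightarrow> moment_solution s \<mu>))"
    if "condition_a h"
    using sound[OF that] by (intro ballI)
  ultimately show ?thesis using complete by (intro conjI impI allI) simp_all
qed

end
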